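(* Let $A\in\mathcal B(\mathcal H)$ be self-adjoint. The orbit $\mathcal O_A=\{uAu^*: u\in U_c(\mathcal H)\}\subset A+\mathcal K(\mathcal H)_h$ is a differentiable complemented submanifold of $A+\mathcal K(\mathcal H)_h$ and the map $\pi_A:U_c(\mathcal H)\to\mathcal O_A$, $\pi_A(u)=uAu^*$, is a submersion if and only if the spectrum of $A$ is finite.
   Context: $\mathcal H$ is a Hilbert space, $\mathcal B(\mathcal H)$ and $\mathcal K(\mathcal H)$ are the bounded and the compact operators on $\mathcal H$, $\mathcal K(\mathcal H)_h$ is the real Banach space of self-adjoint compact operators, and $U_c(\mathcal H)=\{u: u\text{ unitary},\ u-1\in\mathcal K(\mathcal H)\}$ is the unitary Fredholm group, a Banach-Lie group with Lie algebra the anti-hermitian compact operators. $A+\mathcal K(\mathcal H)_h$ is regarded as an affine Banach space. Complemented submanifold means that the tangent spaces are closed and complemented; a submersion is a smooth map whose differential at each point is surjective onto the tangent space of the target and has complemented kernel. *)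

theory Defs
  imports "HOL-Analysis.Analysis"
begin

section \<open>Complex Hilbert spaces and their operators\<close>

text \<open>The real inner product underlying the norm is the real part of the complex one, which is
  linear in its first argument.\<close>

class complex_hilbert_space = real_inner + banach +
  fixes scaleC :: "complex \<Rightarrow> 'a \<Rightarrow> 'a"  (infixr \<open>*\<^sub>C\<close> 75)
    and cinner :: "'a \<Rightarrow> 'a \<Rightarrow> complex"
  assumes scaleC_add_right: "c *\<^sub>C (x + y) = c *\<^sub>C x + c *\<^sub>C y"
    and scaleC_add_left: "(c + d) *\<^sub>C x = c *\<^sub>C x + d *\<^sub>C x"
    and scaleC_scaleC: "c *\<^sub>C (d *\<^sub>C x) = (c * d) *\<^sub>C x"
    and scaleC_of_real: "complex_of_real r *\<^sub>C x = r *\<^sub>R x"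
    and cinner_add_left: "cinner (x + y) z = cinner x z + cinner y z"
    and cinner_scaleC_left: "cinner (c *\<^sub>C x) y = c * cinner x y"
    and cinner_commute: "cinner x y = cnj (cinner y x)"
    and Re_cinner: "Re (cinner x y) = inner x y"

text \<open>The type \<open>'a \<Rightarrow>\<^sub>L 'a\<close> consists of the bounded real-linear operators; the complex-linear ones
  have to be singled out. The operator norm is the same.\<close>

definition bounded_ops :: "('a::complex_hilbert_space \<Rightarrow>\<^sub>L 'a) set" where
  "bounded_ops = {T :: 'a \<Rightarrow>\<^sub>L 'a. \<forall>c x. T (c *\<^sub>C x) = c *\<^sub>C T x}"

definition compact_ops :: "('a::complex_hilbert_space \<Rightarrow>\<^sub>L 'a) set" where
  "compact_ops = {T \<in> bounded_ops. compact (closure (blinfun_apply T ` cball 0 1))}"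

definition is_adjoint ::
    "('a::complex_hilbert_space \<Rightarrow>\<^sub>L 'a) \<Rightarrow> ('a \<Rightarrow>\<^sub>L 'a) \<Rightarrow> bool" where
  "is_adjoint T S \<longleftrightarrow> T \<in> bounded_ops \<and> S \<in> bounded_ops \<and>
     (\<forall>x y. cinner (T x) y = cinner x (S y))"

definition op_adjoint ::
    "('a::complex_hilbert_space \<Rightarrow>\<^sub>L 'a) \<Rightarrow> ('a \<Rightarrow>\<^sub>L 'a)"  (\<open>_\<^sup>\<star>\<close> [1000] 999) where
  "T\<^sup>\<star> = (THE S. is_adjoint T S)"

definition selfadjoint :: "('a::complex_hilbert_space \<Rightarrow>\<^sub>L 'a) \<Rightarrow> bool" where
  "selfadjoint T \<longleftrightarrow> is_adjoint T T"

definition unitary :: "('a::complex_hilbert_space \<Rightarrow>\<^sub>L 'a) \<Rightarrow> bool" where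
  "unitary u \<longleftrightarrow> u \<in> bounded_ops \<and>
     u\<^sup>\<star> o\<^sub>L u = id_blinfun \<and> u o\<^sub>L u\<^sup>\<star> = id_blinfun"

definition spectrum :: "('a::complex_hilbert_space \<Rightarrow>\<^sub>L 'a) \<Rightarrow> complex set" where
  "spectrum T = {z. \<not> (\<exists>S::'a \<Rightarrow>\<^sub>L 'a. S \<in> bounded_ops \<and>
     (\<forall>x. S (T x - z *\<^sub>C x) = x) \<and> (\<forall>x. T (S x) - z *\<^sub>C S x = x))}"

definition compact_sa_ops :: "('a::complex_hilbert_space \<Rightarrow>\<^sub>L 'a) set" where
  "compact_sa_ops = {K \<in> compact_ops. selfadjoint K}"

definition unitary_fredholm :: "('a::complex_hilbert_space \<Rightarrow>\<^sub>L 'a) set" where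
  "unitary_fredholm = {u. unitary u \<and> u - id_blinfun \<in> compact_ops}"

definition orbit_map ::
    "('a::complex_hilbert_space \<Rightarrow>\<^sub>L 'a) \<Rightarrow> ('a \<Rightarrow>\<^sub>L 'a) \<Rightarrow> ('a \<Rightarrow>\<^sub>L 'a)" where
  "orbit_map A u = u o\<^sub>L A o\<^sub>L u\<^sup>\<star>"

definition unitary_orbit ::
    "('a::complex_hilbert_space \<Rightarrow>\<^sub>L 'a) \<Rightarrow> ('a \<Rightarrow>\<^sub>L 'a) set" where
  "unitary_orbit A = orbit_map A ` unitary_fredholm"

section \<open>Submanifolds of affine Banach spaces\<close>

text \<open>An affine Banach space is given as a translate \<open>E\<close> of a closed linear subspace of an ambient
  Banach space. That subspace need not be complemented (the compact operators are not complemented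
  in the bounded ones), so derivatives on \<open>E\<close> are only defined on the direction of \<open>E\<close>.\<close>

definition direction :: "'b::real_normed_vector set \<Rightarrow> 'b set" where
  "direction E = {x - y | x y. x \<in> E \<and> y \<in> E}"

text \<open>\<open>smooth_on V U f\<close>, for \<open>U\<close> relatively open in a translate of the subspace \<open>V\<close>, says that \<open>f\<close> is
  infinitely often Frechet differentiable on \<open>U\<close>. The map taking a list \<open>vs\<close> of \<open>n\<close> vectors of \<open>V\<close> to
  \<open>D x vs\<close> is the \<open>n\<close>-th derivative at \<open>x\<close>: a bounded \<open>n\<close>-linear map on \<open>V\<close>. Each is, with respect
  to the norm of bounded \<open>n\<close>-linear maps, the Frechet derivative of the preceding one.\<close>

definition multilinear_on ::
    "'b::real_normed_vector set \<Rightarrow> ('b list \<Rightarrow> 'c::real_normed_vector) \<Rightarrow> bool" where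
  "multilinear_on V m \<longleftrightarrow> (\<forall>us v w ws r s. set us \<subseteq> V \<and> v \<in> V \<and> w \<in> V \<and> set ws \<subseteq> V \<longrightarrow>
     m (us @ (r *\<^sub>R v + s *\<^sub>R w) # ws) = r *\<^sub>R m (us @ v # ws) + s *\<^sub>R m (us @ w # ws))"

definition smooth_on ::
    "'b::real_normed_vector set \<Rightarrow> 'b set \<Rightarrow> ('b \<Rightarrow> 'c::real_normed_vector) \<Rightarrow> bool" where
  "smooth_on V U f \<longleftrightarrow> (\<exists>D :: 'b \<Rightarrow> 'b list \<Rightarrow> 'c.
     (\<forall>x\<in>U. D x [] = f x \<and> multilinear_on V (D x) \<and>
       (\<forall>n. \<exists>C. \<forall>vs. length vs = n \<and> set vs \<subseteq> V \<longrightarrow>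
          norm (D x vs) \<le> C * prod_list (map norm vs)) \<and>
       (\<forall>n. \<forall>\<epsilon>>0. \<exists>\<delta>>0. \<forall>y\<in>U. norm (y - x) < \<delta> \<longrightarrow>
          (\<forall>vs. length vs = n \<and> set vs \<subseteq> V \<longrightarrow>
             norm (D y vs - D x vs - D x ((y - x) # vs))
               \<le> \<epsilon> * norm (y - x) * prod_list (map norm vs)))))"

text \<open>A chart of \<open>E\<close> around \<open>x\<close> that flattens \<open>M\<close> onto the closed subspace \<open>F\<close>.\<close>

definition submanifold_chart ::
    "'b::real_normed_vector set \<Rightarrow> 'b set \<Rightarrow> 'b \<Rightarrow> 'b set \<Rightarrow> ('b \<Rightarrow> 'b) \<Rightarrow> 'b set \<Rightarrow> bool" where
  "submanifold_chart E M x U \<phi> F \<longleftrightarrow>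
     openin (top_of_set E) U \<and> x \<in> U \<and>
     openin (top_of_set (direction E)) (\<phi> ` U) \<and> inj_on \<phi> U \<and>
     smooth_on (direction E) U \<phi> \<and> smooth_on (direction E) (\<phi> ` U) (inv_into U \<phi>) \<and>
     subspace F \<and> closed F \<and> F \<subseteq> direction E \<and>
     \<phi> ` (U \<inter> M) = \<phi> ` U \<inter> F"

definition submanifold :: "'b::real_normed_vector set \<Rightarrow> 'b set \<Rightarrow> bool" where
  "submanifold E M \<longleftrightarrow> M \<subseteq> E \<and> (\<forall>x\<in>M. \<exists>U \<phi> F. submanifold_chart E M x U \<phi> F)"

definition smooth_curve ::
    "'b::real_normed_vector set \<Rightarrow> 'b \<Rightarrow> 'b \<Rightarrow> (real \<Rightarrow> 'b) \<Rightarrow> bool" where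
  "smooth_curve M x v \<gamma> \<longleftrightarrow> (\<exists>e>0. smooth_on UNIV {-e<..<e} \<gamma> \<and> \<gamma> ` {-e<..<e} \<subseteq> M) \<and>
     \<gamma> 0 = x \<and> (\<gamma> has_vector_derivative v) (at 0)"

definition tangent_space :: "'b::real_normed_vector set \<Rightarrow> 'b \<Rightarrow> 'b set" where
  "tangent_space M x = {v. \<exists>\<gamma>. smooth_curve M x v \<gamma>}"

definition closed_complemented :: "'b::real_normed_vector set \<Rightarrow> 'b set \<Rightarrow> bool" where
  "closed_complemented V W \<longleftrightarrow> subspace W \<and> closed W \<and> W \<subseteq> V \<and>
     (\<exists>C. subspace C \<and> closed C \<and> C \<subseteq> V \<and> W \<inter> C = {0} \<and>
       V = {w + c | w c. w \<in> W \<and> c \<in> C})"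

definition complemented_submanifold :: "'b::real_normed_vector set \<Rightarrow> 'b set \<Rightarrow> bool" where
  "complemented_submanifold E M \<longleftrightarrow> submanifold E M \<and>
     (\<forall>x\<in>M. closed_complemented (direction E) (tangent_space M x))"

text \<open>In the next definitions \<open>M\<close> is a submanifold of \<open>E\<close> and \<open>N\<close> a submanifold of \<open>E'\<close>.\<close>

definition smooth_map ::
    "'b::real_normed_vector set \<Rightarrow> 'b set \<Rightarrow> 'c::real_normed_vector set \<Rightarrow> 'c set
      \<Rightarrow> ('b \<Rightarrow> 'c) \<Rightarrow> bool" where
  "smooth_map E M E' N f \<longleftrightarrow> f ` M \<subseteq> N \<and>
     (\<forall>x\<in>M. \<exists>U \<phi> F W \<psi> G.
        submanifold_chart E M x U \<phi> F \<and> submanifold_chart E' N (f x) W \<psi> G \<and>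
        f ` (U \<inter> M) \<subseteq> W \<and> smooth_on F (\<phi> ` (U \<inter> M)) (\<psi> \<circ> f \<circ> inv_into U \<phi>))"

definition differential ::
    "'b::real_normed_vector set \<Rightarrow> ('b \<Rightarrow> 'c::real_normed_vector) \<Rightarrow> 'b \<Rightarrow> 'b \<Rightarrow> 'c" where
  "differential M f x v =
     (THE w. \<forall>\<gamma>. smooth_curve M x v \<gamma> \<longrightarrow> (f \<circ> \<gamma> has_vector_derivative w) (at 0))"

definition submersion ::
    "'b::real_normed_vector set \<Rightarrow> 'b set \<Rightarrow> 'c::real_normed_vector set \<Rightarrow> 'c set
      \<Rightarrow> ('b \<Rightarrow> 'c) \<Rightarrow> bool" where
  "submersion E M E' N f \<longleftrightarrow> smooth_map E M E' N f \<and>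
     (\<forall>x\<in>M. differential M f x ` tangent_space M x = tangent_space N (f x) \<and>
        closed_complemented (tangent_space M x)
          {v \<in> tangent_space M x. differential M f x v = 0})"

text \<open>The manifold structure of the unitary Fredholm group is the one it has as a submanifold of
  the affine Banach space \<open>unitary_fredholm_space\<close>, the translate of the space of compact operators
  through the identity.\<close>

definition unitary_fredholm_space :: "('a::complex_hilbert_space \<Rightarrow>\<^sub>L 'a) set" where
  "unitary_fredholm_space = (+) id_blinfun ` compact_ops"

definition orbit_space ::
    "('a::complex_hilbert_space \<Rightarrow>\<^sub>L 'a) \<Rightarrow> ('a \<Rightarrow>\<^sub>L 'a) set" where
  "orbit_space A = (+) A ` compact_sa_ops"

end

theory Submission
  imports Defs "HOL-Computational_Algebra.Fundamental_Theorem_Algebra"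
begin

text \<open>The differential of the orbit map at \<open>u\<close> takes the tangent vector \<open>u x\<close>, where \<open>x\<close> is compact and
  anti-hermitian, to \<open>u (x A - A x) u\<^sup>\<star>\<close>. So the theorem is about the commutator map \<open>x \<mapsto> x A - A x\<close>.

  Suppose that the orbit is a complemented submanifold and the orbit map a submersion. Then the range of
  the commutator map is a tangent space of the orbit, hence closed, and by the open mapping theorem each
  \<open>y\<close> in the range has a preimage of norm at most \<open>C \<parallel>y\<parallel>\<close>. An infinite spectrum would contain distinct
  points \<open>a\<close> and \<open>b\<close> as close together as one likes. For approximate unit eigenvectors \<open>v\<close> and \<open>w\<close> the
  operator \<open>x = v \<otimes> w - w \<otimes> v\<close> has a commutator of the size of \<open>a - b\<close>, but each operator with the same
  commutator has an entry at \<open>(v, w)\<close> of modulus about one. This contradiction is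
  \<open>closed_commutator_range_imp_finite_spectrum\<close>.

  Suppose now that the spectrum is finite. Then \<open>A\<close> is annihilated by a polynomial with simple real roots,
  and Lagrange interpolation gives \<open>A = \<Sum> a p\<^sub>a\<close> with orthogonal projections (\<open>spectral_decomposition\<close>).
  On block matrices the commutator multiplies the entry at \<open>(a, b)\<close> by \<open>b - a\<close>. Its range consists of the
  operators with zero diagonal, and its kernel of the block diagonal ones; both are complemented. The map
  that conjugates \<open>A + c\<close>, with \<open>c\<close> block diagonal, by the Cayley transform of an operator determined by the
  off-diagonal part of its argument has the identity as its derivative at zero. By the inverse function
  theorem it parametrizes a neighbourhood of \<open>A\<close> (\<open>orbit_chart_exists\<close>), and in it the orbit is given by
  \<open>c = 0\<close>, because for small nonzero \<open>c\<close> the operator \<open>A + c\<close> does not lie in the orbit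
  (\<open>commuting_perturbation_in_orbit\<close>). Conjugation carries this chart to all points of the orbit.

  The unitary Fredholm group has the Cayley transform as a chart. All charts and coordinate expressions are
  rational expressions in operators and in a local inverse whose derivative is again such an expression.
  The class of these expressions, with vectors inserted, is closed under differentiation, which gives all
  higher derivatives together (\<open>rat_smooth_on\<close>).\<close>

section \<open>The real adjoint on a Hilbert space\<close>

text \<open>The approximating sequence is Cauchy by the parallelogram law, and the minimality of the
  distance forces orthogonality.\<close>

lemma orthogonal_projection_exists:
  fixes x :: "'a::{real_inner,banach}"
  assumes S: "subspace S" "closed S"
  shows "\<exists>p\<in>S. \<forall>s\<in>S. inner (x - p) s = 0"
proof -
  define d where "d = infdist x S"
  have ne: "S \<noteq> {}" using S subspace_0 by blast
  have d0: "d \<ge> 0" by (simp add: d_def infdist_nonneg)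
  have dle: "d \<le> norm (x - s)" if "s \<in> S" for s
    using infdist_le[OF that, of x] by (simp add: d_def dist_norm)
  have "\<exists>s\<in>S. norm (x - s) < d + 1 / real (Suc n)" for n
  proof -
    have "(INF a\<in>S. dist x a) < d + 1 / real (Suc n)"
      using ne by (simp add: d_def infdist_def)
    then show ?thesis
      using ne by (subst (asm) cINF_less_iff) (auto simp: dist_norm intro: bdd_belowI2[of _ 0])
  qed
  then obtain p where p: "\<And>n. p n \<in> S" "\<And>n. norm (x - p n) < d + 1 / real (Suc n)" by metis
  \<comment> \<open>The parallelogram law, with the midpoint of \<open>p m\<close> and \<open>p n\<close> at distance at least \<open>d\<close> from \<open>x\<close>.\<close>
  have par: "(norm (p m - p n))\<^sup>2 \<le> 2 * (norm (x - p m))\<^sup>2 + 2 * (norm (x - p n))\<^sup>2 - 4 * d\<^sup>2" for m n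
  proof -
    have "(1/2) *\<^sub>R (p m + p n) \<in> S" using p S by (simp add: subspace_add subspace_scale)
    then have "d\<^sup>2 \<le> (norm (x - (1/2) *\<^sub>R (p m + p n)))\<^sup>2" using dle d0 by (simp add: power_mono)
    moreover have "(norm (p m - p n))\<^sup>2 = 2 * (norm (x - p m))\<^sup>2 + 2 * (norm (x - p n))\<^sup>2
        - 4 * (norm (x - (1/2) *\<^sub>R (p m + p n)))\<^sup>2"
      by (simp add: power2_norm_eq_inner inner_diff inner_add inner_commute algebra_simps)
    ultimately show ?thesis by linarith
  qed
  have sq: "(d + 1 / real (Suc n))\<^sup>2 \<le> d\<^sup>2 + (2 * d + 1) / real (Suc N)" if "N \<le> n" for n N
  proof -
    have "(1 / real (Suc n))\<^sup>2 \<le> 1 / real (Suc n)" by (simp add: power2_eq_square divide_le_eq)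
    then have "(d + 1 / real (Suc n))\<^sup>2 \<le> d\<^sup>2 + (2 * d + 1) * (1 / real (Suc n))"
      by (simp add: power2_sum algebra_simps)
    also have "\<dots> \<le> d\<^sup>2 + (2 * d + 1) * (1 / real (Suc N))"
      using that d0 by (intro add_left_mono mult_left_mono frac_le) auto
    finally show ?thesis by simp
  qed
  have "Cauchy p"
    unfolding Cauchy_iff
  proof (intro allI impI)
    fix e :: real assume e: "e > 0"
    obtain N where N: "4 * (2 * d + 1) / e\<^sup>2 < real N" using reals_Archimedean2 by blast
    have "norm (p m - p n) < e" if "m \<ge> N" "n \<ge> N" for m n
    proof -
      have le: "(norm (x - p k))\<^sup>2 \<le> d\<^sup>2 + (2 * d + 1) / real (Suc N)" if "k \<ge> N" for k
        using power_mono[OF less_imp_le[OF p(2)[of k]], of 2] sq[OF that] by simp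
      have "(norm (p m - p n))\<^sup>2 \<le> 4 * ((2 * d + 1) / real (Suc N))"
        using par[of m n] le[OF that(1)] le[OF that(2)] by linarith
      also have "\<dots> < e\<^sup>2"
      proof -
        have "4 * (2 * d + 1) < real N * e\<^sup>2" using N e by (simp add: pos_divide_less_eq)
        also have "\<dots> \<le> real (Suc N) * e\<^sup>2" by (intro mult_right_mono) auto
        finally show ?thesis by (simp add: divide_less_eq mult.commute)
      qed
      finally show ?thesis using e power_less_imp_less_base by fastforce
    qed
    then show "\<exists>M. \<forall>m\<ge>M. \<forall>n\<ge>M. norm (p m - p n) < e" by blast
  qed
  then obtain q where q: "p \<longlonglongrightarrow> q" using Cauchy_convergent convergent_def by blast
  have qS: "q \<in> S" using closed_sequentially[OF S(2) _ q] p by blast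
  have "norm (x - q) \<le> d"
  proof (rule LIMSEQ_le)
    show "(\<lambda>n. norm (x - p n)) \<longlonglongrightarrow> norm (x - q)" by (intro tendsto_intros q)
    show "(\<lambda>n. d + 1 / real (Suc n)) \<longlonglongrightarrow> d"
      using tendsto_add[OF tendsto_const LIMSEQ_inverse_real_of_nat, of d] by (simp add: inverse_eq_divide)
    show "\<exists>N. \<forall>n\<ge>N. norm (x - p n) \<le> d + 1 / real (Suc n)" using p(2) less_imp_le by blast
  qed
  then have min: "(norm (x - q))\<^sup>2 \<le> (norm (x - s))\<^sup>2" if "s \<in> S" for s
    using dle[OF that] by (intro power_mono) auto
  have "inner (x - q) s = 0" if s: "s \<in> S" for s
  proof (cases "s = 0")
    case False
    \<comment> \<open>The best approximation of \<open>x\<close> by points \<open>q + t s\<close> of the line through \<open>q\<close>.\<close>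
    define t where "t = inner (x - q) s / inner s s"
    have "(norm (x - q))\<^sup>2 \<le> (norm (x - (q + t *\<^sub>R s)))\<^sup>2"
      using min s qS S by (simp add: subspace_add subspace_scale)
    also have "\<dots> = (norm (x - q))\<^sup>2 - 2 * t * inner (x - q) s + t * t * inner s s"
      by (simp add: power2_norm_eq_inner inner_diff inner_add inner_commute algebra_simps)
    also have "\<dots> = (norm (x - q))\<^sup>2 - (inner (x - q) s)\<^sup>2 / inner s s"
      using False by (simp add: t_def field_simps power2_eq_square)
    finally have "(inner (x - q) s)\<^sup>2 / inner s s \<le> 0" by simp
    moreover have "inner s s > 0" using False by simp
    ultimately show ?thesis by (simp add: divide_le_0_iff)
  qed simp
  with qS show ?thesis by blast
qed

text \<open>A vector orthogonal to the kernel represents \<open>f\<close> up to a scalar.\<close>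

lemma riesz_representation:
  fixes f :: "'a::{real_inner,banach} \<Rightarrow> real"
  assumes f: "bounded_linear f"
  shows "\<exists>z. \<forall>x. f x = inner x z"
proof (cases "\<forall>x. f x = 0")
  case True
  then show ?thesis by (intro exI[of _ 0]) simp
next
  case False
  interpret f: bounded_linear f by fact
  define S where "S = {x. f x = 0}"
  have "subspace S" by (auto simp: S_def subspace_def f.add f.scaleR)
  moreover have "closed S"
    unfolding S_def by (intro closed_Collect_eq continuous_intros f.continuous_on)
  moreover obtain x0 where x0: "f x0 \<noteq> 0" using False by blast
  ultimately obtain p where p: "p \<in> S" "\<And>s. s \<in> S \<Longrightarrow> inner (x0 - p) s = 0"
    using orthogonal_projection_exists by blast
  define w where "w = x0 - p"
  have fw: "f w \<noteq> 0" using p x0 by (simp add: w_def f.diff S_def)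
  then have w: "w \<noteq> 0" using f.zero by auto
  have "f x = inner x ((f w / inner w w) *\<^sub>R w)" for x
  proof -
    have "f x *\<^sub>R w - f w *\<^sub>R x \<in> S" by (simp add: S_def f.diff f.scaleR)
    then have "inner w (f x *\<^sub>R w - f w *\<^sub>R x) = 0" using p by (simp add: w_def)
    then have "f x * inner w w = f w * inner w x" by (simp add: inner_diff)
    then show ?thesis using w by (simp add: field_simps inner_commute)
  qed
  then show ?thesis by blast
qed

lemma adjoint_exists:
  fixes T :: "'a::{real_inner,banach} \<Rightarrow>\<^sub>L 'a"
  shows "\<exists>S :: 'a \<Rightarrow>\<^sub>L 'a. \<forall>x y. inner (T x) y = inner x (S y)"
proof -
  have "\<forall>y. \<exists>z. \<forall>x. inner (T x) y = inner x z"
  proof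
    fix y
    have "bounded_linear (\<lambda>x. inner (T x) y)"
      by (intro bounded_linear_intros)
    then show "\<exists>z. \<forall>x. inner (T x) y = inner x z" by (rule riesz_representation)
  qed
  then obtain s where s: "\<And>x y. inner (T x) y = inner x (s y)" by metis
  have "bounded_linear s"
  proof (rule bounded_linear_intro[where K = "norm T"])
    show "s (x + y) = s x + s y" for x y
      by (rule vector_eq_ldot[THEN iffD1]) (simp add: inner_add flip: s)
    show "s (r *\<^sub>R x) = r *\<^sub>R s x" for r x
      by (rule vector_eq_ldot[THEN iffD1]) (simp flip: s)
    show "norm (s y) \<le> norm y * norm T" for y
    proof (cases "s y = 0")
      case False
      have "norm (s y) * norm (s y) = inner (T (s y)) y"
        by (simp add: s flip: power2_norm_eq_inner power2_eq_square)
      also have "\<dots> \<le> norm (T (s y)) * norm y" by (rule norm_cauchy_schwarz)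
      also have "\<dots> \<le> norm T * norm (s y) * norm y"
        by (intro mult_right_mono norm_blinfun) simp
      finally show ?thesis using False by (simp add: mult.assoc mult.left_commute[of "norm T"] mult.commute)
    qed simp
  qed
  then show ?thesis using s by (metis bounded_linear_Blinfun_apply)
qed

text \<open>The adjoint for the real inner product, on all bounded real-linear operators: as a total,
  bounded linear map it fits into differential calculus, and it is the Hilbert space adjoint on the
  complex-linear operators.\<close>

definition radj :: "('a::{real_inner,banach} \<Rightarrow>\<^sub>L 'a) \<Rightarrow> ('a \<Rightarrow>\<^sub>L 'a)" where
  "radj T = (SOME S :: 'a \<Rightarrow>\<^sub>L 'a. \<forall>x y. inner (T x) y = inner x (S y))"

lemma inner_radj:
  fixes T :: "'a::{real_inner,banach} \<Rightarrow>\<^sub>L 'a"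
  shows "inner (T x) y = inner x (radj T y)"
  unfolding radj_def using someI_ex[OF adjoint_exists[of T]] by blast

lemma radj_eqI:
  fixes T S :: "'a::{real_inner,banach} \<Rightarrow>\<^sub>L 'a"
  assumes "\<And>x y. inner (T x) y = inner x (S y)"
  shows "radj T = S"
proof (rule blinfun_eqI)
  fix y
  show "radj T y = S y"
    by (rule vector_eq_ldot[THEN iffD1]) (simp flip: inner_radj add: assms)
qed

lemma radj_radj [simp]: "radj (radj T) = T"
  by (rule radj_eqI) (metis inner_commute inner_radj)

lemma radj_compose [simp]: "radj (S o\<^sub>L T) = radj T o\<^sub>L radj S"
  by (rule radj_eqI) (simp add: inner_radj)

lemma radj_id [simp]: "radj id_blinfun = id_blinfun"
  by (rule radj_eqI) simp

lemma radj_add: "radj (S + T) = radj S + radj T"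
  by (rule radj_eqI) (simp add: inner_radj blinfun.bilinear_simps inner_add)

lemma radj_scaleR: "radj (r *\<^sub>R T) = r *\<^sub>R radj T"
  by (rule radj_eqI) (simp add: inner_radj blinfun.bilinear_simps)

lemma norm_radj_le: "norm (radj T) \<le> norm T"
proof (rule norm_blinfun_bound)
  fix y
  show "norm (radj T y) \<le> norm T * norm y"
  proof (cases "radj T y = 0")
    case False
    have "norm (radj T y) * norm (radj T y) = inner (T (radj T y)) y"
      by (simp add: inner_radj flip: power2_norm_eq_inner power2_eq_square)
    also have "\<dots> \<le> norm (T (radj T y)) * norm y" by (rule norm_cauchy_schwarz)
    also have "\<dots> \<le> norm T * norm (radj T y) * norm y"
      by (intro mult_right_mono norm_blinfun) simp
    finally show ?thesis using False by (simp add: mult.assoc mult.left_commute[of "norm T"] mult.commute)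
  qed simp
qed simp

lemma bounded_linear_radj: "bounded_linear radj"
  by (rule bounded_linear_intro[where K = 1]) (simp_all add: radj_add radj_scaleR norm_radj_le)

lemma radj_zero [simp]: "radj 0 = 0"
  by (rule linear_simps(3)[OF bounded_linear_radj])

lemma radj_diff: "radj (S - T) = radj S - radj T"
  by (rule linear_simps(2)[OF bounded_linear_radj])

lemma radj_sum: "radj (\<Sum>i\<in>I. T i) = (\<Sum>i\<in>I. radj (T i))"
  by (induction I rule: infinite_finite_induct) (simp_all add: radj_add)

section \<open>Complex-linear operators\<close>

lemma compose_assoc: "(R o\<^sub>L S) o\<^sub>L T = R o\<^sub>L (S o\<^sub>L T)"
  by (rule blinfun_eqI) simp

lemmas compose_simps =
  bounded_bilinear_blinfun_compose[THEN bounded_bilinear.add_left]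
  bounded_bilinear_blinfun_compose[THEN bounded_bilinear.add_right]
  bounded_bilinear_blinfun_compose[THEN bounded_bilinear.diff_left]
  bounded_bilinear_blinfun_compose[THEN bounded_bilinear.diff_right]
  bounded_bilinear_blinfun_compose[THEN bounded_bilinear.minus_left]
  bounded_bilinear_blinfun_compose[THEN bounded_bilinear.minus_right]
  bounded_bilinear_blinfun_compose[THEN bounded_bilinear.scaleR_left]
  bounded_bilinear_blinfun_compose[THEN bounded_bilinear.scaleR_right]
  bounded_bilinear_blinfun_compose[THEN bounded_bilinear.sum_left]
  bounded_bilinear_blinfun_compose[THEN bounded_bilinear.sum_right]
  compose_assoc

lemma compose_id [simp]: "T o\<^sub>L id_blinfun = T" "id_blinfun o\<^sub>L T = T"
  by (auto intro: blinfun_eqI)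

lemma scaleC_one [simp]: "(1::complex) *\<^sub>C x = x"
  using scaleC_of_real[of 1 x] by simp

lemma scaleC_scaleR: "c *\<^sub>C (r *\<^sub>R x) = r *\<^sub>R (c *\<^sub>C x)"
  by (simp add: scaleC_scaleC mult.commute flip: scaleC_of_real)

lemma cinner_scaleC_right: "cinner x (c *\<^sub>C y) = cnj c * cinner x y"
  by (metis cinner_commute cinner_scaleC_left complex_cnj_mult)

lemma inner_scaleC_left: "inner (c *\<^sub>C x) y = inner x (cnj c *\<^sub>C y)"
  by (simp add: cinner_scaleC_left cinner_scaleC_right flip: Re_cinner)

lemma cinner_eq_Complex: "cinner x y = Complex (inner x y) (inner x (\<i> *\<^sub>C y))"
  by (simp add: complex_eq_iff Re_cinner) (simp add: cinner_scaleC_right flip: Re_cinner)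

lemma norm_scaleC: "norm (c *\<^sub>C x) = cmod c * norm x"
proof (rule power2_eq_imp_eq)
  have "cnj c * c = complex_of_real ((cmod c)\<^sup>2)"
    by (metis complex_norm_square mult.commute)
  then show "(norm (c *\<^sub>C x))\<^sup>2 = (cmod c * norm x)\<^sup>2"
    by (simp add: power2_norm_eq_inner inner_scaleC_left scaleC_scaleC scaleC_of_real power_mult_distrib)
qed simp_all

lemma bounded_linear_scaleC_right: "bounded_linear (\<lambda>x. c *\<^sub>C x)"
  by (rule bounded_linear_intro[where K = "cmod c"])
    (simp_all add: scaleC_add_right scaleC_scaleR norm_scaleC)

definition cscalar :: "complex \<Rightarrow> 'a::complex_hilbert_space \<Rightarrow>\<^sub>L 'a" where
  "cscalar c = Blinfun (\<lambda>x. c *\<^sub>C x)"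

lemma cscalar_apply [simp]: "cscalar c x = c *\<^sub>C x"
  by (simp add: cscalar_def bounded_linear_Blinfun_apply bounded_linear_scaleC_right)

lemma radj_cscalar: "radj (cscalar c) = cscalar (cnj c)"
  by (rule radj_eqI) (simp add: inner_scaleC_left)

lemma mem_bounded_ops: "T \<in> bounded_ops \<longleftrightarrow> (\<forall>c. T o\<^sub>L cscalar c = cscalar c o\<^sub>L T)"
proof -
  have "T o\<^sub>L cscalar c = cscalar c o\<^sub>L T \<longleftrightarrow> (\<forall>x. T (c *\<^sub>C x) = c *\<^sub>C T x)" for c
    by (metis blinfun_apply_blinfun_compose blinfun_eqI cscalar_apply)
  then show ?thesis by (simp add: bounded_ops_def)
qed

lemma bounded_ops_zero [simp]: "0 \<in> bounded_ops"
  by (simp add: mem_bounded_ops)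

lemma bounded_ops_id [simp]: "id_blinfun \<in> bounded_ops"
  by (simp add: mem_bounded_ops)

lemma bounded_ops_cscalar [simp]: "cscalar c \<in> bounded_ops"
  by (auto simp: bounded_ops_def scaleC_scaleC mult.commute)

lemma bounded_ops_add: "S \<in> bounded_ops \<Longrightarrow> T \<in> bounded_ops \<Longrightarrow> S + T \<in> bounded_ops"
  by (simp add: mem_bounded_ops compose_simps)

lemma bounded_ops_diff: "S \<in> bounded_ops \<Longrightarrow> T \<in> bounded_ops \<Longrightarrow> S - T \<in> bounded_ops"
  by (simp add: mem_bounded_ops compose_simps)

lemma bounded_ops_scaleR: "T \<in> bounded_ops \<Longrightarrow> r *\<^sub>R T \<in> bounded_ops"
  by (simp add: mem_bounded_ops compose_simps)

lemma bounded_ops_compose: "S \<in> bounded_ops \<Longrightarrow> T \<in> bounded_ops \<Longrightarrow> S o\<^sub>L T \<in> bounded_ops"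
  by (metis mem_bounded_ops compose_assoc)

lemma bounded_ops_radj:
  assumes "T \<in> bounded_ops"
  shows "radj T \<in> bounded_ops"
  unfolding mem_bounded_ops
proof
  fix c
  have "radj (T o\<^sub>L cscalar (cnj c)) = radj (cscalar (cnj c) o\<^sub>L T)"
    using assms unfolding mem_bounded_ops by metis
  then show "radj T o\<^sub>L cscalar c = cscalar c o\<^sub>L radj T" by (simp add: radj_cscalar)
qed

lemma bounded_ops_inverse:
  assumes "T \<in> bounded_ops" "S o\<^sub>L T = id_blinfun" "T o\<^sub>L S = id_blinfun"
  shows "S \<in> bounded_ops"
  unfolding mem_bounded_ops
proof
  fix c
  have "S o\<^sub>L (T o\<^sub>L cscalar c) o\<^sub>L S = S o\<^sub>L (cscalar c o\<^sub>L T) o\<^sub>L S"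
    using assms(1) unfolding mem_bounded_ops by metis
  then show "S o\<^sub>L cscalar c = cscalar c o\<^sub>L S"
    using assms(2,3) by (metis compose_assoc compose_id)
qed

lemma closed_bounded_ops: "closed (bounded_ops :: ('a::complex_hilbert_space \<Rightarrow>\<^sub>L 'a) set)"
proof -
  have "bounded_ops = (\<Inter>c. {T :: 'a \<Rightarrow>\<^sub>L 'a. T o\<^sub>L cscalar c = cscalar c o\<^sub>L T})"
    by (auto simp: mem_bounded_ops)
  moreover have "closed {T :: 'a \<Rightarrow>\<^sub>L 'a. T o\<^sub>L cscalar c = cscalar c o\<^sub>L T}" for c
    by (intro closed_Collect_eq continuous_intros)
  ultimately show ?thesis by (metis (no_types, lifting) closed_INT)
qed

text \<open>The real part determines a complex inner product that is linear in one variable, so the adjoint for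
  the real inner product is also the one for the complex inner product.\<close>

lemma is_adjoint_iff: "is_adjoint T S \<longleftrightarrow> T \<in> bounded_ops \<and> S = radj T"
proof
  assume *: "is_adjoint T S"
  then have "radj T = S"
    by (intro radj_eqI) (simp add: is_adjoint_def flip: Re_cinner)
  then show "T \<in> bounded_ops \<and> S = radj T" using * by (simp add: is_adjoint_def)
next
  assume T: "T \<in> bounded_ops \<and> S = radj T"
  then have S: "S \<in> bounded_ops" by (simp add: bounded_ops_radj)
  then have "S (c *\<^sub>C x) = c *\<^sub>C S x" for c x by (simp add: bounded_ops_def)
  with T S show "is_adjoint T S"
    by (auto simp: is_adjoint_def cinner_eq_Complex inner_radj)
qed

lemma op_adjoint_eq_radj: "T \<in> bounded_ops \<Longrightarrow> T\<^sup>\<star> = radj T"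
  by (simp add: op_adjoint_def is_adjoint_iff)

lemma selfadjoint_iff: "selfadjoint T \<longleftrightarrow> T \<in> bounded_ops \<and> radj T = T"
  by (auto simp: selfadjoint_def is_adjoint_iff)

lemma unitary_iff:
  "unitary u \<longleftrightarrow> u \<in> bounded_ops \<and> radj u o\<^sub>L u = id_blinfun \<and> u o\<^sub>L radj u = id_blinfun"
  by (auto simp: unitary_def op_adjoint_eq_radj)

section \<open>Compact operators\<close>

lemma compact_closure_iff_totally_bounded:
  fixes S :: "'a::banach set"
  shows "compact (closure S) \<longleftrightarrow> (\<forall>e>0. \<exists>k. finite k \<and> S \<subseteq> (\<Union>x\<in>k. ball x e))"
proof
  assume "compact (closure S)"
  then show "\<forall>e>0. \<exists>k. finite k \<and> S \<subseteq> (\<Union>x\<in>k. ball x e)"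
    unfolding compact_eq_totally_bounded using closure_subset[of S] by (meson order_trans)
next
  assume *: "\<forall>e>0. \<exists>k. finite k \<and> S \<subseteq> (\<Union>x\<in>k. ball x e)"
  have "\<exists>k. finite k \<and> closure S \<subseteq> (\<Union>x\<in>k. ball x e)" if e: "e > 0" for e :: real
  proof -
    have "e / 2 > 0" using e by simp
    then obtain k where k: "finite k" "S \<subseteq> (\<Union>x\<in>k. ball x (e / 2))" using * by blast
    have "closure S \<subseteq> (\<Union>x\<in>k. cball x (e / 2))"
    proof (rule closure_minimal)
      show "S \<subseteq> (\<Union>x\<in>k. cball x (e / 2))" 
        by (rule order_trans[OF k(2)]) (intro UN_mono ball_subset_cball order_refl)
      show "closed (\<Union>x\<in>k. cball x (e / 2))" using k(1) by (intro closed_UN) auto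
    qed
    also have "\<dots> \<subseteq> (\<Union>x\<in>k. ball x e)"
      using e by (intro UN_mono order_refl) auto
    finally show ?thesis using k(1) by blast
  qed
  then show "compact (closure S)"
    unfolding compact_eq_totally_bounded by (simp add: complete_eq_closed)
qed

lemma compact_ops_iff:
  "T \<in> compact_ops \<longleftrightarrow> T \<in> bounded_ops \<and>
    (\<forall>e>0. \<exists>k. finite k \<and> (\<forall>x. norm x \<le> 1 \<longrightarrow> (\<exists>a\<in>k. norm (T x - a) < e)))"
proof -
  have "blinfun_apply T ` cball 0 1 \<subseteq> (\<Union>x\<in>k. ball x e) \<longleftrightarrow>
      (\<forall>x. norm x \<le> 1 \<longrightarrow> (\<exists>a\<in>k. norm (T x - a) < e))" for k e
    by (simp add: image_subset_iff Ball_def dist_norm norm_minus_commute)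
  then show ?thesis
    by (simp add: compact_ops_def compact_closure_iff_totally_bounded)
qed

lemma compact_opsD:
  assumes "T \<in> compact_ops" "e > 0"
  obtains k where "finite k" "\<And>x. norm x \<le> 1 \<Longrightarrow> \<exists>a\<in>k. norm (T x - a) < e"
  using assms unfolding compact_ops_iff by blast

lemma compact_opsI:
  assumes "T \<in> bounded_ops"
    and "\<And>e. e > 0 \<Longrightarrow> \<exists>k. finite k \<and> (\<forall>x. norm x \<le> 1 \<longrightarrow> (\<exists>a\<in>k. norm (T x - a) < e))"
  shows "T \<in> compact_ops"
  using assms unfolding compact_ops_iff by blast

lemma compact_bounded [dest]: "T \<in> compact_ops \<Longrightarrow> T \<in> bounded_ops"
  by (simp add: compact_ops_def)

lemma compact_ops_zero [simp]: "0 \<in> compact_ops"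
  by (rule compact_opsI) (auto intro!: exI[of _ "{0}"])

lemma compact_ops_add:
  assumes S: "S \<in> compact_ops" and T: "T \<in> compact_ops"
  shows "S + T \<in> compact_ops"
proof (rule compact_opsI)
  show "S + T \<in> bounded_ops" using assms by (auto intro: bounded_ops_add)
  fix e :: real assume "e > 0"
  then have e: "e / 2 > 0" by simp
  obtain k where k: "finite k" "\<And>x. norm x \<le> 1 \<Longrightarrow> \<exists>a\<in>k. norm (S x - a) < e / 2"
    using compact_opsD[OF S e] by blast
  obtain l where l: "finite l" "\<And>x. norm x \<le> 1 \<Longrightarrow> \<exists>a\<in>l. norm (T x - a) < e / 2"
    using compact_opsD[OF T e] by blast
  have "\<exists>c\<in>(\<lambda>(a, b). a + b) ` (k \<times> l). norm ((S + T) x - c) < e" if x: "norm x \<le> 1" for x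
  proof -
    obtain a b where ab: "a \<in> k" "b \<in> l" "norm (S x - a) < e / 2" "norm (T x - b) < e / 2"
      using k(2)[OF x] l(2)[OF x] by blast
    have "norm ((S + T) x - (a + b)) \<le> norm (S x - a) + norm (T x - b)"
      by (simp add: blinfun.bilinear_simps norm_diff_triangle_ineq)
    then show ?thesis using ab by (intro bexI[of _ "a + b"]) auto
  qed
  then show "\<exists>k. finite k \<and> (\<forall>x. norm x \<le> 1 \<longrightarrow> (\<exists>a\<in>k. norm ((S + T) x - a) < e))"
    using k(1) l(1) by (intro exI[of _ "(\<lambda>(a, b). a + b) ` (k \<times> l)"]) auto
qed

lemma compact_ops_compose_left:
  assumes S: "S \<in> bounded_ops" and T: "T \<in> compact_ops"
  shows "S o\<^sub>L T \<in> compact_ops"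
proof (rule compact_opsI)
  show "S o\<^sub>L T \<in> bounded_ops" using assms by (auto intro: bounded_ops_compose)
  fix e :: real assume e: "e > 0"
  have M: "norm S + 1 > 0" using norm_ge_zero[of S] by linarith
  then have "e / (norm S + 1) > 0" using e by simp
  then obtain k where k: "finite k" "\<And>x. norm x \<le> 1 \<Longrightarrow> \<exists>a\<in>k. norm (T x - a) < e / (norm S + 1)"
    using compact_opsD[OF T] by blast
  have "\<exists>c\<in>S ` k. norm ((S o\<^sub>L T) x - c) < e" if x: "norm x \<le> 1" for x
  proof -
    obtain a where a: "a \<in> k" "norm (T x - a) < e / (norm S + 1)" using k(2)[OF x] by blast
    have "norm (S (T x) - S a) \<le> norm S * norm (T x - a)"
      by (metis blinfun.diff_right norm_blinfun)
    also have "\<dots> \<le> (norm S + 1) * norm (T x - a)" by (intro mult_right_mono) auto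
    also have "\<dots> < e" using a(2) M by (simp add: pos_less_divide_eq mult.commute)
    finally show ?thesis using a by auto
  qed
  then show "\<exists>k. finite k \<and> (\<forall>x. norm x \<le> 1 \<longrightarrow> (\<exists>a\<in>k. norm ((S o\<^sub>L T) x - a) < e))"
    using k(1) by (intro exI[of _ "S ` k"]) auto
qed

lemma compact_ops_compose_right:
  assumes S: "S \<in> bounded_ops" and T: "T \<in> compact_ops"
  shows "T o\<^sub>L S \<in> compact_ops"
proof (rule compact_opsI)
  show "T o\<^sub>L S \<in> bounded_ops" using assms by (auto intro: bounded_ops_compose)
  fix e :: real assume e: "e > 0"
  define M where "M = norm S + 1"
  have M: "M > 0" using norm_ge_zero[of S] unfolding M_def by linarith
  then have "e / M > 0" using e by simp
  then obtain k where k: "finite k" "\<And>x. norm x \<le> 1 \<Longrightarrow> \<exists>a\<in>k. norm (T x - a) < e / M"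
    using compact_opsD[OF T] by blast
  have "\<exists>c\<in>(\<lambda>a. M *\<^sub>R a) ` k. norm ((T o\<^sub>L S) x - c) < e" if x: "norm x \<le> 1" for x
  proof -
    have "norm (S x) \<le> norm S * norm x" by (rule norm_blinfun)
    also have "\<dots> \<le> norm S * 1" using x by (intro mult_left_mono) auto
    finally have "norm (S x /\<^sub>R M) \<le> 1" using M by (simp add: M_def divide_simps)
    then obtain a where a: "a \<in> k" "norm (T (S x /\<^sub>R M) - a) < e / M" using k by blast
    have "T (S x) - M *\<^sub>R a = M *\<^sub>R (T (S x /\<^sub>R M) - a)"
      using M by (simp add: blinfun.bilinear_simps scaleR_diff_right)
    then have "norm (T (S x) - M *\<^sub>R a) = M * norm (T (S x /\<^sub>R M) - a)" using M by simp
    also have "\<dots> < e" using a(2) M by (simp add: pos_less_divide_eq mult.commute)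
    finally show ?thesis using a by auto
  qed
  then show "\<exists>k. finite k \<and> (\<forall>x. norm x \<le> 1 \<longrightarrow> (\<exists>a\<in>k. norm ((T o\<^sub>L S) x - a) < e))"
    using k(1) by (intro exI[of _ "(\<lambda>a. M *\<^sub>R a) ` k"]) auto
qed

lemma compact_ops_scaleR: "T \<in> compact_ops \<Longrightarrow> r *\<^sub>R T \<in> compact_ops"
  using compact_ops_compose_left[of "r *\<^sub>R id_blinfun" T] by (simp add: bounded_ops_scaleR compose_simps)

lemma compact_ops_minus: "T \<in> compact_ops \<Longrightarrow> - T \<in> compact_ops"
  using compact_ops_scaleR[of T "-1"] by simp

lemma compact_ops_diff: "S \<in> compact_ops \<Longrightarrow> T \<in> compact_ops \<Longrightarrow> S - T \<in> compact_ops"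
  using compact_ops_add[of S "- T"] by (simp add: compact_ops_minus)

lemma compact_ops_sum: "(\<And>i. i \<in> I \<Longrightarrow> T i \<in> compact_ops) \<Longrightarrow> sum T I \<in> compact_ops"
  by (induction I rule: infinite_finite_induct) (auto intro: compact_ops_add)

lemma subspace_compact_ops: "subspace compact_ops"
  by (simp add: subspace_def compact_ops_add compact_ops_scaleR)

lemma closed_compact_ops: "closed (compact_ops :: ('a::complex_hilbert_space \<Rightarrow>\<^sub>L 'a) set)"
proof -
  have "T \<in> compact_ops" if T: "T \<in> closure compact_ops" for T :: "'a \<Rightarrow>\<^sub>L 'a"
  proof (rule compact_opsI)
    have "closure compact_ops \<subseteq> (bounded_ops :: ('a \<Rightarrow>\<^sub>L 'a) set)"
      by (rule closure_minimal) (auto intro: closed_bounded_ops)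
    then show "T \<in> bounded_ops" using T by blast
    fix e :: real assume "e > 0"
    then have e: "e / 2 > 0" by simp
    then obtain S where S: "S \<in> compact_ops" "dist S T < e / 2"
      using T unfolding closure_approachable by blast
    obtain k where k: "finite k" "\<And>x. norm x \<le> 1 \<Longrightarrow> \<exists>a\<in>k. norm (S x - a) < e / 2"
      using compact_opsD[OF S(1) e] by blast
    have "\<exists>a\<in>k. norm (T x - a) < e" if x: "norm x \<le> 1" for x
    proof -
      obtain a where a: "a \<in> k" "norm (S x - a) < e / 2" using k x by blast
      have "norm (T x - S x) \<le> norm (T - S) * norm x"
        by (metis blinfun.diff_left norm_blinfun)
      also have "\<dots> \<le> norm (T - S) * 1" using x by (intro mult_left_mono) auto
      also have "\<dots> < e / 2" using S(2) by (simp add: dist_norm norm_minus_commute)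
      finally have "norm (T x - a) < e / 2 + e / 2"
        using norm_triangle_ineq[of "T x - S x" "S x - a"] a by simp
      then show ?thesis using a by auto
    qed
    then show "\<exists>k. finite k \<and> (\<forall>x. norm x \<le> 1 \<longrightarrow> (\<exists>a\<in>k. norm (T x - a) < e))"
      using k(1) by blast
  qed
  then show ?thesis by (metis closure_subset_eq subsetI)
qed

text \<open>An approximation of the compact operator \<open>T T\<^sup>\<star>\<close> on the unit ball gives one of
  \<open>T\<^sup>\<star>\<close>, because \<open>\<parallel>T\<^sup>\<star> v\<parallel>\<^sup>2 = \<langle>T T\<^sup>\<star> v, v\<rangle>\<close>.\<close>

lemma compact_ops_radj:
  assumes T: "T \<in> compact_ops"
  shows "radj T \<in> compact_ops"
proof (rule compact_opsI)
  show R: "radj T \<in> bounded_ops" using T by (auto intro: bounded_ops_radj)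
  fix e :: real assume e: "e > 0"
  define d where "d = e\<^sup>2 / 8"
  have d: "d > 0" using e by (simp add: d_def)
  have "T o\<^sub>L radj T \<in> compact_ops" using R T by (rule compact_ops_compose_right)
  then obtain k where k: "finite k" "\<And>x. norm x \<le> 1 \<Longrightarrow> \<exists>a\<in>k. norm (T (radj T x) - a) < d"
    using compact_opsD[OF _ d] by (metis blinfun_apply_blinfun_compose)
  define c where "c a = (SOME x. norm x \<le> 1 \<and> norm (T (radj T x) - a) < d)" for a
  have "\<exists>b\<in>(\<lambda>a. radj T (c a)) ` k. norm (radj T x - b) < e" if x: "norm x \<le> 1" for x
  proof -
    obtain a where a: "a \<in> k" "norm (T (radj T x) - a) < d" using k x by blast
    then have c: "norm (c a) \<le> 1" "norm (T (radj T (c a)) - a) < d"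
      unfolding c_def using someI[of "\<lambda>x. norm x \<le> 1 \<and> norm (T (radj T x) - a) < d" x] x by auto
    let ?v = "x - c a"
    have v: "norm ?v \<le> 2" using norm_triangle_ineq4[of x "c a"] x c(1) by linarith
    have "T (radj T ?v) = (T (radj T x) - a) - (T (radj T (c a)) - a)"
      by (simp add: blinfun.bilinear_simps)
    then have w: "norm (T (radj T ?v)) < 2 * d"
      using norm_triangle_ineq4[of "T (radj T x) - a" "T (radj T (c a)) - a"] a(2) c(2) by simp
    have "(norm (radj T ?v))\<^sup>2 = inner (T (radj T ?v)) ?v"
      by (simp add: inner_radj power2_norm_eq_inner)
    also have "\<dots> \<le> norm (T (radj T ?v)) * norm ?v" by (rule norm_cauchy_schwarz)
    also have "\<dots> \<le> norm (T (radj T ?v)) * 2" using v by (intro mult_left_mono) auto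
    also have "\<dots> < e\<^sup>2" 
      using w norm_ge_zero[of "T (radj T ?v)"] unfolding d_def by linarith
    finally have "norm (radj T ?v) < e" using e power_less_imp_less_base by fastforce
    then show ?thesis using a by (auto simp: blinfun.bilinear_simps)
  qed
  then show "\<exists>k. finite k \<and> (\<forall>x. norm x \<le> 1 \<longrightarrow> (\<exists>a\<in>k. norm (radj T x - a) < e))"
    using k(1) by (intro exI[of _ "(\<lambda>a. radj T (c a)) ` k"]) auto
qed

text \<open>Cauchy-Schwarz for the real inner product, after a rotation of \<open>x\<close> that makes the complex inner
  product real.\<close>

lemma cmod_cinner_le: "cmod (cinner x y) \<le> norm x * norm y"
proof -
  let ?z = "cinner x y"
  define c where "c = (if ?z = 0 then 1 else cnj ?z / cmod ?z)"
  have "cmod c = 1" by (simp add: c_def norm_divide)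
  have "c * ?z = complex_of_real (cmod ?z)"
    by (simp add: c_def complex_norm_square[symmetric] mult.commute[of "cnj ?z"] power2_eq_square)
  then have "cmod ?z = Re (cinner (c *\<^sub>C x) y)" by (simp add: cinner_scaleC_left)
  also have "\<dots> \<le> norm (c *\<^sub>C x) * norm y" by (simp add: Re_cinner norm_cauchy_schwarz)
  finally show ?thesis using \<open>cmod c = 1\<close> by (simp add: norm_scaleC)
qed

lemma scaleC_scaleR_left: "(r *\<^sub>R c) *\<^sub>C x = r *\<^sub>R (c *\<^sub>C x)"
  by (simp add: scaleR_conv_of_real scaleC_of_real flip: scaleC_scaleC)

definition rank_one :: "'a::complex_hilbert_space \<Rightarrow> 'a \<Rightarrow> 'a \<Rightarrow>\<^sub>L 'a" where
  "rank_one v w = Blinfun (\<lambda>x. cinner x w *\<^sub>C v)"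

lemma rank_one_apply: "rank_one v w x = cinner x w *\<^sub>C v"
proof -
  have "bounded_linear (\<lambda>x. cinner x w *\<^sub>C v)"
  proof (rule bounded_linear_intro[where K = "norm v * norm w"])
    show "cinner (x + y) w *\<^sub>C v = cinner x w *\<^sub>C v + cinner y w *\<^sub>C v" for x y
      by (simp add: cinner_add_left scaleC_add_left)
    show "cinner (r *\<^sub>R x) w *\<^sub>C v = r *\<^sub>R (cinner x w *\<^sub>C v)" for r x
      using cinner_scaleC_left[of "complex_of_real r" x w]
      by (simp add: scaleC_of_real scaleC_scaleR_left[symmetric] scaleR_conv_of_real)
    show "norm (cinner x w *\<^sub>C v) \<le> norm x * (norm v * norm w)" for x
      using mult_right_mono[OF cmod_cinner_le[of x w] norm_ge_zero[of v]]
      by (simp add: norm_scaleC mult.assoc mult.commute[of "norm v"])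
  qed
  then show ?thesis by (simp add: rank_one_def bounded_linear_Blinfun_apply)
qed

lemma rank_one_compact: "rank_one v w \<in> compact_ops"
  unfolding compact_ops_def
proof (intro CollectI conjI)
  show "rank_one v w \<in> bounded_ops"
    by (simp add: bounded_ops_def rank_one_apply cinner_scaleC_left scaleC_scaleC)
  have "bounded_linear (\<lambda>c. c *\<^sub>C v)"
    by (rule bounded_linear_intro[where K = "norm v"])
      (simp_all add: scaleC_add_left scaleC_scaleR_left norm_scaleC)
  then have "compact ((\<lambda>c. c *\<^sub>C v) ` cball 0 (norm w))"
    by (intro compact_continuous_image compact_cball linear_continuous_on)
  moreover have "rank_one v w ` cball 0 1 \<subseteq> (\<lambda>c. c *\<^sub>C v) ` cball 0 (norm w)"
  proof clarsimp
    fix x :: 'a assume "norm x \<le> 1"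
    then have "cmod (cinner x w) \<le> norm w"
      using cmod_cinner_le[of x w] mult_right_mono[of "norm x" 1 "norm w"] by simp
    then show "rank_one v w x \<in> (\<lambda>c. c *\<^sub>C v) ` cball 0 (norm w)" by (simp add: rank_one_apply)
  qed
  ultimately show "compact (closure (rank_one v w ` cball 0 1))"
    by (metis closed_closure closure_minimal compact_Int_closed compact_imp_closed inf.absorb2)
qed

lemma radj_rank_one: "radj (rank_one v w) = rank_one w v"
proof (rule radj_eqI)
  fix x y
  have "inner (rank_one v w x) y = Re (cinner x w * cinner v y)"
    by (simp add: rank_one_apply cinner_scaleC_left flip: Re_cinner)
  also have "\<dots> = inner x (rank_one w v y)"
    using cinner_commute[of y v]
    by (simp add: rank_one_apply cinner_scaleC_right mult.commute flip: Re_cinner)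
  finally show "inner (rank_one v w x) y = inner x (rank_one w v y)" .
qed

text \<open>Left multiplication by a unitary operator identifies the following space with the tangent
  space of the unitary Fredholm group.\<close>

definition compact_ah_ops :: "('a::complex_hilbert_space \<Rightarrow>\<^sub>L 'a) set" where
  "compact_ah_ops = {K \<in> compact_ops. radj K = - K}"

lemma compact_sa_ops_eq: "compact_sa_ops = {K \<in> compact_ops. radj K = K}"
  by (auto simp: compact_sa_ops_def selfadjoint_iff)

lemma subspace_compact_sa_ops: "subspace compact_sa_ops"
  by (auto simp: compact_sa_ops_eq subspace_def compact_ops_add compact_ops_scaleR radj_add radj_scaleR)

lemma subspace_compact_ah_ops: "subspace compact_ah_ops"
  by (auto simp: compact_ah_ops_def subspace_def compact_ops_add compact_ops_scaleR radj_add radj_scaleR)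

lemma closed_compact_sa_ops: "closed (compact_sa_ops :: ('a::complex_hilbert_space \<Rightarrow>\<^sub>L 'a) set)"
proof -
  have "compact_sa_ops = compact_ops \<inter> {K :: 'a \<Rightarrow>\<^sub>L 'a. radj K = K}" by (auto simp: compact_sa_ops_eq)
  moreover have "closed {K :: 'a \<Rightarrow>\<^sub>L 'a. radj K = K}"
    by (intro closed_Collect_eq continuous_intros linear_continuous_on bounded_linear_radj)
  ultimately show ?thesis by (metis closed_Int closed_compact_ops)
qed

lemma closed_compact_ah_ops: "closed (compact_ah_ops :: ('a::complex_hilbert_space \<Rightarrow>\<^sub>L 'a) set)"
proof -
  have "compact_ah_ops = compact_ops \<inter> {K :: 'a \<Rightarrow>\<^sub>L 'a. radj K = - K}" by (auto simp: compact_ah_ops_def)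
  moreover have "closed {K :: 'a \<Rightarrow>\<^sub>L 'a. radj K = - K}"
    by (intro closed_Collect_eq continuous_intros linear_continuous_on bounded_linear_radj)
  ultimately show ?thesis by (metis closed_Int closed_compact_ops)
qed

section \<open>Invertible operators\<close>

definition invertible_op :: "('x::real_normed_vector \<Rightarrow>\<^sub>L 'x) \<Rightarrow> bool" where
  "invertible_op T \<longleftrightarrow> (\<exists>S. S o\<^sub>L T = id_blinfun \<and> T o\<^sub>L S = id_blinfun)"

text \<open>With the value \<open>0\<close> on operators that are not invertible, inversion commutes with the passage
  from an operator to its left multiplication without a side condition.\<close>

definition inv_op :: "('x::real_normed_vector \<Rightarrow>\<^sub>L 'x) \<Rightarrow> ('x \<Rightarrow>\<^sub>L 'x)" where
  "inv_op T = (if invertible_op T then SOME S. S o\<^sub>L T = id_blinfun \<and> T o\<^sub>L S = id_blinfun else 0)"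

lemma inv_op:
  assumes "invertible_op T"
  shows inv_op_left: "inv_op T o\<^sub>L T = id_blinfun" and inv_op_right: "T o\<^sub>L inv_op T = id_blinfun"
  using someI_ex[OF assms[unfolded invertible_op_def]] assms by (auto simp: inv_op_def)

lemma inv_op_cancel:
  assumes "invertible_op T"
  shows "inv_op T o\<^sub>L (T o\<^sub>L S) = S" "T o\<^sub>L (inv_op T o\<^sub>L S) = S"
  using assms by (simp_all add: inv_op flip: compose_assoc)

lemma inv_op_eqI:
  assumes "S o\<^sub>L T = id_blinfun" "T o\<^sub>L S = id_blinfun"
  shows "invertible_op T" "inv_op T = S"
proof -
  show *: "invertible_op T" using assms by (auto simp: invertible_op_def)
  have "inv_op T = inv_op T o\<^sub>L (T o\<^sub>L S)" using assms by simp
  then show "inv_op T = S" using * by (simp add: inv_op_cancel)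
qed

lemma invertible_op_id [simp]: "invertible_op id_blinfun" "inv_op id_blinfun = id_blinfun"
  using inv_op_eqI[of id_blinfun id_blinfun] by simp_all

lemma invertible_op_compose:
  assumes "invertible_op S" "invertible_op T"
  shows "invertible_op (S o\<^sub>L T)" "inv_op (S o\<^sub>L T) = inv_op T o\<^sub>L inv_op S"
proof -
  have 1: "(inv_op T o\<^sub>L inv_op S) o\<^sub>L (S o\<^sub>L T) = id_blinfun"
    and 2: "(S o\<^sub>L T) o\<^sub>L (inv_op T o\<^sub>L inv_op S) = id_blinfun"
    by (simp_all add: compose_assoc inv_op_cancel inv_op assms)
  show "invertible_op (S o\<^sub>L T)" "inv_op (S o\<^sub>L T) = inv_op T o\<^sub>L inv_op S"
    using inv_op_eqI[OF 1 2] by simp_all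
qed

text \<open>The two one-sided inverses are fixed points of the contractions \<open>S \<mapsto> 1 + E S\<close> and \<open>S \<mapsto> 1 + S E\<close>.\<close>

lemma invertible_one_minus:
  fixes E :: "'x::banach \<Rightarrow>\<^sub>L 'x"
  assumes E: "norm E < 1"
  shows "invertible_op (id_blinfun - E)"
proof -
  have "\<exists>!S. id_blinfun + (E o\<^sub>L S) = S"
  proof (rule banach_fix_type[OF norm_ge_zero E], intro allI)
    fix S T :: "'x \<Rightarrow>\<^sub>L 'x"
    show "dist (id_blinfun + (E o\<^sub>L S)) (id_blinfun + (E o\<^sub>L T)) \<le> norm E * dist S T"
      using norm_blinfun_compose[of E "S - T"] by (simp add: dist_norm compose_simps)
  qed
  then obtain S where S: "id_blinfun + (E o\<^sub>L S) = S" by blast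
  have "\<exists>!S. id_blinfun + (S o\<^sub>L E) = S"
  proof (rule banach_fix_type[OF norm_ge_zero E], intro allI)
    fix S T :: "'x \<Rightarrow>\<^sub>L 'x"
    show "dist (id_blinfun + (S o\<^sub>L E)) (id_blinfun + (T o\<^sub>L E)) \<le> norm E * dist S T"
      using norm_blinfun_compose[of "S - T" E] by (simp add: dist_norm compose_simps mult.commute)
  qed
  then obtain R where R: "id_blinfun + (R o\<^sub>L E) = R" by blast
  have 1: "(id_blinfun - E) o\<^sub>L S = id_blinfun"
    using S by (simp add: compose_simps) (metis add_diff_cancel_right')
  have 2: "R o\<^sub>L (id_blinfun - E) = id_blinfun"
    using R by (simp add: compose_simps) (metis add_diff_cancel_right')
  have "R = S"
    using 1 2 by (metis compose_assoc compose_id)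
  then show ?thesis using 1 2 by (auto simp: invertible_op_def)
qed

lemma invertible_op_near:
  fixes T :: "'x::banach \<Rightarrow>\<^sub>L 'x"
  assumes T: "invertible_op T" and "norm (inv_op T) * norm (S - T) < 1"
  shows "invertible_op S"
proof -
  have "norm (inv_op T o\<^sub>L (T - S)) < 1"
    using norm_blinfun_compose[of "inv_op T" "T - S"] assms(2) by (simp add: norm_minus_commute)
  then have "invertible_op (T o\<^sub>L (id_blinfun - (inv_op T o\<^sub>L (T - S))))"
    using invertible_one_minus T invertible_op_compose by blast
  then show ?thesis using T by (simp add: compose_simps inv_op_cancel inv_op)
qed

lemma open_invertible: "open {T :: 'x::banach \<Rightarrow>\<^sub>L 'x. invertible_op T}"
  unfolding open_dist
proof (intro ballI, unfold mem_Collect_eq)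
  fix T :: "'x \<Rightarrow>\<^sub>L 'x" assume T: "invertible_op T"
  define M where "M = norm (inv_op T) + 1"
  have M: "M > 0" "norm (inv_op T) < M" using norm_ge_zero[of "inv_op T"] unfolding M_def by linarith+
  have "invertible_op S" if "dist S T < 1 / M" for S
  proof (rule invertible_op_near[OF T])
    have "norm (inv_op T) * norm (S - T) \<le> M * norm (S - T)" using M by (intro mult_right_mono) auto
    also have "\<dots> < 1" using that M by (simp add: dist_norm pos_less_divide_eq mult.commute)
    finally show "norm (inv_op T) * norm (S - T) < 1" .
  qed
  then show "\<exists>e>0. \<forall>y. dist y T < e \<longrightarrow> invertible_op y" using M by (intro exI[of _ "1 / M"]) auto
qed

text \<open>Both estimates come from \<open>b\<^sup>-\<^sup>1 - a\<^sup>-\<^sup>1 = - b\<^sup>-\<^sup>1 (b - a) a\<^sup>-\<^sup>1\<close>, the second one from its iteration.\<close>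

lemma inv_op_bound:
  assumes a: "invertible_op a" and b: "invertible_op b"
    and near: "norm (b - a) * norm (inv_op a) \<le> 1 / 2"
  shows "norm (inv_op b) \<le> 2 * norm (inv_op a)"
    and "norm (inv_op b - inv_op a + (inv_op a o\<^sub>L (b - a) o\<^sub>L inv_op a))
      \<le> 2 * norm (inv_op a) ^ 3 * (norm (b - a))\<^sup>2"
proof -
  let ?r = "inv_op a" and ?s = "inv_op b" and ?d = "b - a"
  have diff: "?s - ?r = - (?s o\<^sub>L ?d o\<^sub>L ?r)"
    using a b by (simp add: compose_simps inv_op_cancel inv_op)
  have "norm ?s \<le> norm ?r + norm (?s o\<^sub>L ?d o\<^sub>L ?r)"
  proof -
    have "?s = ?r - (?s o\<^sub>L ?d o\<^sub>L ?r)" using diff unfolding diff_eq_eq by simp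
    then have "norm ?s = norm (?r - (?s o\<^sub>L ?d o\<^sub>L ?r))" by (rule arg_cong)
    then show ?thesis using norm_triangle_ineq4[of ?r "?s o\<^sub>L ?d o\<^sub>L ?r"] by linarith
  qed
  also have "norm (?s o\<^sub>L ?d o\<^sub>L ?r) \<le> norm (?s o\<^sub>L ?d) * norm ?r" by (rule norm_blinfun_compose)
  also have "\<dots> \<le> (norm ?s * norm ?d) * norm ?r" by (intro mult_right_mono norm_blinfun_compose) simp
  also have "\<dots> = norm ?s * (norm ?d * norm ?r)" by simp
  also have "\<dots> \<le> norm ?s * (1 / 2)" by (intro mult_left_mono near) simp
  finally show 1: "norm ?s \<le> 2 * norm ?r" by simp
  have "?s - ?r + (?r o\<^sub>L ?d o\<^sub>L ?r) = ?s o\<^sub>L ?d o\<^sub>L ?r o\<^sub>L ?d o\<^sub>L ?r"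
    using a b by (simp add: compose_simps inv_op_cancel inv_op)
  also have "norm \<dots> \<le> norm ?s * norm ?d * norm ?r * norm ?d * norm ?r"
    by (intro order.trans[OF norm_blinfun_compose] mult_right_mono norm_ge_zero order.refl)
  also have "\<dots> \<le> (2 * norm ?r) * norm ?d * norm ?r * norm ?d * norm ?r"
    by (intro mult_right_mono 1) auto
  finally show "norm (?s - ?r + (?r o\<^sub>L ?d o\<^sub>L ?r)) \<le> 2 * norm ?r ^ 3 * (norm ?d)\<^sup>2"
    by (simp add: power2_eq_square power3_eq_cube mult_ac)
qed

lemma inv_op_has_derivative:
  assumes x: "invertible_op x"
  shows "(inv_op has_derivative (\<lambda>h. - (inv_op x o\<^sub>L h o\<^sub>L inv_op x))) (at x within {T. invertible_op T})"
  unfolding has_derivative_within_alt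
proof (intro conjI allI impI)
  show "bounded_linear (\<lambda>h. - (inv_op x o\<^sub>L h o\<^sub>L inv_op x))"
  proof (rule bounded_linear_intro[where K = "norm (inv_op x) * norm (inv_op x)"])
    fix h k :: "'a \<Rightarrow>\<^sub>L 'a" and r :: real
    show "- (inv_op x o\<^sub>L (h + k) o\<^sub>L inv_op x)
        = - (inv_op x o\<^sub>L h o\<^sub>L inv_op x) + - (inv_op x o\<^sub>L k o\<^sub>L inv_op x)"
      by (simp add: compose_simps)
    show "- (inv_op x o\<^sub>L (r *\<^sub>R h) o\<^sub>L inv_op x) = r *\<^sub>R - (inv_op x o\<^sub>L h o\<^sub>L inv_op x)"
      by (simp add: compose_simps)
    have "norm (inv_op x o\<^sub>L h o\<^sub>L inv_op x) \<le> norm (inv_op x) * norm h * norm (inv_op x)"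
      by (intro order.trans[OF norm_blinfun_compose] mult_right_mono norm_blinfun_compose norm_ge_zero)
    then show "norm (- (inv_op x o\<^sub>L h o\<^sub>L inv_op x)) \<le> norm h * (norm (inv_op x) * norm (inv_op x))"
      by (simp add: mult_ac)
  qed
  fix e :: real assume e: "e > 0"
  define M where "M = norm (inv_op x) + 1"
  have M: "M > 0" "norm (inv_op x) \<le> M" using norm_ge_zero[of "inv_op x"] unfolding M_def by linarith+
  define d where "d = min (1 / (2 * M)) (e / (2 * M ^ 3))"
  have d: "d > 0" "d \<le> 1 / (2 * M)" "d \<le> e / (2 * M ^ 3)" using M e by (auto simp: d_def)
  have "norm (inv_op y - inv_op x - - (inv_op x o\<^sub>L (y - x) o\<^sub>L inv_op x)) \<le> e * norm (y - x)"
    if y: "invertible_op y" "norm (y - x) < d" for y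
  proof -
    have "norm (y - x) * norm (inv_op x) \<le> (1 / (2 * M)) * M"
      using y(2) d M by (intro mult_mono) auto
    then have near: "norm (y - x) * norm (inv_op x) \<le> 1 / 2" using M by simp
    have "norm (inv_op y - inv_op x - - (inv_op x o\<^sub>L (y - x) o\<^sub>L inv_op x))
        \<le> 2 * norm (inv_op x) ^ 3 * (norm (y - x))\<^sup>2"
      using inv_op_bound(2)[OF x y(1) near] by simp
    also have "\<dots> \<le> 2 * M ^ 3 * (norm (y - x))\<^sup>2"
      using M by (intro mult_right_mono mult_left_mono power_mono) auto
    also have "\<dots> = (2 * M ^ 3 * norm (y - x)) * norm (y - x)" by (simp add: power2_eq_square)
    also have "\<dots> \<le> e * norm (y - x)"
    proof (rule mult_right_mono)
      have "2 * M ^ 3 * norm (y - x) \<le> 2 * M ^ 3 * (e / (2 * M ^ 3))"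
        using y(2) d M by (intro mult_left_mono) auto
      then show "2 * M ^ 3 * norm (y - x) \<le> e" using M by simp
    qed simp
    finally show ?thesis .
  qed
  then show "\<exists>d>0. \<forall>y\<in>{T. invertible_op T}. norm (y - x) < d \<longrightarrow>
      norm (inv_op y - inv_op x - - (inv_op x o\<^sub>L (y - x) o\<^sub>L inv_op x)) \<le> e * norm (y - x)"
    using d(1) by auto
qed

lemma continuous_on_inv_op: "continuous_on {T. invertible_op T} inv_op"
  unfolding continuous_on_eq_continuous_within
  using inv_op_has_derivative has_derivative_continuous by blast

section \<open>Smoothness of rational expressions in operators\<close>

text \<open>The families of multilinear maps that arise from operator valued functions in \<open>G\<close> by algebraic
  operations, inversion on \<open>U\<close>, and insertion of vectors. The set of numbers says which of the
  vectors \<open>vs\<close> have been inserted: each of them exactly once, so that the value is linear in each.\<close>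

inductive rat :: "'b::real_normed_vector set \<Rightarrow> ('b \<Rightarrow> 'x::real_normed_vector \<Rightarrow>\<^sub>L 'x) set \<Rightarrow> nat set
    \<Rightarrow> ('b \<Rightarrow> (nat \<Rightarrow> 'b) \<Rightarrow> 'x \<Rightarrow>\<^sub>L 'x) \<Rightarrow> bool"
  for U G where
  rat_const: "rat U G {} (\<lambda>z vs. c)"
| rat_base: "g \<in> G \<Longrightarrow> rat U G {} (\<lambda>z vs. g z)"
| rat_zero: "finite S \<Longrightarrow> rat U G S (\<lambda>z vs. 0)"
| rat_add: "rat U G S f \<Longrightarrow> rat U G S f' \<Longrightarrow> rat U G S (\<lambda>z vs. f z vs + f' z vs)"
| rat_linear: "bounded_linear l \<Longrightarrow> rat U G S f \<Longrightarrow> rat U G S (\<lambda>z vs. l (f z vs))"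
| rat_mult: "bounded_bilinear \<beta> \<Longrightarrow> rat U G S f \<Longrightarrow> rat U G T g \<Longrightarrow> S \<inter> T = {}
    \<Longrightarrow> rat U G (S \<union> T) (\<lambda>z vs. \<beta> (f z vs) (g z vs))"
| rat_inv: "rat U G {} f \<Longrightarrow> (\<forall>z\<in>U. \<forall>vs. invertible_op (f z vs))
    \<Longrightarrow> rat U G {} (\<lambda>z vs. inv_op (f z vs))"
| rat_slot: "bounded_bilinear \<gamma> \<Longrightarrow> rat U G S f \<Longrightarrow> i \<notin> S
    \<Longrightarrow> rat U G (insert i S) (\<lambda>z vs. \<gamma> (f z vs) (vs i))"

lemma rat_finite: "rat U G S f \<Longrightarrow> finite S"
  by (induction rule: rat.induct) auto

lemma rat_cong_slots:
  assumes "rat U G S f" "\<And>i. i \<in> S \<Longrightarrow> vs i = ws i"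
  shows "f z vs = f z ws"
  using assms
proof (induction arbitrary: vs ws rule: rat.induct)
  case (rat_add S f f')
  then show ?case by metis
next
  case (rat_linear l S f)
  then show ?case by metis
next
  case (rat_mult \<beta> S f T g)
  then have "f z vs = f z ws" "g z vs = g z ws" by (metis UnCI)+
  then show ?case by simp
next
  case (rat_inv f)
  then show ?case by (metis empty_iff)
next
  case (rat_slot \<gamma> S f i)
  then have "f z vs = f z ws" "vs i = ws i" by (metis insertCI)+
  then show ?case by simp
qed auto

lemma rat_upd: "rat U G S f \<Longrightarrow> n \<notin> S \<Longrightarrow> f z (vs(n := v)) = f z vs"
  by (rule rat_cong_slots) auto

lemma rat_slotwise_linear:
  assumes "rat U G S f" "i \<in> S"
  shows "f z (vs(i := r *\<^sub>R v + s *\<^sub>R w)) = r *\<^sub>R f z (vs(i := v)) + s *\<^sub>R f z (vs(i := w))"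
  using assms
proof (induction arbitrary: vs rule: rat.induct)
  case (rat_add S f f')
  then show ?case by (simp add: scaleR_add_right)
next
  case (rat_linear l S f)
  then show ?case
    by (simp add: linear_simps(1)[OF rat_linear(1)] linear_simps(5)[OF rat_linear(1)])
next
  case (rat_mult \<beta> S f T g)
  note \<beta> = bounded_bilinear.add_left[OF rat_mult(1)] bounded_bilinear.add_right[OF rat_mult(1)]
    bounded_bilinear.scaleR_left[OF rat_mult(1)] bounded_bilinear.scaleR_right[OF rat_mult(1)]
  show ?case
  proof (cases "i \<in> S")
    case True
    then have "i \<notin> T" using rat_mult by auto
    then have "g z (vs(i := u)) = g z vs" for u by (rule rat_upd[OF rat_mult(3)])
    moreover have "f z (vs(i := r *\<^sub>R v + s *\<^sub>R w)) = r *\<^sub>R f z (vs(i := v)) + s *\<^sub>R f z (vs(i := w))"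
      using rat_mult True by blast
    ultimately show ?thesis by (simp only: \<beta>)
  next
    case False
    then have "i \<in> T" using rat_mult by auto
    have "f z (vs(i := u)) = f z vs" for u using False by (rule rat_upd[OF rat_mult(2)])
    moreover have "g z (vs(i := r *\<^sub>R v + s *\<^sub>R w)) = r *\<^sub>R g z (vs(i := v)) + s *\<^sub>R g z (vs(i := w))"
      using rat_mult \<open>i \<in> T\<close> by blast
    ultimately show ?thesis by (simp only: \<beta>)
  qed
next
  case (rat_slot \<gamma> S f j)
  note \<gamma> = bounded_bilinear.add_left[OF rat_slot(1)] bounded_bilinear.add_right[OF rat_slot(1)]
    bounded_bilinear.scaleR_left[OF rat_slot(1)] bounded_bilinear.scaleR_right[OF rat_slot(1)]
  show ?case
  proof (cases "i = j")
    case True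
    then have "f z (vs(i := u)) = f z vs" for u using rat_slot by (intro rat_upd[OF rat_slot(2)]) simp
    then show ?thesis using True by (simp only: \<gamma> fun_upd_same)
  next
    case False
    then have "i \<in> S" using rat_slot by simp
    then have "f z (vs(i := r *\<^sub>R v + s *\<^sub>R w)) = r *\<^sub>R f z (vs(i := v)) + s *\<^sub>R f z (vs(i := w))"
      by (rule rat_slot)
    moreover have "(vs(i := u)) j = vs j" for u using False by simp
    ultimately show ?thesis by (simp only: \<gamma>)
  qed
qed auto

lemma rat_bounded:
  assumes "rat U G S f"
  obtains C where "C \<ge> 0" "\<And>vs. norm (f z vs) \<le> C * (\<Prod>i\<in>S. norm (vs i))"
proof -
  have "\<exists>C\<ge>0. \<forall>vs. norm (f z vs) \<le> C * (\<Prod>i\<in>S. norm (vs i))"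
    using assms
  proof (induction rule: rat.induct)
    case (rat_const c)
    then show ?case by (intro exI[of _ "norm c"]) auto
  next
    case (rat_base g)
    then show ?case by (intro exI[of _ "norm (g z)"]) auto
  next
    case (rat_zero S)
    then show ?case by (intro exI[of _ 0]) auto
  next
    case (rat_add S f f')
    then obtain C D where C: "C \<ge> 0" "\<And>vs. norm (f z vs) \<le> C * (\<Prod>i\<in>S. norm (vs i))"
      and D: "D \<ge> 0" "\<And>vs. norm (f' z vs) \<le> D * (\<Prod>i\<in>S. norm (vs i))" by metis
    have "norm (f z vs + f' z vs) \<le> (C + D) * (\<Prod>i\<in>S. norm (vs i))" for vs
      using norm_triangle_ineq[of "f z vs" "f' z vs"] C(2)[of vs] D(2)[of vs]
      by (simp add: distrib_right)
    then show ?case using C(1) D(1) by (intro exI[of _ "C + D"]) auto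
  next
    case (rat_linear l S f)
    then obtain C where C: "C \<ge> 0" "\<And>vs. norm (f z vs) \<le> C * (\<Prod>i\<in>S. norm (vs i))" by metis
    obtain K where K: "K > 0" "\<And>x. norm (l x) \<le> norm x * K"
      using bounded_linear.pos_bounded[OF rat_linear(1)] by blast
    have "norm (l (f z vs)) \<le> (C * K) * (\<Prod>i\<in>S. norm (vs i))" for vs
      using order.trans[OF K(2)[of "f z vs"] mult_right_mono[OF C(2)[of vs], of K]] K(1)
      by (simp add: mult_ac)
    then show ?case using C(1) K(1) by (intro exI[of _ "C * K"]) auto
  next
    case (rat_mult \<beta> S f T g)
    then obtain C D where C: "C \<ge> 0" "\<And>vs. norm (f z vs) \<le> C * (\<Prod>i\<in>S. norm (vs i))"
      and D: "D \<ge> 0" "\<And>vs. norm (g z vs) \<le> D * (\<Prod>i\<in>T. norm (vs i))" by metis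
    obtain K where K: "K > 0" "\<And>x y. norm (\<beta> x y) \<le> norm x * norm y * K"
      using bounded_bilinear.pos_bounded[OF rat_mult(1)] by blast
    have "norm (\<beta> (f z vs) (g z vs)) \<le> (C * D * K) * (\<Prod>i\<in>S \<union> T. norm (vs i))" for vs
    proof -
      have "norm (f z vs) * norm (g z vs)
          \<le> (C * (\<Prod>i\<in>S. norm (vs i))) * (D * (\<Prod>i\<in>T. norm (vs i)))"
        using C D by (intro mult_mono) (auto intro!: mult_nonneg_nonneg prod_nonneg)
      moreover have "(\<Prod>i\<in>S \<union> T. norm (vs i)) = (\<Prod>i\<in>S. norm (vs i)) * (\<Prod>i\<in>T. norm (vs i))"
        using rat_mult by (intro prod.union_disjoint) (auto dest: rat_finite)
      ultimately have "norm (f z vs) * norm (g z vs) \<le> C * D * (\<Prod>i\<in>S \<union> T. norm (vs i))"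
        by (simp add: mult_ac)
      then have "norm (f z vs) * norm (g z vs) * K \<le> (C * D * (\<Prod>i\<in>S \<union> T. norm (vs i))) * K"
        using K(1) by (intro mult_right_mono) auto
      with K(2)[of "f z vs" "g z vs"] show ?thesis by (simp add: mult_ac)
    qed
    then show ?case using C(1) D(1) K(1) by (intro exI[of _ "C * D * K"]) auto
  next
    case (rat_inv f)
    have "f z vs = f z (\<lambda>_. 0)" for vs by (rule rat_cong_slots[OF rat_inv(1)]) simp
    then have "norm (inv_op (f z vs)) = norm (inv_op (f z (\<lambda>_. 0)))" for vs
      by (rule arg_cong)
    then have "norm (inv_op (f z vs)) \<le> norm (inv_op (f z (\<lambda>_. 0))) * (\<Prod>i\<in>{}. norm (vs i))" for vs
      by (metis mult.right_neutral order.refl prod.empty)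
    then show ?case using norm_ge_zero by blast
  next
    case (rat_slot \<gamma> S f i)
    then obtain C where C: "C \<ge> 0" "\<And>vs. norm (f z vs) \<le> C * (\<Prod>i\<in>S. norm (vs i))" by metis
    obtain K where K: "K > 0" "\<And>x y. norm (\<gamma> x y) \<le> norm x * norm y * K"
      using bounded_bilinear.pos_bounded[OF rat_slot(1)] by blast
    have "norm (\<gamma> (f z vs) (vs i)) \<le> (C * K) * (\<Prod>j\<in>insert i S. norm (vs j))" for vs
    proof -
      have "norm (\<gamma> (f z vs) (vs i)) \<le> norm (f z vs) * (norm (vs i) * K)"
        using K(2)[of "f z vs" "vs i"] by (simp add: mult.assoc)
      also have "\<dots> \<le> (C * (\<Prod>i\<in>S. norm (vs i))) * (norm (vs i) * K)"
        using K(1) by (intro mult_right_mono C(2)) auto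
      also have "\<dots> = (C * K) * (\<Prod>j\<in>insert i S. norm (vs j))"
        using rat_slot(3) rat_finite[OF rat_slot(2)] by (simp add: mult_ac)
      finally show ?thesis .
    qed
    then show ?case using C(1) K(1) by (intro exI[of _ "C * K"]) auto
  qed
  then show ?thesis using that by blast
qed

text \<open>Differentiability with respect to the norm of multilinear maps, which requires uniformity in the
  vectors \<open>vs\<close>. The derivative takes the increment as its \<open>n\<close>-th vector.\<close>

definition family_derivative :: "'b::real_normed_vector set \<Rightarrow> nat set \<Rightarrow> nat
    \<Rightarrow> ('b \<Rightarrow> (nat \<Rightarrow> 'b) \<Rightarrow> 'd::real_normed_vector) \<Rightarrow> ('b \<Rightarrow> (nat \<Rightarrow> 'b) \<Rightarrow> 'd) \<Rightarrow> bool" where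
  "family_derivative U S n f f' \<longleftrightarrow> (\<forall>x\<in>U. \<forall>e>0. \<exists>d>0. \<forall>y\<in>U. norm (y - x) < d \<longrightarrow>
     (\<forall>vs. norm (f y vs - f x vs - f' x (vs(n := y - x)))
        \<le> e * norm (y - x) * (\<Prod>i\<in>S. norm (vs i))))"

lemma family_derivativeD:
  assumes "family_derivative U S n f f'" "x \<in> U" "e > 0"
  obtains d where "d > 0" "\<And>y vs. y \<in> U \<Longrightarrow> norm (y - x) < d \<Longrightarrow>
    norm (f y vs - f x vs - f' x (vs(n := y - x))) \<le> e * norm (y - x) * (\<Prod>i\<in>S. norm (vs i))"
  using assms unfolding family_derivative_def by metis

lemma rat_bounded_upd:
  assumes "rat U G (insert n S) f" "n \<notin> S"
  obtains C where "C \<ge> 0" "\<And>vs h. norm (f z (vs(n := h))) \<le> C * norm h * (\<Prod>i\<in>S. norm (vs i))"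
proof -
  obtain C where C: "C \<ge> 0" "\<And>vs. norm (f z vs) \<le> C * (\<Prod>i\<in>insert n S. norm (vs i))"
    using rat_bounded[OF assms(1)] by blast
  have "finite S" using rat_finite[OF assms(1)] by simp
  then have "(\<Prod>i\<in>insert n S. norm ((vs(n := h)) i)) = norm h * (\<Prod>i\<in>S. norm (vs i))" for vs h
    using assms(2) by (simp add: prod.insert_remove) (intro disjI2 prod.cong; auto)
  then show ?thesis using that[OF C(1)] C(2) by (metis mult.assoc)
qed

text \<open>What the estimates for products and inverses use of differentiability besides the definition.\<close>

lemma family_derivative_Lipschitz:
  assumes f': "family_derivative U S n f f'" "rat U G (insert n S) f'" "n \<notin> S" and x: "x \<in> U"
  obtains d L where "d > 0" "L \<ge> 0" "\<And>y vs. y \<in> U \<Longrightarrow> norm (y - x) < d \<Longrightarrow>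
    norm (f y vs - f x vs) \<le> L * norm (y - x) * (\<Prod>i\<in>S. norm (vs i))"
proof -
  obtain C where C: "C \<ge> 0" "\<And>vs h. norm (f' x (vs(n := h))) \<le> C * norm h * (\<Prod>i\<in>S. norm (vs i))"
    using rat_bounded_upd[OF f'(2,3)] by blast
  obtain d where d: "d > 0" "\<And>y vs. y \<in> U \<Longrightarrow> norm (y - x) < d \<Longrightarrow>
      norm (f y vs - f x vs - f' x (vs(n := y - x))) \<le> 1 * norm (y - x) * (\<Prod>i\<in>S. norm (vs i))"
    using family_derivativeD[OF f'(1) x zero_less_one] by blast
  have "norm (f y vs - f x vs) \<le> (1 + C) * norm (y - x) * (\<Prod>i\<in>S. norm (vs i))"
    if "y \<in> U" "norm (y - x) < d" for y vs
  proof -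
    have "norm (f y vs - f x vs) \<le> norm (f y vs - f x vs - f' x (vs(n := y - x))) + norm (f' x (vs(n := y - x)))"
      by (metis norm_triangle_ineq diff_add_cancel)
    also have "\<dots> \<le> 1 * norm (y - x) * (\<Prod>i\<in>S. norm (vs i)) + C * norm (y - x) * (\<Prod>i\<in>S. norm (vs i))"
      using that by (intro add_mono d C)
    finally show ?thesis by (simp add: algebra_simps)
  qed
  then show ?thesis using that d(1) C(1) by (metis add_nonneg_nonneg zero_le_one)
qed

lemma family_derivative_add:
  assumes f: "family_derivative U S n f f'" and g: "family_derivative U S n g g'"
  shows "family_derivative U S n (\<lambda>z vs. f z vs + g z vs) (\<lambda>z vs. f' z vs + g' z vs)"
  unfolding family_derivative_def
proof (intro ballI allI impI)
  fix x and e :: real assume x: "x \<in> U" and "e > 0"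
  then have e: "e / 2 > 0" by simp
  obtain d1 where d1: "d1 > 0" "\<And>y vs. y \<in> U \<Longrightarrow> norm (y - x) < d1 \<Longrightarrow>
      norm (f y vs - f x vs - f' x (vs(n := y - x))) \<le> e / 2 * norm (y - x) * (\<Prod>i\<in>S. norm (vs i))"
    using family_derivativeD[OF f x e] by blast
  obtain d2 where d2: "d2 > 0" "\<And>y vs. y \<in> U \<Longrightarrow> norm (y - x) < d2 \<Longrightarrow>
      norm (g y vs - g x vs - g' x (vs(n := y - x))) \<le> e / 2 * norm (y - x) * (\<Prod>i\<in>S. norm (vs i))"
    using family_derivativeD[OF g x e] by blast
  have "norm (f y vs + g y vs - (f x vs + g x vs) - (f' x (vs(n := y - x)) + g' x (vs(n := y - x))))
      \<le> e * norm (y - x) * (\<Prod>i\<in>S. norm (vs i))"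
    if y: "y \<in> U" "norm (y - x) < min d1 d2" for y vs
  proof -
    have "f y vs + g y vs - (f x vs + g x vs) - (f' x (vs(n := y - x)) + g' x (vs(n := y - x)))
      = (f y vs - f x vs - f' x (vs(n := y - x))) + (g y vs - g x vs - g' x (vs(n := y - x)))"
      by (simp add: algebra_simps)
    also have "norm \<dots> \<le> e / 2 * norm (y - x) * (\<Prod>i\<in>S. norm (vs i)) + e / 2 * norm (y - x) * (\<Prod>i\<in>S. norm (vs i))"
      using y by (intro norm_triangle_le add_mono d1 d2) auto
    finally show ?thesis by (simp add: field_simps)
  qed
  then show "\<exists>d>0. \<forall>y\<in>U. norm (y - x) < d \<longrightarrow> (\<forall>vs. norm (f y vs + g y vs - (f x vs + g x vs)
      - (f' x (vs(n := y - x)) + g' x (vs(n := y - x)))) \<le> e * norm (y - x) * (\<Prod>i\<in>S. norm (vs i)))"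
    using d1(1) d2(1) by (intro exI[of _ "min d1 d2"]) auto
qed

lemma family_derivative_linear:
  assumes l: "bounded_linear l" and f: "family_derivative U S n f f'"
  shows "family_derivative U S n (\<lambda>z vs. l (f z vs)) (\<lambda>z vs. l (f' z vs))"
  unfolding family_derivative_def
proof (intro ballI allI impI)
  fix x and e :: real assume x: "x \<in> U" and e: "e > 0"
  obtain K where K: "K > 0" "\<And>x. norm (l x) \<le> norm x * K"
    using bounded_linear.pos_bounded[OF l] by blast
  have "e / K > 0" using e K by simp
  then obtain d where d: "d > 0" "\<And>y vs. y \<in> U \<Longrightarrow> norm (y - x) < d \<Longrightarrow>
      norm (f y vs - f x vs - f' x (vs(n := y - x))) \<le> e / K * norm (y - x) * (\<Prod>i\<in>S. norm (vs i))"
    using family_derivativeD[OF f x] by blast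
  have "norm (l (f y vs) - l (f x vs) - l (f' x (vs(n := y - x)))) \<le> e * norm (y - x) * (\<Prod>i\<in>S. norm (vs i))"
    if y: "y \<in> U" "norm (y - x) < d" for y vs
  proof -
    have "l (f y vs) - l (f x vs) - l (f' x (vs(n := y - x))) = l (f y vs - f x vs - f' x (vs(n := y - x)))"
      by (simp add: linear_simps(2)[OF l])
    also have "norm \<dots> \<le> norm (f y vs - f x vs - f' x (vs(n := y - x))) * K" by (rule K)
    also have "\<dots> \<le> (e / K * norm (y - x) * (\<Prod>i\<in>S. norm (vs i))) * K"
      using K y by (intro mult_right_mono d) auto
    finally show ?thesis using K(1) by (simp add: field_simps)
  qed
  then show "\<exists>d>0. \<forall>y\<in>U. norm (y - x) < d \<longrightarrow> (\<forall>vs. norm (l (f y vs) - l (f x vs)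
      - l (f' x (vs(n := y - x)))) \<le> e * norm (y - x) * (\<Prod>i\<in>S. norm (vs i)))"
    using d(1) by blast
qed

lemma family_derivative_slot:
  assumes \<gamma>: "bounded_bilinear \<gamma>" and f: "family_derivative U S n f f'"
    and i: "i \<notin> S" "i \<noteq> n" "finite S"
  shows "family_derivative U (insert i S) n (\<lambda>z vs. \<gamma> (f z vs) (vs i)) (\<lambda>z vs. \<gamma> (f' z vs) (vs i))"
  unfolding family_derivative_def
proof (intro ballI allI impI)
  fix x and e :: real assume x: "x \<in> U" and e: "e > 0"
  obtain K where K: "K > 0" "\<And>x y. norm (\<gamma> x y) \<le> norm x * norm y * K"
    using bounded_bilinear.pos_bounded[OF \<gamma>] by blast
  have "e / K > 0" using e K by simp
  then obtain d where d: "d > 0" "\<And>y vs. y \<in> U \<Longrightarrow> norm (y - x) < d \<Longrightarrow>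
      norm (f y vs - f x vs - f' x (vs(n := y - x))) \<le> e / K * norm (y - x) * (\<Prod>i\<in>S. norm (vs i))"
    using family_derivativeD[OF f x] by blast
  have "norm (\<gamma> (f y vs) (vs i) - \<gamma> (f x vs) (vs i) - \<gamma> (f' x (vs(n := y - x))) ((vs(n := y - x)) i))
      \<le> e * norm (y - x) * (\<Prod>i\<in>insert i S. norm (vs i))"
    if y: "y \<in> U" "norm (y - x) < d" for y vs
  proof -
    have "\<gamma> (f y vs) (vs i) - \<gamma> (f x vs) (vs i) - \<gamma> (f' x (vs(n := y - x))) ((vs(n := y - x)) i)
        = \<gamma> (f y vs - f x vs - f' x (vs(n := y - x))) (vs i)"
      using i by (simp add: bounded_bilinear.diff_left[OF \<gamma>])
    also have "norm \<dots> \<le> norm (f y vs - f x vs - f' x (vs(n := y - x))) * (norm (vs i) * K)"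
      using K(2) by (simp add: mult.assoc)
    also have "\<dots> \<le> (e / K * norm (y - x) * (\<Prod>i\<in>S. norm (vs i))) * (norm (vs i) * K)"
      using K y by (intro mult_right_mono d) auto
    also have "\<dots> = e * norm (y - x) * (\<Prod>i\<in>insert i S. norm (vs i))"
      using K(1) i by simp
    finally show ?thesis .
  qed
  then show "\<exists>d>0. \<forall>y\<in>U. norm (y - x) < d \<longrightarrow> (\<forall>vs. norm (\<gamma> (f y vs) (vs i) - \<gamma> (f x vs) (vs i)
      - \<gamma> (f' x (vs(n := y - x))) ((vs(n := y - x)) i)) \<le> e * norm (y - x) * (\<Prod>i\<in>insert i S. norm (vs i)))"
    using d(1) by blast
qed

lemma family_derivative_mult:
  assumes \<beta>: "bounded_bilinear \<beta>"
    and f: "rat U G S f" "rat U G (insert n S) f'" "family_derivative U S n f f'"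
    and g: "rat U G T g" "rat U G (insert n T) g'" "family_derivative U T n g g'"
    and disj: "S \<inter> T = {}" "n \<notin> S" "n \<notin> T"
  shows "family_derivative U (S \<union> T) n (\<lambda>z vs. \<beta> (f z vs) (g z vs))
    (\<lambda>z vs. \<beta> (f' z vs) (g z vs) + \<beta> (f z vs) (g' z vs))"
  unfolding family_derivative_def
proof (intro ballI allI impI)
  fix x and e :: real assume x: "x \<in> U" and e: "e > 0"
  note bi = bounded_bilinear.diff_left[OF \<beta>] bounded_bilinear.diff_right[OF \<beta>]
  obtain K where K: "K > 0" "\<And>x y. norm (\<beta> x y) \<le> norm x * norm y * K"
    using bounded_bilinear.pos_bounded[OF \<beta>] by blast
  obtain Cf where Cf: "Cf \<ge> 0" "\<And>vs. norm (f x vs) \<le> Cf * (\<Prod>i\<in>S. norm (vs i))"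
    using rat_bounded[OF f(1)] by blast
  obtain Cg where Cg: "Cg \<ge> 0" "\<And>vs. norm (g x vs) \<le> Cg * (\<Prod>i\<in>T. norm (vs i))"
    using rat_bounded[OF g(1)] by blast
  obtain Cf' where Cf': "Cf' \<ge> 0"
      "\<And>vs h. norm (f' x (vs(n := h))) \<le> Cf' * norm h * (\<Prod>i\<in>S. norm (vs i))"
    using rat_bounded_upd[OF f(2) disj(2)] by blast
  obtain d0 L where L: "d0 > 0" "L \<ge> 0" "\<And>y vs. y \<in> U \<Longrightarrow> norm (y - x) < d0 \<Longrightarrow>
      norm (g y vs - g x vs) \<le> L * norm (y - x) * (\<Prod>i\<in>T. norm (vs i))"
    using family_derivative_Lipschitz[OF g(3,2) disj(3) x] by blast
  define M where "M = Cf + Cg + Cf' + L + 1"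
  have M: "M > 0" "Cf \<le> M" "Cf' \<le> M" "L \<le> M" "Cg + L \<le> M"
    using Cf(1) Cg(1) Cf'(1) L(2) by (simp_all add: M_def)
  define a where "a = e / (3 * K * M)"
  have a: "a > 0" using e K M by (simp add: a_def)
  obtain d1 where d1: "d1 > 0" "\<And>y vs. y \<in> U \<Longrightarrow> norm (y - x) < d1 \<Longrightarrow>
      norm (f y vs - f x vs - f' x (vs(n := y - x))) \<le> a * norm (y - x) * (\<Prod>i\<in>S. norm (vs i))"
    using family_derivativeD[OF f(3) x a] by blast
  obtain d2 where d2: "d2 > 0" "\<And>y vs. y \<in> U \<Longrightarrow> norm (y - x) < d2 \<Longrightarrow>
      norm (g y vs - g x vs - g' x (vs(n := y - x))) \<le> a * norm (y - x) * (\<Prod>i\<in>T. norm (vs i))"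
    using family_derivativeD[OF g(3) x a] by blast
  define d where "d = Min {d0, d1, d2, 1, a / M}"
  have d: "d > 0" "d \<le> d0" "d \<le> d1" "d \<le> d2" "d \<le> 1" "d \<le> a / M"
    using L(1) d1(1) d2(1) a M(1) by (auto simp: d_def)
  have "norm (\<beta> (f y vs) (g y vs) - \<beta> (f x vs) (g x vs)
      - (\<beta> (f' x (vs(n := y - x))) (g x (vs(n := y - x))) + \<beta> (f x (vs(n := y - x))) (g' x (vs(n := y - x)))))
      \<le> e * norm (y - x) * (\<Prod>i\<in>S \<union> T. norm (vs i))"
    if y: "y \<in> U" "norm (y - x) < d" for y vs
  proof -
    define h where "h = y - x"
    define P where "P = (\<Prod>i\<in>S. norm (vs i))"
    define Q where "Q = (\<Prod>i\<in>T. norm (vs i))"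
    have PQ: "P \<ge> 0" "Q \<ge> 0" by (simp_all add: P_def Q_def prod_nonneg)
    define F where "F = f' x (vs(n := h))"
    define H where "H = g' x (vs(n := h))"
    have h: "norm h < d0" "norm h < d1" "norm h < d2" "norm h \<le> 1" "norm h \<le> a / M"
      using y d by (auto simp: h_def)
    have upd: "g x (vs(n := h)) = g x vs" "f x (vs(n := h)) = f x vs"
      using rat_upd[OF g(1) disj(3)] rat_upd[OF f(1) disj(2)] by auto
    have ef: "norm (f y vs - f x vs - F) \<le> a * norm h * P"
      using d1(2)[of y vs] y h by (simp add: F_def h_def P_def)
    have eg: "norm (g y vs - g x vs - H) \<le> a * norm h * Q"
      using d2(2)[of y vs] y h by (simp add: H_def h_def Q_def)
    have lg: "norm (g y vs - g x vs) \<le> L * norm h * Q"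
      using L(3)[of y vs] y h by (simp add: h_def Q_def)
    have "norm (g y vs) \<le> norm (g x vs) + norm (g y vs - g x vs)"
      by (metis norm_triangle_ineq add.commute diff_add_cancel)
    also have "\<dots> \<le> Cg * Q + L * norm h * Q"
      using Cg(2)[of vs] lg by (simp add: Q_def)
    also have "\<dots> \<le> Cg * Q + L * 1 * Q"
      using h(4) L(2) PQ by (intro add_left_mono mult_right_mono mult_left_mono) auto
    also have "\<dots> \<le> M * Q"
      using mult_right_mono[OF M(5) PQ(2)] by (simp add: distrib_right)
    finally have bg: "norm (g y vs) \<le> M * Q" .
    \<comment> \<open>The error of the product is the sum of three products: error of \<open>f\<close> times \<open>g\<close>, \<open>f\<close> times error of
      \<open>g\<close>, and the term of second order \<open>F (g y - g x)\<close>.\<close>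
    have t1: "norm (\<beta> (f y vs - f x vs - F) (g y vs)) \<le> (a * norm h * P) * (M * Q) * K"
      using ef bg K PQ a M by (intro order.trans[OF K(2)] mult_right_mono mult_mono) auto
    have "norm (f x vs) \<le> M * P"
      using Cf(2)[of vs] mult_right_mono[OF M(2) PQ(1)] by (simp add: P_def)
    then have t2: "norm (\<beta> (f x vs) (g y vs - g x vs - H)) \<le> (M * P) * (a * norm h * Q) * K"
      using eg K PQ a M by (intro order.trans[OF K(2)] mult_right_mono mult_mono) auto
    have "norm F \<le> Cf' * norm h * P" using Cf'(2) by (simp add: F_def P_def)
    also have "\<dots> \<le> M * norm h * P" using M PQ by (intro mult_right_mono) auto
    finally have bF: "norm F \<le> M * norm h * P" .
    have "norm (g y vs - g x vs) \<le> M * (a / M) * Q"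
      by (rule order.trans[OF lg]) (use h M L PQ a in \<open>intro mult_mono; auto\<close>)
    then have "norm (g y vs - g x vs) \<le> a * Q" using M by simp
    with bF have t3: "norm (\<beta> F (g y vs - g x vs)) \<le> (M * norm h * P) * (a * Q) * K"
      using K PQ a M by (intro order.trans[OF K(2)] mult_right_mono mult_mono) auto
    have "\<beta> (f y vs) (g y vs) - \<beta> (f x vs) (g x vs) - (\<beta> F (g x vs) + \<beta> (f x vs) H)
      = \<beta> (f y vs - f x vs - F) (g y vs) + \<beta> (f x vs) (g y vs - g x vs - H) + \<beta> F (g y vs - g x vs)"
      by (simp add: bi)
    also have "norm \<dots> \<le> (a * norm h * P) * (M * Q) * K + (M * P) * (a * norm h * Q) * K
        + (M * norm h * P) * (a * Q) * K"
      by (intro norm_triangle_le add_mono t1 t2 t3)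
    also have "\<dots> = (3 * K * M * a) * norm h * (P * Q)" by (simp add: algebra_simps)
    also have "3 * K * M * a = e" using K M by (simp add: a_def)
    also have "P * Q = (\<Prod>i\<in>S \<union> T. norm (vs i))"
      unfolding P_def Q_def using rat_finite[OF f(1)] rat_finite[OF g(1)] disj
      by (simp add: prod.union_disjoint)
    finally show ?thesis by (simp only: upd h_def[symmetric] F_def H_def)
  qed
  then show "\<exists>d>0. \<forall>y\<in>U. norm (y - x) < d \<longrightarrow> (\<forall>vs. norm (\<beta> (f y vs) (g y vs) - \<beta> (f x vs) (g x vs)
      - (\<beta> (f' x (vs(n := y - x))) (g x (vs(n := y - x))) + \<beta> (f x (vs(n := y - x))) (g' x (vs(n := y - x)))))
      \<le> e * norm (y - x) * (\<Prod>i\<in>S \<union> T. norm (vs i)))"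
    using d(1) by blast
qed

lemma family_derivative_inv:
  assumes f: "rat U G {} f" "rat U G {n} f'" "family_derivative U {} n f f'"
    and inv: "\<And>z vs. z \<in> U \<Longrightarrow> invertible_op (f z vs)"
  shows "family_derivative U {} n (\<lambda>z vs. inv_op (f z vs))
    (\<lambda>z vs. - (inv_op (f z vs) o\<^sub>L f' z vs o\<^sub>L inv_op (f z vs)))"
  unfolding family_derivative_def
proof (intro ballI allI impI)
  fix x and e :: real assume x: "x \<in> U" and e: "e > 0"
  define c where "c = f x (\<lambda>_. 0)"
  have fx: "f x vs = c" for vs unfolding c_def by (rule rat_cong_slots[OF f(1)]) simp
  define R where "R = norm (inv_op c) + 1"
  have R: "R > 0" "norm (inv_op c) \<le> R" using norm_ge_zero[of "inv_op c"] unfolding R_def by linarith+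
  obtain d0 L where L: "d0 > 0" "L \<ge> 0" "\<And>y vs. y \<in> U \<Longrightarrow> norm (y - x) < d0 \<Longrightarrow>
      norm (f y vs - f x vs) \<le> L * norm (y - x) * (\<Prod>i\<in>{}. norm (vs i))"
    using family_derivative_Lipschitz[OF f(3,2) _ x] by auto
  define a where "a = e / (2 * R\<^sup>2)"
  have a: "a > 0" using e R by (simp add: a_def)
  obtain d1 where d1: "d1 > 0" "\<And>y vs. y \<in> U \<Longrightarrow> norm (y - x) < d1 \<Longrightarrow>
      norm (f y vs - f x vs - f' x (vs(n := y - x))) \<le> a * norm (y - x) * (\<Prod>i\<in>{}. norm (vs i))"
    using family_derivativeD[OF f(3) x a] by blast
  define b where "b = e / (4 * R ^ 3 * (L + 1)\<^sup>2)"
  have b: "b > 0" using e R L by (simp add: b_def)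
  define d where "d = Min {d0, d1, 1 / (2 * R * (L + 1)), b}"
  have d: "d > 0" "d \<le> d0" "d \<le> d1" "d \<le> 1 / (2 * R * (L + 1))" "d \<le> b"
    using L d1(1) R b by (auto simp: d_def)
  have "norm (inv_op (f y vs) - inv_op (f x vs)
      - - (inv_op (f x (vs(n := y - x))) o\<^sub>L f' x (vs(n := y - x)) o\<^sub>L inv_op (f x (vs(n := y - x)))))
      \<le> e * norm (y - x) * (\<Prod>i\<in>{}. norm (vs i))"
    if y: "y \<in> U" "norm (y - x) < d" for y vs
  proof -
    define h where "h = y - x"
    define F where "F = f' x (vs(n := h))"
    define D where "D = f y vs - c"
    let ?r = "inv_op c"
    have h: "norm h < d0" "norm h < d1" "norm h \<le> 1 / (2 * R * (L + 1))" "norm h \<le> b"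
      using y d by (auto simp: h_def)
    have ef: "norm (D - F) \<le> a * norm h"
      using d1(2)[of y vs] y h by (simp add: F_def D_def h_def fx)
    have "norm D \<le> L * norm h" using L(3)[of y vs] y h by (simp add: D_def h_def fx)
    also have "\<dots> \<le> (L + 1) * norm h" by (intro mult_right_mono) auto
    finally have lD: "norm D \<le> (L + 1) * norm h" .
    have "norm D * norm ?r \<le> ((L + 1) * norm h) * R"
      using lD R L by (intro mult_mono) auto
    also have "\<dots> \<le> ((L + 1) * (1 / (2 * R * (L + 1)))) * R"
      using h(3) R L by (intro mult_right_mono mult_left_mono) auto
    also have "\<dots> = 1 / 2"
    proof -
      have "(q * (1 / (2 * R * q))) * R = 1 / 2" if "q > 0" for q :: real
        using that R by (simp add: field_simps)
      from this[of "L + 1"] show ?thesis using L(2) by simp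
    qed
    finally have near: "norm (f y vs - c) * norm ?r \<le> 1 / 2" by (simp add: D_def)
    have c: "invertible_op c" using inv[OF x] fx by metis
    have "norm (inv_op (f y vs) - ?r + (?r o\<^sub>L D o\<^sub>L ?r)) \<le> 2 * norm ?r ^ 3 * (norm D)\<^sup>2"
      using inv_op_bound(2)[OF c inv[OF y(1)] near] by (simp add: D_def)
    also have "\<dots> \<le> 2 * R ^ 3 * ((L + 1) * norm h)\<^sup>2"
      using lD R L by (intro mult_mono mult_left_mono power_mono) auto
    also have "\<dots> = (2 * R ^ 3 * (L + 1)\<^sup>2 * norm h) * norm h"
      by (simp add: power_mult_distrib power2_eq_square)
    also have "\<dots> \<le> (2 * R ^ 3 * (L + 1)\<^sup>2 * b) * norm h"
      using h(4) R L by (intro mult_right_mono mult_left_mono) auto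
    also have "2 * R ^ 3 * (L + 1)\<^sup>2 * b = e / 2" using R L by (simp add: b_def field_simps)
    finally have t1: "norm (inv_op (f y vs) - ?r + (?r o\<^sub>L D o\<^sub>L ?r)) \<le> e / 2 * norm h" .
    have "norm (?r o\<^sub>L (D - F) o\<^sub>L ?r) \<le> norm ?r * norm (D - F) * norm ?r"
      by (intro order.trans[OF norm_blinfun_compose] mult_right_mono norm_blinfun_compose norm_ge_zero)
    also have "\<dots> \<le> R * (a * norm h) * R"
      using ef R a by (intro mult_mono) auto
    also have "\<dots> = e / 2 * norm h" using R by (simp add: a_def power2_eq_square)
    finally have t2: "norm (?r o\<^sub>L (D - F) o\<^sub>L ?r) \<le> e / 2 * norm h" .
    \<comment> \<open>The increment \<open>D\<close> of \<open>f\<close> and its linear part \<open>F\<close> differ by a term of higher order.\<close>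
    have "inv_op (f y vs) - ?r - - (?r o\<^sub>L F o\<^sub>L ?r)
        = (inv_op (f y vs) - ?r + (?r o\<^sub>L D o\<^sub>L ?r)) - (?r o\<^sub>L (D - F) o\<^sub>L ?r)"
      by (simp add: compose_simps)
    also have "norm \<dots> \<le> e / 2 * norm h + e / 2 * norm h"
      by (intro order.trans[OF norm_triangle_ineq4] add_mono t1 t2)
    finally show ?thesis by (simp add: fx F_def h_def)
  qed
  then show "\<exists>d>0. \<forall>y\<in>U. norm (y - x) < d \<longrightarrow> (\<forall>vs. norm (inv_op (f y vs) - inv_op (f x vs)
      - - (inv_op (f x (vs(n := y - x))) o\<^sub>L f' x (vs(n := y - x)) o\<^sub>L inv_op (f x (vs(n := y - x)))))
      \<le> e * norm (y - x) * (\<Prod>i\<in>{}. norm (vs i)))"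
    using d(1) by blast
qed

text \<open>A set of functions whose derivatives are again rational in them, such as a function given by a
  differential equation with rational right hand side.\<close>

definition differentially_closed ::
    "'b::real_normed_vector set \<Rightarrow> ('b \<Rightarrow> 'x::real_normed_vector \<Rightarrow>\<^sub>L 'x) set \<Rightarrow> bool" where
  "differentially_closed U G \<longleftrightarrow> (\<forall>g\<in>G. \<exists>m \<gamma>. rat U G {} (\<lambda>z vs. m z) \<and> bounded_bilinear \<gamma> \<and>
     (\<forall>z\<in>U. (g has_derivative (\<lambda>h. \<gamma> (m z) h)) (at z within U)))"

text \<open>Each rule for \<^const>\<open>rat\<close> has a rule of differentiation whose result is again covered by the rules.
  The new vector is inserted in one factor of a product at a time, so that it too occurs exactly once.\<close>

lemma rat_has_derivative:
  assumes G: "differentially_closed U G" and "rat U G S f" "n \<notin> S"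
  shows "\<exists>f'. rat U G (insert n S) f' \<and> family_derivative U S n f f'"
  using assms(2,3)
proof (induction rule: rat.induct)
  case (rat_const c)
  have "rat U G {n} (\<lambda>z vs. 0)" by (rule rat.rat_zero) simp
  moreover have "family_derivative U {} n (\<lambda>z vs. c) (\<lambda>z vs. 0)"
    by (auto simp: family_derivative_def intro: exI[of _ 1])
  ultimately show ?case by blast
next
  case (rat_base g)
  obtain m \<gamma> where m: "rat U G {} (\<lambda>z vs. m z)" "bounded_bilinear \<gamma>"
      "\<And>z. z \<in> U \<Longrightarrow> (g has_derivative (\<lambda>h. \<gamma> (m z) h)) (at z within U)"
    using G rat_base unfolding differentially_closed_def by blast
  have "rat U G {n} (\<lambda>z vs. \<gamma> (m z) (vs n))" using rat.rat_slot[OF m(2,1)] by simp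
  moreover have "family_derivative U {} n (\<lambda>z vs. g z) (\<lambda>z vs. \<gamma> (m z) (vs n))"
    using m(3) unfolding family_derivative_def has_derivative_within_alt by simp
  ultimately show ?case by blast
next
  case (rat_zero S)
  have "rat U G (insert n S) (\<lambda>z vs. 0)" by (rule rat.rat_zero) (simp add: rat_zero)
  moreover have "family_derivative U S n (\<lambda>z vs. 0) (\<lambda>z vs. 0)"
    by (auto simp: family_derivative_def prod_nonneg intro!: exI[of _ 1])
  ultimately show ?case by blast
next
  case (rat_add S f g)
  then show ?case using rat.rat_add family_derivative_add by blast
next
  case (rat_linear l S f)
  then show ?case using rat.rat_linear family_derivative_linear by blast
next
  case (rat_mult \<beta> S f T g)
  then obtain f' g' where f': "rat U G (insert n S) f'" "family_derivative U S n f f'"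
    and g': "rat U G (insert n T) g'" "family_derivative U T n g g'" by auto
  have "rat U G (insert n S \<union> T) (\<lambda>z vs. \<beta> (f' z vs) (g z vs))"
    using rat_mult f' by (intro rat.rat_mult) auto
  moreover have "rat U G (S \<union> insert n T) (\<lambda>z vs. \<beta> (f z vs) (g' z vs))"
    using rat_mult g' by (intro rat.rat_mult) auto
  ultimately have "rat U G (insert n (S \<union> T)) (\<lambda>z vs. \<beta> (f' z vs) (g z vs) + \<beta> (f z vs) (g' z vs))"
    by (intro rat.rat_add) auto
  moreover have "family_derivative U (S \<union> T) n (\<lambda>z vs. \<beta> (f z vs) (g z vs))
      (\<lambda>z vs. \<beta> (f' z vs) (g z vs) + \<beta> (f z vs) (g' z vs))"
    by (rule family_derivative_mult) (use rat_mult f' g' in auto)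
  ultimately show ?case by blast
next
  case (rat_inv f)
  then obtain f' where f': "rat U G {n} f'" "family_derivative U {} n f f'" by auto
  let ?r = "\<lambda>z vs. inv_op (f z vs)"
  have r: "rat U G {} ?r" using rat_inv by (intro rat.rat_inv)
  have "rat U G ({} \<union> {n}) (\<lambda>z vs. ?r z vs o\<^sub>L f' z vs)"
    by (intro rat.rat_mult bounded_bilinear_blinfun_compose r f') simp
  then have "rat U G ({} \<union> {n} \<union> {}) (\<lambda>z vs. ?r z vs o\<^sub>L f' z vs o\<^sub>L ?r z vs)"
    by (rule rat.rat_mult[OF bounded_bilinear_blinfun_compose _ r]) simp
  then have "rat U G {n} (\<lambda>z vs. - (?r z vs o\<^sub>L f' z vs o\<^sub>L ?r z vs))"
    using rat.rat_linear[OF bounded_linear_minus[OF bounded_linear_ident]] by simp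
  moreover have "family_derivative U {} n ?r (\<lambda>z vs. - (?r z vs o\<^sub>L f' z vs o\<^sub>L ?r z vs))"
    using family_derivative_inv[OF rat_inv(1) f'] rat_inv by blast
  ultimately show ?case by blast
next
  case (rat_slot \<gamma> S f i)
  then obtain f' where f': "rat U G (insert n S) f'" "family_derivative U S n f f'" by auto
  have "rat U G (insert i (insert n S)) (\<lambda>z vs. \<gamma> (f' z vs) (vs i))"
    by (rule rat.rat_slot) (use rat_slot f' in auto)
  moreover have "family_derivative U (insert i S) n (\<lambda>z vs. \<gamma> (f z vs) (vs i)) (\<lambda>z vs. \<gamma> (f' z vs) (vs i))"
    using rat_slot f' by (intro family_derivative_slot) (auto dest: rat_finite)
  ultimately show ?case unfolding insert_commute[of n i] by blast
qed

text \<open>Iterated differentiation yields all derivatives at once. In the list of arguments the vector of the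
  latest differentiation comes first, whereas the \<open>i\<close>-th differentiation introduces the vector number
  \<open>i\<close>; hence the reversal.\<close>

theorem rat_smooth_on:
  fixes F :: "'b::real_normed_vector \<Rightarrow> 'x::real_normed_vector \<Rightarrow>\<^sub>L 'x"
    and l :: "('x \<Rightarrow>\<^sub>L 'x) \<Rightarrow> 'c::real_normed_vector"
  assumes G: "differentially_closed U G" and F: "rat U G {} (\<lambda>z vs. F z)" and l: "bounded_linear l"
  shows "smooth_on V U (\<lambda>z. l (F z))"
proof -
  have "\<exists>f. \<forall>n. rat U G {..<n} (f n) \<and> (n = 0 \<longrightarrow> f n = (\<lambda>z vs. F z)) \<and>
      family_derivative U {..<n} n (f n) (f (Suc n))"
  proof -
    have "\<exists>f. \<forall>n. (rat U G {..<n} (f n) \<and> (n = 0 \<longrightarrow> f n = (\<lambda>z vs. F z))) \<and>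
        family_derivative U {..<n} n (f n) (f (Suc n))"
    proof (rule dependent_nat_choice)
      show "\<exists>f. rat U G {..<0::nat} f \<and> ((0::nat) = 0 \<longrightarrow> f = (\<lambda>z vs. F z))" using F by auto
    next
      fix f n assume "rat U G {..<n} f \<and> (n = 0 \<longrightarrow> f = (\<lambda>z vs. F z))"
      then show "\<exists>f'. (rat U G {..<Suc n} f' \<and> (Suc n = 0 \<longrightarrow> f' = (\<lambda>z vs. F z))) \<and>
          family_derivative U {..<n} n f f'"
        using rat_has_derivative[OF G, of "{..<n}" f n] by (simp add: lessThan_Suc)
    qed
    then show ?thesis by blast
  qed
  then obtain f where f: "\<And>n. rat U G {..<n} (f n)" "f 0 = (\<lambda>z vs. F z)"
      "\<And>n. family_derivative U {..<n} n (f n) (f (Suc n))" by blast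
  define D where "D x vs = l (f (length vs) x (\<lambda>i. rev vs ! i))" for x vs
  have fl: "family_derivative U {..<n} n (\<lambda>z vs. l (f n z vs)) (\<lambda>z vs. l (f (Suc n) z vs))" for n
    by (rule family_derivative_linear[OF l f(3)])
  have prod: "(\<Prod>i<length vs. norm (rev vs ! i)) = prod_list (map norm vs)" for vs :: "'b list"
  proof -
    have "prod_list (map norm vs) = prod_list (rev (map norm vs))" by simp
    also have "\<dots> = (\<Prod>i=0..<length vs. rev (map norm vs) ! i)" by (simp add: prod.list_conv_set_nth)
    also have "\<dots> = (\<Prod>i=0..<length vs. norm (rev vs ! i))" by (intro prod.cong) (simp_all add: rev_map)
    finally show ?thesis by (simp add: atLeast0LessThan)
  qed
  show ?thesis
    unfolding smooth_on_def
  proof (intro exI[of _ D] ballI conjI allI impI)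
    fix x assume x: "x \<in> U"
    show "D x [] = l (F x)" by (simp add: D_def f(2))
    show "multilinear_on V (D x)"
      unfolding multilinear_on_def
    proof (intro allI impI)
      fix us v w ws r s
      have nth: "(\<lambda>i. rev (us @ z # ws) ! i) = (\<lambda>i. rev (us @ 0 # ws) ! i)(length ws := z)" for z :: 'b
        by (rule ext) (simp add: nth_append nth_Cons split: nat.split)
      have "length ws \<in> {..<Suc (length us + length ws)}" by simp
      note lin = rat_slotwise_linear[OF f(1) this]
      show "D x (us @ (r *\<^sub>R v + s *\<^sub>R w) # ws) = r *\<^sub>R D x (us @ v # ws) + s *\<^sub>R D x (us @ w # ws)"
        unfolding D_def nth[of "r *\<^sub>R v + s *\<^sub>R w"] nth[of v] nth[of w]
        using lin by (simp add: linear_simps(1)[OF l] linear_simps(5)[OF l] del: rev_append)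
    qed
    show "\<exists>C. \<forall>vs. length vs = n \<and> set vs \<subseteq> V \<longrightarrow> norm (D x vs) \<le> C * prod_list (map norm vs)" for n
    proof -
      obtain C where C: "C \<ge> 0" "\<And>vs. norm (f n x vs) \<le> C * (\<Prod>i<n. norm (vs i))"
        using rat_bounded[OF f(1)] by blast
      obtain K where K: "K > 0" "\<And>x. norm (l x) \<le> norm x * K"
        using bounded_linear.pos_bounded[OF l] by blast
      have "norm (D x vs) \<le> (C * K) * prod_list (map norm vs)" if n: "length vs = n" for vs
      proof -
        have "norm (D x vs) \<le> norm (f n x (\<lambda>i. rev vs ! i)) * K" unfolding D_def n by (rule K)
        also have "\<dots> \<le> (C * (\<Prod>i<n. norm (rev vs ! i))) * K" using K by (intro mult_right_mono C) auto
        finally show ?thesis using prod[of vs] n by (simp add: mult_ac)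
      qed
      then show ?thesis by blast
    qed
    fix n and e :: real assume "e > 0"
    then obtain d where d: "d > 0" "\<And>y vs. y \<in> U \<Longrightarrow> norm (y - x) < d \<Longrightarrow>
        norm (l (f n y vs) - l (f n x vs) - l (f (Suc n) x (vs(n := y - x))))
          \<le> e * norm (y - x) * (\<Prod>i<n. norm (vs i))"
      using family_derivativeD[OF fl x] by blast
    have "norm (D y vs - D x vs - D x ((y - x) # vs)) \<le> e * norm (y - x) * prod_list (map norm vs)"
      if y: "y \<in> U" "norm (y - x) < d" and n: "length vs = n" for y vs
    proof -
      have "f (Suc n) x (\<lambda>i. rev ((y - x) # vs) ! i) = f (Suc n) x ((\<lambda>i. rev vs ! i)(n := y - x))"
        by (rule rat_cong_slots[OF f(1)]) (use n in \<open>auto simp: nth_append\<close>)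
      then have "D x ((y - x) # vs) = l (f (Suc n) x ((\<lambda>i. rev vs ! i)(n := y - x)))"
        using n by (simp add: D_def del: rev.simps)
      then show ?thesis
        using d(2)[OF y, of "\<lambda>i. rev vs ! i"] prod[of vs] n by (simp add: D_def)
    qed
    then show "\<exists>d>0. \<forall>y\<in>U. norm (y - x) < d \<longrightarrow> (\<forall>vs. length vs = n \<and> set vs \<subseteq> V \<longrightarrow>
        norm (D y vs - D x vs - D x ((y - x) # vs)) \<le> e * norm (y - x) * prod_list (map norm vs))"
      using d(1) by blast
  qed
qed

lemma smooth_on_cong:
  assumes "smooth_on V U f" "\<And>x. x \<in> U \<Longrightarrow> f x = g x"
  shows "smooth_on V U g"
  using assms unfolding smooth_on_def by (elim exE, intro exI) auto

lemma rat_compose: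
  assumes "rat U G {} (\<lambda>z vs. f z)" "rat U G {} (\<lambda>z vs. g z)"
  shows "rat U G {} (\<lambda>z vs. f z o\<^sub>L g z)"
  using rat_mult[OF bounded_bilinear_blinfun_compose assms] by simp

lemma rat_diff:
  assumes "rat U G {} (\<lambda>z vs. f z)" "rat U G {} (\<lambda>z vs. g z)"
  shows "rat U G {} (\<lambda>z vs. f z - g z)"
  using rat_add[OF assms(1) rat_linear[OF bounded_linear_minus[OF bounded_linear_ident] assms(2)]] by simp

lemma rat_scaleR: "rat U G {} (\<lambda>z vs. f z) \<Longrightarrow> rat U G {} (\<lambda>z vs. c *\<^sub>R f z)"
  by (rule rat_linear[OF bounded_linear_scaleR_right])

lemma rat_inv_op:
  assumes "rat U G {} (\<lambda>z vs. f z)" "\<And>z. z \<in> U \<Longrightarrow> invertible_op (f z)"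
  shows "rat U G {} (\<lambda>z vs. inv_op (f z))"
  using rat_inv[OF assms(1)] assms(2) by blast

lemma differentially_closed_linear:
  assumes l: "bounded_linear l"
  shows "differentially_closed U {l}"
  unfolding differentially_closed_def
proof (intro ballI exI conjI)
  fix g z assume "g \<in> {l}"
  then have g: "g = l" by simp
  show "rat U {l} {} (\<lambda>z vs. id_blinfun)" by (rule rat_const)
  show "bounded_bilinear (\<lambda>T h. T o\<^sub>L l h)"
    by (rule bounded_bilinear.comp[OF bounded_bilinear_blinfun_compose bounded_linear_ident l])
  show "(g has_derivative (\<lambda>h. id_blinfun o\<^sub>L l h)) (at z within U)"
    using bounded_linear_imp_has_derivative[OF l] by (simp add: g)
qed

section \<open>The Cayley transform\<close>

lemma direction_translate:
  fixes S :: "'a::real_normed_vector set"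
  assumes "subspace S"
  shows "direction ((+) a ` S) = S"
proof (intro equalityI subsetI)
  fix s assume "s \<in> direction ((+) a ` S)"
  then obtain x y where "x \<in> S" "y \<in> S" "s = (a + x) - (a + y)"
    unfolding direction_def by blast
  then show "s \<in> S" using subspace_diff[OF assms] by simp
next
  fix s assume "s \<in> S"
  moreover have "s = (a + s) - (a + 0)" by simp
  ultimately show "s \<in> direction ((+) a ` S)"
    unfolding direction_def using subspace_0[OF assms] by blast
qed

lemma invertible_op_radj:
  assumes "invertible_op T"
  shows "invertible_op (radj T)" "inv_op (radj T) = radj (inv_op T)"
proof -
  have "radj (inv_op T) o\<^sub>L radj T = id_blinfun" "radj T o\<^sub>L radj (inv_op T) = id_blinfun"
    using inv_op[OF assms] by (metis radj_compose radj_id)+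
  then show "invertible_op (radj T)" "inv_op (radj T) = radj (inv_op T)" using inv_op_eqI by auto
qed

lemma bounded_ops_inv_op:
  assumes "T \<in> bounded_ops" "invertible_op T"
  shows "inv_op T \<in> bounded_ops"
  using bounded_ops_inverse[OF assms(1)] inv_op[OF assms(2)] by blast

text \<open>The Cayley transform \<open>(1 - y) (1 + y)\<^sup>-\<^sup>1\<close>, an involution that exchanges anti-hermitian and
  unitary operators.\<close>

definition cayley :: "('x::real_normed_vector \<Rightarrow>\<^sub>L 'x) \<Rightarrow> ('x \<Rightarrow>\<^sub>L 'x)" where
  "cayley y = 2 *\<^sub>R inv_op (id_blinfun + y) - id_blinfun"

lemma cayley_zero [simp]: "cayley 0 = id_blinfun"
  by (simp add: cayley_def scaleR_2)

lemma compose_scaleR: "(a *\<^sub>R S) o\<^sub>L (b *\<^sub>R T) = (a * b) *\<^sub>R (S o\<^sub>L T)"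
  by (simp add: bounded_bilinear.scaleR_left[OF bounded_bilinear_blinfun_compose]
      bounded_bilinear.scaleR_right[OF bounded_bilinear_blinfun_compose])

lemma cayley_involution:
  assumes "invertible_op (id_blinfun + y)"
  shows "invertible_op (id_blinfun + cayley y)" "cayley (cayley y) = y"
proof -
  let ?r = "inv_op (id_blinfun + y)"
  have eq: "id_blinfun + cayley y = 2 *\<^sub>R ?r" by (simp add: cayley_def)
  have "((1/2) *\<^sub>R (id_blinfun + y)) o\<^sub>L (2 *\<^sub>R ?r) = id_blinfun"
    "(2 *\<^sub>R ?r) o\<^sub>L ((1/2) *\<^sub>R (id_blinfun + y)) = id_blinfun"
    using inv_op[OF assms] by (simp_all add: compose_scaleR)
  then have *: "invertible_op (2 *\<^sub>R ?r)" "inv_op (2 *\<^sub>R ?r) = (1/2) *\<^sub>R (id_blinfun + y)"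
    using inv_op_eqI by blast+
  show "invertible_op (id_blinfun + cayley y)" using * by (simp add: eq)
  show "cayley (cayley y) = y" unfolding cayley_def[of "cayley y"] eq using * by simp
qed

text \<open>The factors \<open>1 + y\<close> and \<open>1 - y\<close> commute.\<close>

lemma cayley_minus_compose:
  assumes p: "invertible_op (id_blinfun + y)" and m: "invertible_op (id_blinfun - y)"
  shows "cayley (- y) o\<^sub>L cayley y = id_blinfun"
proof -
  let ?p = "id_blinfun + y" and ?m = "id_blinfun - y"
  have 1: "cayley y = ?m o\<^sub>L inv_op ?p"
  proof -
    have "2 *\<^sub>R inv_op ?p - (?p o\<^sub>L inv_op ?p) = ?m o\<^sub>L inv_op ?p"
      by (simp add: compose_simps scaleR_2)
    then show ?thesis using inv_op_right[OF p] by (simp add: cayley_def)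
  qed
  have 2: "cayley (- y) = inv_op ?m o\<^sub>L ?p"
  proof -
    have "2 *\<^sub>R inv_op ?m - (inv_op ?m o\<^sub>L ?m) = inv_op ?m o\<^sub>L ?p"
      by (simp add: compose_simps scaleR_2)
    then show ?thesis using inv_op_left[OF m] by (simp add: cayley_def)
  qed
  have comm: "?p o\<^sub>L ?m = ?m o\<^sub>L ?p" by (simp add: compose_simps algebra_simps)
  have "cayley (- y) o\<^sub>L cayley y = inv_op ?m o\<^sub>L (?p o\<^sub>L ?m) o\<^sub>L inv_op ?p"
    unfolding 1 2 by (simp only: compose_assoc)
  also have "\<dots> = (inv_op ?m o\<^sub>L ?m) o\<^sub>L (?p o\<^sub>L inv_op ?p)" unfolding comm by (simp only: compose_assoc)
  finally show ?thesis using inv_op[OF p] inv_op[OF m] by simp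
qed

lemma radj_cayley:
  assumes "invertible_op (id_blinfun + y)"
  shows "radj (cayley y) = cayley (radj y)"
  using invertible_op_radj(2)[OF assms] by (simp add: cayley_def radj_diff radj_scaleR radj_add)

lemma cayley_has_derivative:
  fixes y :: "'x::banach \<Rightarrow>\<^sub>L 'x"
  assumes y: "invertible_op (id_blinfun + y)"
  shows "(cayley has_derivative
    (\<lambda>h. - 2 *\<^sub>R (inv_op (id_blinfun + y) o\<^sub>L h o\<^sub>L inv_op (id_blinfun + y)))) (at y)"
proof -
  have "(inv_op has_derivative (\<lambda>h. - (inv_op (id_blinfun + y) o\<^sub>L h o\<^sub>L inv_op (id_blinfun + y))))
      (at (id_blinfun + y))"
    using inv_op_has_derivative[OF y] at_within_open[OF _ open_invertible] y by (metis mem_Collect_eq)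
  moreover have "((+) id_blinfun has_derivative (\<lambda>h. h)) (at y)"
    by (auto intro!: derivative_eq_intros)
  ultimately have "((\<lambda>y. inv_op (id_blinfun + y)) has_derivative
      (\<lambda>h. - (inv_op (id_blinfun + y) o\<^sub>L h o\<^sub>L inv_op (id_blinfun + y)))) (at y)"
    using has_derivative_compose by blast
  then have "((\<lambda>y. 2 *\<^sub>R inv_op (id_blinfun + y) - id_blinfun) has_derivative
      (\<lambda>h. 2 *\<^sub>R (- (inv_op (id_blinfun + y) o\<^sub>L h o\<^sub>L inv_op (id_blinfun + y))) - 0)) (at y)"
    by (intro has_derivative_diff has_derivative_scaleR_right has_derivative_const)
  then show ?thesis by (simp add: cayley_def[abs_def])
qed

lemma open_invertible_id_plus: "open {y :: 'x::banach \<Rightarrow>\<^sub>L 'x. invertible_op (id_blinfun + y)}"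
proof -
  have "open ((\<lambda>y. id_blinfun + y) -` {T :: 'x \<Rightarrow>\<^sub>L 'x. invertible_op T})"
    by (intro open_vimage open_invertible continuous_intros)
  then show ?thesis by (simp add: vimage_def)
qed

lemma continuous_on_cayley:
  "continuous_on {y :: 'x::banach \<Rightarrow>\<^sub>L 'x. invertible_op (id_blinfun + y)} cayley"
  by (rule continuous_at_imp_continuous_on) (auto intro: has_derivative_continuous cayley_has_derivative)

lemma rat_cayley:
  assumes "rat U G {} (\<lambda>z vs. f z)" "\<And>z. z \<in> U \<Longrightarrow> invertible_op (id_blinfun + f z)"
  shows "rat U G {} (\<lambda>z vs. cayley (f z))"
  unfolding cayley_def
  by (intro rat_diff rat_scaleR rat_inv_op rat_add[OF rat_const] rat_const assms)

lemma compact_cayley: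
  assumes w: "w - id_blinfun \<in> compact_ops" and inv: "invertible_op (id_blinfun + w)"
  shows "cayley w \<in> compact_ops"
proof -
  have b: "id_blinfun + w \<in> bounded_ops"
  proof -
    have "id_blinfun + w = (w - id_blinfun) + 2 *\<^sub>R id_blinfun" by (simp add: scaleR_2)
    then show ?thesis using w by (metis bounded_ops_add bounded_ops_scaleR bounded_ops_id compact_bounded)
  qed
  have "cayley w = - (inv_op (id_blinfun + w) o\<^sub>L (w - id_blinfun))"
  proof -
    have "2 *\<^sub>R inv_op (id_blinfun + w) - (inv_op (id_blinfun + w) o\<^sub>L (id_blinfun + w))
        = - (inv_op (id_blinfun + w) o\<^sub>L (w - id_blinfun))"
      by (simp add: compose_simps scaleR_2)
    then show ?thesis by (simp only: cayley_def inv_op_left[OF inv])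
  qed
  then show ?thesis
    using compact_ops_minus[OF compact_ops_compose_left[OF bounded_ops_inv_op[OF b inv] w]] by simp
qed

lemma cayley_minus_id_compact:
  assumes y: "y \<in> compact_ops" and inv: "invertible_op (id_blinfun + y)"
  shows "cayley y - id_blinfun \<in> compact_ops"
proof -
  have b: "id_blinfun + y \<in> bounded_ops"
    using y by (metis bounded_ops_add bounded_ops_id compact_bounded)
  have "cayley y - id_blinfun = (-2) *\<^sub>R (inv_op (id_blinfun + y) o\<^sub>L y)"
  proof -
    have "2 *\<^sub>R inv_op (id_blinfun + y) - 2 *\<^sub>R (inv_op (id_blinfun + y) o\<^sub>L (id_blinfun + y))
        = (-2) *\<^sub>R (inv_op (id_blinfun + y) o\<^sub>L y)"
      by (simp add: compose_simps scaleR_add_right)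
    moreover have "cayley y - id_blinfun = 2 *\<^sub>R inv_op (id_blinfun + y) - 2 *\<^sub>R (inv_op (id_blinfun + y) o\<^sub>L (id_blinfun + y))"
      unfolding inv_op_left[OF inv] by (simp add: cayley_def scaleR_2 diff_diff_eq)
    ultimately show ?thesis by simp
  qed
  then show ?thesis
    using compact_ops_scaleR[OF compact_ops_compose_left[OF bounded_ops_inv_op[OF b inv] y], of "-2"] by simp
qed

section \<open>The unitary Fredholm group\<close>

lemma unitary_fredholm_iff:
  "u \<in> unitary_fredholm \<longleftrightarrow> u \<in> bounded_ops \<and> u - id_blinfun \<in> compact_ops \<and>
     radj u o\<^sub>L u = id_blinfun \<and> u o\<^sub>L radj u = id_blinfun"
  by (auto simp: unitary_fredholm_def unitary_iff)

lemma unitary_fredholmD: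
  fixes u x :: "'a::complex_hilbert_space \<Rightarrow>\<^sub>L 'a"
  assumes "u \<in> unitary_fredholm"
  shows "u \<in> bounded_ops" "radj u \<in> bounded_ops" "u - id_blinfun \<in> compact_ops"
    "radj u o\<^sub>L u = id_blinfun" "u o\<^sub>L radj u = id_blinfun"
    "radj u o\<^sub>L (u o\<^sub>L x) = x" "u o\<^sub>L (radj u o\<^sub>L x) = x"
  using assms bounded_ops_radj by (auto simp: unitary_fredholm_iff simp flip: compose_assoc)

lemma unitary_fredholm_id [simp]: "id_blinfun \<in> unitary_fredholm"
  by (simp add: unitary_fredholm_iff)

lemma unitary_fredholm_compose:
  assumes u: "u \<in> unitary_fredholm" and v: "v \<in> unitary_fredholm"
  shows "u o\<^sub>L v \<in> unitary_fredholm"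
proof -
  note U = unitary_fredholmD[OF u] and V = unitary_fredholmD[OF v]
  have "(u o\<^sub>L v) - id_blinfun = (u o\<^sub>L (v - id_blinfun)) + (u - id_blinfun)"
    by (simp add: compose_simps)
  then have "(u o\<^sub>L v) - id_blinfun \<in> compact_ops"
    using U V by (metis compact_ops_add compact_ops_compose_left)
  then show ?thesis
    using U V by (simp add: unitary_fredholm_iff bounded_ops_compose compose_assoc)
qed

lemma unitary_fredholm_radj:
  assumes "u \<in> unitary_fredholm"
  shows "radj u \<in> unitary_fredholm"
  using unitary_fredholmD[OF assms] compact_ops_radj[of "u - id_blinfun"]
  by (simp add: unitary_fredholm_iff radj_diff)

lemma cayley_unitary_fredholm:
  assumes y: "y \<in> compact_ah_ops" and inv: "invertible_op (id_blinfun + y)"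
  shows "cayley y \<in> unitary_fredholm" "radj (cayley y) = cayley (- y)"
proof -
  have y': "y \<in> compact_ops" "radj y = - y" using y by (auto simp: compact_ah_ops_def)
  have m: "invertible_op (id_blinfun - y)"
    using invertible_op_radj(1)[OF inv] y' by (simp add: radj_add)
  show adj: "radj (cayley y) = cayley (- y)" using radj_cayley[OF inv] y' by simp
  have K: "cayley y - id_blinfun \<in> compact_ops" by (rule cayley_minus_id_compact[OF y'(1) inv])
  then have "cayley y \<in> bounded_ops"
    by (metis bounded_ops_add bounded_ops_id compact_bounded diff_add_cancel)
  moreover have "cayley (- (- y)) o\<^sub>L cayley (- y) = id_blinfun"
    by (rule cayley_minus_compose) (use inv m in simp_all)
  ultimately show "cayley y \<in> unitary_fredholm"
    using K cayley_minus_compose[OF inv m] by (simp add: unitary_fredholm_iff adj)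
qed

text \<open>From \<open>1 + w\<^sup>\<star> = w\<^sup>\<star> (1 + w)\<close> one gets \<open>(1 + w\<^sup>\<star>)\<^sup>-\<^sup>1 = (1 + w)\<^sup>-\<^sup>1 w\<close>, and the two Cayley transforms add
  up to zero.\<close>

lemma cayley_of_unitary:
  assumes w: "w \<in> unitary_fredholm" and inv: "invertible_op (id_blinfun + w)"
  shows "cayley w \<in> compact_ah_ops"
proof -
  note W = unitary_fredholmD[OF w]
  let ?r = "inv_op (id_blinfun + w)"
  have adj: "id_blinfun + radj w = radj w o\<^sub>L (id_blinfun + w)"
    using W by (simp add: compose_simps add.commute)
  have "inv_op (id_blinfun + radj w) = ?r o\<^sub>L w"
  proof (rule inv_op_eqI)
    show "(?r o\<^sub>L w) o\<^sub>L (id_blinfun + radj w) = id_blinfun"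
      unfolding adj compose_assoc by (simp add: W inv_op[OF inv])
    show "(id_blinfun + radj w) o\<^sub>L (?r o\<^sub>L w) = id_blinfun"
      unfolding adj compose_assoc by (simp add: W inv_op_cancel[OF inv])
  qed
  then have "cayley (radj w) + cayley w = 2 *\<^sub>R (?r o\<^sub>L (id_blinfun + w)) - 2 *\<^sub>R id_blinfun"
    by (simp add: cayley_def compose_simps scaleR_add_right scaleR_2)
  also have "\<dots> = 0" by (simp only: inv_op_left[OF inv] diff_self)
  finally have "radj (cayley w) = - cayley w"
    using radj_cayley[OF inv] by (simp add: eq_neg_iff_add_eq_0)
  then show ?thesis using compact_cayley[OF W(3) inv] by (simp add: compact_ah_ops_def)
qed

lemma direction_unitary_fredholm_space: "direction unitary_fredholm_space = compact_ops"
  unfolding unitary_fredholm_space_def by (rule direction_translate[OF subspace_compact_ops])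

lemma mem_unitary_fredholm_space: "w \<in> unitary_fredholm_space \<longleftrightarrow> w - id_blinfun \<in> compact_ops"
proof
  assume "w - id_blinfun \<in> compact_ops"
  then have "id_blinfun + (w - id_blinfun) \<in> unitary_fredholm_space"
    unfolding unitary_fredholm_space_def by (rule imageI)
  then show "w \<in> unitary_fredholm_space" by simp
next
  assume "w \<in> unitary_fredholm_space"
  then obtain k where "k \<in> compact_ops" "w = id_blinfun + k"
    unfolding unitary_fredholm_space_def by blast
  then show "w - id_blinfun \<in> compact_ops" by simp
qed

lemma translate_mem_unitary_fredholm_space:
  assumes u: "u \<in> unitary_fredholm"
  shows "u o\<^sub>L w \<in> unitary_fredholm_space \<longleftrightarrow> w \<in> unitary_fredholm_space"
proof -
  note U = unitary_fredholmD[OF u] and U' = unitary_fredholmD[OF unitary_fredholm_radj[OF u]]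
  have *: "v o\<^sub>L w \<in> unitary_fredholm_space"
    if v: "v \<in> unitary_fredholm" "w \<in> unitary_fredholm_space" for v w :: "'a \<Rightarrow>\<^sub>L 'a"
  proof -
    have "(v o\<^sub>L w) - id_blinfun = (v o\<^sub>L (w - id_blinfun)) + (v - id_blinfun)"
      by (simp add: compose_simps)
    then show ?thesis
      using v unitary_fredholmD[OF v(1)] unfolding mem_unitary_fredholm_space
      by (metis compact_ops_add compact_ops_compose_left)
  qed
  show ?thesis
    using *[OF u, of w] *[OF unitary_fredholm_radj[OF u], of "u o\<^sub>L w"] U by auto
qed

text \<open>The Cayley transform, translated by \<open>u\<close>, is rational in both directions and turns the unitary
  operators into the anti-hermitian ones. The open set \<open>N\<close> serves to shrink the domain of the chart.\<close>

lemma unitary_fredholm_chart: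
  fixes N :: "('a::complex_hilbert_space \<Rightarrow>\<^sub>L 'a) set"
  assumes u: "u \<in> unitary_fredholm" and N: "open N" "u \<in> N"
  defines "U \<equiv> {w \<in> unitary_fredholm_space. w \<in> N \<and> invertible_op (id_blinfun + (radj u o\<^sub>L w))}"
    and "\<phi> \<equiv> \<lambda>w. cayley (radj u o\<^sub>L w)"
  shows "submanifold_chart unitary_fredholm_space unitary_fredholm u U \<phi> compact_ah_ops"
    and "\<And>y. y \<in> \<phi> ` U \<Longrightarrow> inv_into U \<phi> y = u o\<^sub>L cayley y \<and> invertible_op (id_blinfun + y)"
proof -
  note uD = unitary_fredholmD[OF u]
  define \<kappa> where "\<kappa> y = u o\<^sub>L cayley y" for y
  have \<kappa>\<phi>: "\<kappa> (\<phi> w) = w" if "w \<in> U" for w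
    using that uD by (simp add: \<kappa>_def \<phi>_def U_def cayley_involution)
  have inj: "inj_on \<phi> U" by (metis \<kappa>\<phi> inj_on_def)
  have image: "\<phi> ` U = compact_ops \<inter> ({y. invertible_op (id_blinfun + y)} \<inter> \<kappa> -` N)"
  proof (intro equalityI subsetI)
    fix y assume "y \<in> \<phi> ` U"
    then obtain w where w: "w \<in> U" "y = \<phi> w" by blast
    have "radj u o\<^sub>L w \<in> unitary_fredholm_space"
      using w translate_mem_unitary_fredholm_space[OF unitary_fredholm_radj[OF u]] by (simp add: U_def)
    then have "y \<in> compact_ops"
      using w by (simp add: \<phi>_def U_def compact_cayley mem_unitary_fredholm_space)
    then show "y \<in> compact_ops \<inter> ({y. invertible_op (id_blinfun + y)} \<inter> \<kappa> -` N)"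
      using w \<kappa>\<phi>[OF w(1)] cayley_involution(1)[of "radj u o\<^sub>L w"] by (simp add: \<phi>_def U_def)
  next
    fix y assume y: "y \<in> compact_ops \<inter> ({y. invertible_op (id_blinfun + y)} \<inter> \<kappa> -` N)"
    have "\<kappa> y \<in> unitary_fredholm_space"
      using y cayley_minus_id_compact[of y] translate_mem_unitary_fredholm_space[OF u]
      by (simp add: \<kappa>_def mem_unitary_fredholm_space)
    moreover have "radj u o\<^sub>L \<kappa> y = cayley y" using uD by (simp add: \<kappa>_def)
    ultimately have "\<kappa> y \<in> U" "\<phi> (\<kappa> y) = y"
      using y cayley_involution[of y] by (auto simp: U_def \<phi>_def)
    then show "y \<in> \<phi> ` U" by (metis imageI)
  qed
  have inv: "inv_into U \<phi> y = \<kappa> y" if "y \<in> \<phi> ` U" for y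
    using that inj \<kappa>\<phi> by (auto simp: inv_into_f_f)
  show "\<And>y. y \<in> \<phi> ` U \<Longrightarrow> inv_into U \<phi> y = u o\<^sub>L cayley y \<and> invertible_op (id_blinfun + y)"
    using inv image by (auto simp: \<kappa>_def)
  have id: "bounded_linear (\<lambda>w :: 'a \<Rightarrow>\<^sub>L 'a. w)" by (rule bounded_linear_ident)
  have base: "rat X {\<lambda>w. w} {} (\<lambda>w vs. w)" for X :: "('a \<Rightarrow>\<^sub>L 'a) set" by (rule rat_base) simp
  show "submanifold_chart unitary_fredholm_space unitary_fredholm u U \<phi> compact_ah_ops"
    unfolding submanifold_chart_def direction_unitary_fredholm_space
  proof (intro conjI inj subspace_compact_ah_ops closed_compact_ah_ops)
    have "open ((\<lambda>w. radj u o\<^sub>L w) -` {y. invertible_op (id_blinfun + y)})"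
      by (intro open_vimage open_invertible_id_plus continuous_intros)
    then have "openin (top_of_set unitary_fredholm_space)
        (unitary_fredholm_space \<inter> (N \<inter> (\<lambda>w. radj u o\<^sub>L w) -` {y. invertible_op (id_blinfun + y)}))"
      using N by (intro openin_open_Int open_Int)
    moreover have "U = unitary_fredholm_space \<inter> (N \<inter> (\<lambda>w. radj u o\<^sub>L w) -` {y. invertible_op (id_blinfun + y)})"
      by (auto simp: U_def)
    ultimately show "openin (top_of_set unitary_fredholm_space) U" by simp
    have "(1/2) *\<^sub>R id_blinfun o\<^sub>L (id_blinfun + (id_blinfun :: 'a \<Rightarrow>\<^sub>L 'a)) = id_blinfun"
      "(id_blinfun + (id_blinfun :: 'a \<Rightarrow>\<^sub>L 'a)) o\<^sub>L (1/2) *\<^sub>R id_blinfun = id_blinfun"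
      by (simp_all add: compose_simps flip: scaleR_2)
    then have "invertible_op (id_blinfun + (id_blinfun :: 'a \<Rightarrow>\<^sub>L 'a))" by (rule inv_op_eqI)
    then show "u \<in> U" using N uD by (simp add: U_def mem_unitary_fredholm_space)
    have "continuous_on {y. invertible_op (id_blinfun + y)} \<kappa>"
      unfolding \<kappa>_def by (intro continuous_intros continuous_on_cayley)
    then have "open ({y. invertible_op (id_blinfun + y)} \<inter> \<kappa> -` N)"
      by (rule continuous_open_preimage[OF _ open_invertible_id_plus N(1)])
    then show "openin (top_of_set compact_ops) (\<phi> ` U)" unfolding image by (rule openin_open_Int)
    show "smooth_on compact_ops U \<phi>"
    proof (rule rat_smooth_on[OF differentially_closed_linear[OF id] _ id])
      show "rat U {\<lambda>w. w} {} (\<lambda>w vs. \<phi> w)"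
        unfolding \<phi>_def by (intro rat_cayley rat_compose rat_const base) (simp add: U_def)
    qed
    have "smooth_on compact_ops (\<phi> ` U) \<kappa>"
    proof (rule rat_smooth_on[OF differentially_closed_linear[OF id] _ id])
      show "rat (\<phi> ` U) {\<lambda>w. w} {} (\<lambda>w vs. \<kappa> w)"
        unfolding \<kappa>_def by (intro rat_cayley rat_compose rat_const base) (simp add: image)
    qed
    then show "smooth_on compact_ops (\<phi> ` U) (inv_into U \<phi>)"
      by (rule smooth_on_cong) (simp add: inv)
    show "compact_ah_ops \<subseteq> compact_ops" by (auto simp: compact_ah_ops_def)
    show "\<phi> ` (U \<inter> unitary_fredholm) = \<phi> ` U \<inter> compact_ah_ops"
    proof (intro equalityI subsetI)
      fix y assume "y \<in> \<phi> ` (U \<inter> unitary_fredholm)"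
      then obtain w where w: "w \<in> U" "w \<in> unitary_fredholm" "y = \<phi> w" by blast
      then have "radj u o\<^sub>L w \<in> unitary_fredholm"
        using u by (intro unitary_fredholm_compose unitary_fredholm_radj)
      then show "y \<in> \<phi> ` U \<inter> compact_ah_ops"
        using w cayley_of_unitary by (auto simp: \<phi>_def U_def)
    next
      fix y assume y: "y \<in> \<phi> ` U \<inter> compact_ah_ops"
      then have "cayley y \<in> unitary_fredholm" using image cayley_unitary_fredholm by blast
      then have "\<kappa> y \<in> unitary_fredholm" unfolding \<kappa>_def by (rule unitary_fredholm_compose[OF u])
      then show "y \<in> \<phi> ` (U \<inter> unitary_fredholm)" using y \<kappa>\<phi> by force
    qed
  qed
qed

section \<open>Tangent vectors\<close>

text \<open>Difference quotients of the curve lie in \<open>S\<close>.\<close>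

lemma vector_derivative_in_closed_subspace:
  assumes S: "subspace S" "closed S" and e: "e > 0"
    and \<gamma>: "\<And>t. t \<in> {-e<..<e} \<Longrightarrow> \<gamma> t - \<gamma> 0 \<in> S"
    and v: "(\<gamma> has_vector_derivative v) (at (0::real))"
  shows "v \<in> S"
proof -
  have "\<exists>s\<in>S. dist s v < a" if a: "a > 0" for a
  proof -
    have "a / 2 > 0" using a by simp
    then obtain d where d: "d > 0" "\<And>t. norm t < d \<Longrightarrow> norm (\<gamma> t - \<gamma> 0 - t *\<^sub>R v) \<le> a / 2 * norm t"
      using v unfolding has_vector_derivative_def has_derivative_at_alt by (metis diff_zero)
    define t where "t = min d e / 2"
    have t: "t > 0" "t < d" "t < e" using d(1) e by (auto simp: t_def min_def)
    have "(\<gamma> t - \<gamma> 0) /\<^sub>R t - v = (\<gamma> t - \<gamma> 0 - t *\<^sub>R v) /\<^sub>R t"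
      using t by (simp add: scaleR_diff_right)
    then have "norm ((\<gamma> t - \<gamma> 0) /\<^sub>R t - v) = norm (\<gamma> t - \<gamma> 0 - t *\<^sub>R v) / t"
      using t by (simp add: divide_inverse mult.commute)
    also have "\<dots> \<le> a / 2" using d(2)[of t] t by (simp add: divide_le_eq)
    also have "\<dots> < a" using a by simp
    finally have "dist ((\<gamma> t - \<gamma> 0) /\<^sub>R t) v < a" by (simp add: dist_norm)
    moreover have "(\<gamma> t - \<gamma> 0) /\<^sub>R t \<in> S" using S(1) \<gamma>[of t] t by (intro subspace_scale) auto
    ultimately show ?thesis by blast
  qed
  then have "v \<in> closure S" unfolding closure_approachable by blast
  then show ?thesis using S(2) by (simp add: closure_closed)
qed

lemma vector_derivative_of_locally_constant:
  assumes e: "e > 0" and c: "\<And>t. t \<in> {-e<..<e} \<Longrightarrow> f t = c"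
    and v: "(f has_vector_derivative v) (at (0::real))"
  shows "v = 0"
proof -
  have "(f has_vector_derivative 0) (at 0)"
    by (rule has_vector_derivative_transform_within_open[OF has_vector_derivative_const, of "{-e<..<e}" 0 c])
      (use e c in auto)
  then show ?thesis using v by (rule vector_derivative_unique_at[symmetric])
qed

lemma has_vector_derivative_compose_op:
  assumes "(f has_vector_derivative f') (at t)" "(g has_vector_derivative g') (at t)"
  shows "((\<lambda>t. f t o\<^sub>L g t) has_vector_derivative ((f' o\<^sub>L g t) + (f t o\<^sub>L g'))) (at t)"
  using bounded_bilinear.has_vector_derivative[OF bounded_bilinear_blinfun_compose assms]
  by (simp add: add.commute)

lemma has_vector_derivative_radj:
  "(f has_vector_derivative f') F \<Longrightarrow> ((\<lambda>t. radj (f t)) has_vector_derivative radj f') F"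
  by (rule bounded_linear.has_vector_derivative[OF bounded_linear_radj])

definition cayley_curve :: "('x::real_normed_vector \<Rightarrow>\<^sub>L 'x) \<Rightarrow> real \<Rightarrow> ('x \<Rightarrow>\<^sub>L 'x)" where
  "cayley_curve x t = cayley ((- t / 2) *\<^sub>R x)"

lemma cayley_curve_zero [simp]: "cayley_curve x 0 = id_blinfun"
  by (simp add: cayley_curve_def)

lemma cayley_curve_has_vector_derivative:
  fixes x :: "'x::banach \<Rightarrow>\<^sub>L 'x"
  shows "(cayley_curve x has_vector_derivative x) (at 0)"
proof -
  have "(cayley has_derivative (\<lambda>h. - 2 *\<^sub>R h)) (at ((- 0 / 2) *\<^sub>R x))"
    using cayley_has_derivative[of "0 :: 'x \<Rightarrow>\<^sub>L 'x"] by simp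
  moreover have "((\<lambda>t. (- t / 2) *\<^sub>R x) has_derivative (\<lambda>t. (- t / 2) *\<^sub>R x)) (at 0)"
    by (auto intro!: derivative_eq_intros)
  ultimately have "((\<lambda>t. cayley ((- t / 2) *\<^sub>R x)) has_derivative (\<lambda>t. - 2 *\<^sub>R ((- t / 2) *\<^sub>R x))) (at 0)"
    by (rule has_derivative_compose[rotated])
  then show ?thesis by (simp add: has_vector_derivative_def cayley_curve_def[abs_def])
qed

text \<open>As long as \<open>(t / 2) x\<close> has norm less than one, the Cayley transform is defined there and the curve is
  rational in \<open>t\<close>. The factors \<open>u\<close> and \<open>B\<close> provide for translates and for their images under orbit
  maps.\<close>

lemma cayley_curve_smooth:
  fixes x :: "'a::complex_hilbert_space \<Rightarrow>\<^sub>L 'a"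
  assumes x: "x \<in> compact_ah_ops"
  shows "\<exists>e>0. (\<forall>t\<in>{-e<..<e}. cayley_curve x t \<in> unitary_fredholm) \<and>
    (\<forall>u :: 'a \<Rightarrow>\<^sub>L 'a. smooth_on UNIV {-e<..<e} (\<lambda>t. u o\<^sub>L cayley_curve x t)) \<and>
    (\<forall>u B :: 'a \<Rightarrow>\<^sub>L 'a. smooth_on UNIV {-e<..<e}
      (\<lambda>t. u o\<^sub>L cayley_curve x t o\<^sub>L B o\<^sub>L radj (u o\<^sub>L cayley_curve x t)))"
proof -
  define e where "e = 1 / (1 + norm x)"
  have n: "1 + norm x > 0" using norm_ge_zero[of x] by linarith
  then have e: "e > 0" by (simp add: e_def)
  have inv: "invertible_op (id_blinfun + (- t / 2) *\<^sub>R x)" if t: "t \<in> {-e<..<e}" for t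
  proof -
    have "norm ((t / 2) *\<^sub>R x) \<le> \<bar>t\<bar> * (1 + norm x)"
      unfolding norm_scaleR by (intro mult_mono) auto
    also have "\<dots> < e * (1 + norm x)" using t n by (intro mult_strict_right_mono) auto
    also have "\<dots> = 1" using n by (simp add: e_def)
    finally have "invertible_op (id_blinfun - (t / 2) *\<^sub>R x)" by (rule invertible_one_minus)
    then show ?thesis by simp
  qed
  define l where "l t = (- t / 2) *\<^sub>R x" for t
  have "l = (\<lambda>t. t *\<^sub>R ((- 1 / 2) *\<^sub>R x))" by (simp add: l_def fun_eq_iff)
  then have l: "bounded_linear l" by (simp only: bounded_linear_scaleR_left)
  have rat: "rat {-e<..<e} {l} {} (\<lambda>t vs. cayley_curve x t)"
  proof -
    have "rat {-e<..<e} {l} {} (\<lambda>t vs. cayley (l t))"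
    proof (rule rat_cayley)
      show "rat {-e<..<e} {l} {} (\<lambda>t vs. l t)" by (rule rat_base) simp
    qed (simp only: l_def inv)
    then show ?thesis unfolding cayley_curve_def l_def .
  qed
  show ?thesis
  proof (intro exI[of _ e] conjI e ballI allI)
    show "cayley_curve x t \<in> unitary_fredholm" if "t \<in> {-e<..<e}" for t
      unfolding cayley_curve_def
      by (rule cayley_unitary_fredholm(1)[OF subspace_scale[OF subspace_compact_ah_ops x] inv[OF that]])
    show "smooth_on UNIV {-e<..<e} (\<lambda>t. u o\<^sub>L cayley_curve x t)" for u :: "'a \<Rightarrow>\<^sub>L 'a"
      by (rule rat_smooth_on[OF differentially_closed_linear[OF l] _ bounded_linear_ident])
        (intro rat_compose rat_const rat)
    show "smooth_on UNIV {-e<..<e} (\<lambda>t. u o\<^sub>L cayley_curve x t o\<^sub>L B o\<^sub>L radj (u o\<^sub>L cayley_curve x t))" for u B :: "'a \<Rightarrow>\<^sub>L 'a"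
      by (rule rat_smooth_on[OF differentially_closed_linear[OF l] _ bounded_linear_ident])
        (intro rat_compose rat_const rat rat_linear[OF bounded_linear_radj])
  qed
qed

lemma translated_cayley_curve:
  fixes u x :: "'a::complex_hilbert_space \<Rightarrow>\<^sub>L 'a"
  assumes u: "u \<in> unitary_fredholm" and x: "x \<in> compact_ah_ops"
  shows "smooth_curve unitary_fredholm u (u o\<^sub>L x) (\<lambda>t. u o\<^sub>L cayley_curve x t)"
proof -
  obtain e where e: "e > 0" "\<forall>t\<in>{-e<..<e}. cayley_curve x t \<in> unitary_fredholm"
    "\<forall>u :: 'a \<Rightarrow>\<^sub>L 'a. smooth_on UNIV {-e<..<e} (\<lambda>t. u o\<^sub>L cayley_curve x t)"
    using cayley_curve_smooth[OF x] by blast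
  have "((\<lambda>t. u o\<^sub>L cayley_curve x t) has_vector_derivative (u o\<^sub>L x)) (at 0)"
    using has_vector_derivative_compose_op[OF has_vector_derivative_const cayley_curve_has_vector_derivative, of u x]
    by simp
  moreover have "(\<lambda>t. u o\<^sub>L cayley_curve x t) ` {-e<..<e} \<subseteq> unitary_fredholm"
    using e(2) unitary_fredholm_compose[OF u] by blast
  ultimately show ?thesis unfolding smooth_curve_def using e(1,3) by auto
qed

text \<open>Differentiation of \<open>u\<^sup>\<star> u = 1\<close> along a curve gives one inclusion, the translated Cayley curves the
  other.\<close>

lemma tangent_space_unitary_fredholm:
  fixes u :: "'a::complex_hilbert_space \<Rightarrow>\<^sub>L 'a"
  assumes u: "u \<in> unitary_fredholm"
  shows "tangent_space unitary_fredholm u = (\<lambda>x. u o\<^sub>L x) ` compact_ah_ops"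
proof (intro equalityI subsetI)
  fix v assume "v \<in> tangent_space unitary_fredholm u"
  then obtain \<gamma> e where \<gamma>: "e > 0" "\<gamma> ` {-e<..<e} \<subseteq> unitary_fredholm" "\<gamma> 0 = u"
      "(\<gamma> has_vector_derivative v) (at 0)"
    unfolding tangent_space_def smooth_curve_def by blast
  note uD = unitary_fredholmD[OF u]
  have mem: "\<gamma> t \<in> unitary_fredholm" if "t \<in> {-e<..<e}" for t using \<gamma>(2) that by blast
  have "\<gamma> t - \<gamma> 0 \<in> compact_ops" if "t \<in> {-e<..<e}" for t
    using compact_ops_diff[OF unitary_fredholmD(3)[OF mem[OF that]] uD(3)] \<gamma>(3) by simp
  then have v: "v \<in> compact_ops"
    by (rule vector_derivative_in_closed_subspace[OF subspace_compact_ops closed_compact_ops \<gamma>(1) _ \<gamma>(4)])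
  have der: "((\<lambda>t. radj (\<gamma> t) o\<^sub>L \<gamma> t) has_vector_derivative ((radj v o\<^sub>L \<gamma> 0) + (radj (\<gamma> 0) o\<^sub>L v))) (at 0)"
    by (intro has_vector_derivative_compose_op has_vector_derivative_radj \<gamma>(4))
  have const: "radj (\<gamma> t) o\<^sub>L \<gamma> t = id_blinfun" if "t \<in> {-e<..<e}" for t
    by (rule unitary_fredholmD(4)[OF mem[OF that]])
  have "(radj v o\<^sub>L \<gamma> 0) + (radj (\<gamma> 0) o\<^sub>L v) = 0"
    by (rule vector_derivative_of_locally_constant[OF \<gamma>(1) const der])
  then have "radj (radj u o\<^sub>L v) = - (radj u o\<^sub>L v)" by (simp add: \<gamma>(3) eq_neg_iff_add_eq_0)
  moreover have "radj u o\<^sub>L v \<in> compact_ops" using uD(2) v by (rule compact_ops_compose_left)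
  ultimately have "radj u o\<^sub>L v \<in> compact_ah_ops" by (simp add: compact_ah_ops_def)
  moreover have "v = u o\<^sub>L (radj u o\<^sub>L v)" using uD by simp
  ultimately show "v \<in> (\<lambda>x. u o\<^sub>L x) ` compact_ah_ops" by blast
next
  fix v assume "v \<in> (\<lambda>x. u o\<^sub>L x) ` compact_ah_ops"
  then show "v \<in> tangent_space unitary_fredholm u"
    using translated_cayley_curve[OF u] by (auto simp: tangent_space_def)
qed

lemma orbit_map_eq: "u \<in> unitary_fredholm \<Longrightarrow> orbit_map A u = u o\<^sub>L A o\<^sub>L radj u"
  by (simp add: orbit_map_def op_adjoint_eq_radj unitary_fredholmD(1))

lemma orbit_map_has_vector_derivative:
  assumes \<gamma>: "smooth_curve unitary_fredholm u v \<gamma>"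
  shows "(orbit_map A \<circ> \<gamma> has_vector_derivative ((v o\<^sub>L A o\<^sub>L radj u) + (u o\<^sub>L A o\<^sub>L radj v))) (at 0)"
proof -
  obtain e where e: "e > 0" "\<gamma> ` {-e<..<e} \<subseteq> unitary_fredholm" "\<gamma> 0 = u"
      "(\<gamma> has_vector_derivative v) (at 0)"
    using \<gamma> unfolding smooth_curve_def by blast
  have "((\<lambda>t. \<gamma> t o\<^sub>L A o\<^sub>L radj (\<gamma> t)) has_vector_derivative
      ((((v o\<^sub>L A) + (\<gamma> 0 o\<^sub>L 0)) o\<^sub>L radj (\<gamma> 0)) + (\<gamma> 0 o\<^sub>L A o\<^sub>L radj v))) (at 0)"
    by (rule has_vector_derivative_compose_op[OF
          has_vector_derivative_compose_op[OF e(4) has_vector_derivative_const]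
          has_vector_derivative_radj[OF e(4)]])
  then have "((\<lambda>t. \<gamma> t o\<^sub>L A o\<^sub>L radj (\<gamma> t)) has_vector_derivative
      ((v o\<^sub>L A o\<^sub>L radj u) + (u o\<^sub>L A o\<^sub>L radj v))) (at 0)"
    by (simp add: e(3))
  then show ?thesis
    by (rule has_vector_derivative_transform_within_open[of _ _ _ "{-e<..<e}"])
      (use e(1,2) in \<open>auto simp: image_subset_iff orbit_map_eq\<close>)
qed

definition commutator :: "('x::real_normed_vector \<Rightarrow>\<^sub>L 'x) \<Rightarrow> ('x \<Rightarrow>\<^sub>L 'x) \<Rightarrow> ('x \<Rightarrow>\<^sub>L 'x)" where
  "commutator x A = (x o\<^sub>L A) - (A o\<^sub>L x)"

lemma commutator_add: "commutator (x + y) A = commutator x A + commutator y A"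
  by (simp add: commutator_def compose_simps)

lemma commutator_scaleR: "commutator (r *\<^sub>R x) A = r *\<^sub>R commutator x A"
  by (simp add: commutator_def compose_simps scaleR_diff_right)

lemma commutator_diff: "commutator (x - y) A = commutator x A - commutator y A"
  by (simp add: commutator_def compose_simps)

lemma bounded_linear_commutator: "bounded_linear (\<lambda>x. commutator x A)"
proof (rule bounded_linear_intro[where K = "2 * norm A"])
  fix x
  show "norm (commutator x A) \<le> norm x * (2 * norm A)"
  proof -
    have "norm (commutator x A) \<le> norm x * norm A + norm A * norm x"
      unfolding commutator_def
      by (intro order.trans[OF norm_triangle_ineq4] add_mono norm_blinfun_compose)
    then show ?thesis by (simp add: algebra_simps)
  qed
qed (simp_all add: commutator_add commutator_scaleR)

text \<open>The translated Cayley curve is needed for uniqueness: without a curve through the tangent vector any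
  value would satisfy the description in \<^const>\<open>differential\<close>.\<close>

lemma differential_orbit_map:
  assumes u: "u \<in> unitary_fredholm" and x: "x \<in> compact_ah_ops"
  shows "differential unitary_fredholm (orbit_map A) u (u o\<^sub>L x) = u o\<^sub>L commutator x A o\<^sub>L radj u"
proof -
  define w where "w = ((u o\<^sub>L x) o\<^sub>L A o\<^sub>L radj u) + (u o\<^sub>L A o\<^sub>L radj (u o\<^sub>L x))"
  have w: "w = u o\<^sub>L commutator x A o\<^sub>L radj u"
    using x by (simp add: w_def commutator_def compact_ah_ops_def compose_simps)
  have der: "smooth_curve unitary_fredholm u (u o\<^sub>L x) \<gamma> \<Longrightarrow> (orbit_map A \<circ> \<gamma> has_vector_derivative w) (at 0)" for \<gamma>
    unfolding w_def by (rule orbit_map_has_vector_derivative)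
  have "differential unitary_fredholm (orbit_map A) u (u o\<^sub>L x) = w"
    unfolding differential_def
  proof (rule the_equality)
    show "\<forall>\<gamma>. smooth_curve unitary_fredholm u (u o\<^sub>L x) \<gamma> \<longrightarrow> (orbit_map A \<circ> \<gamma> has_vector_derivative w) (at 0)"
      using der by blast
    fix w' assume "\<forall>\<gamma>. smooth_curve unitary_fredholm u (u o\<^sub>L x) \<gamma> \<longrightarrow> (orbit_map A \<circ> \<gamma> has_vector_derivative w') (at 0)"
    then show "w' = w"
      using translated_cayley_curve[OF u x] der vector_derivative_unique_at by blast
  qed
  then show ?thesis using w by simp
qed

section \<open>Operators with closed range\<close>

text \<open>The open mapping theorem on a closed subspace: by Baire, the closure of the image of some ball
  is a neighbourhood of zero in the range, and successive approximation removes the closure.\<close>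

lemma closed_range_approximate_preimage:
  fixes T :: "'b::banach \<Rightarrow> 'c::banach"
  assumes T: "bounded_linear T" and V: "subspace V" and R: "closed (T ` V)"
  shows "\<exists>K\<ge>0. \<forall>y\<in>T ` V. \<exists>x\<in>V. norm x \<le> K * norm y \<and> norm (y - T x) \<le> norm y / 2"
proof -
  interpret T: bounded_linear T by fact
  let ?X = "top_of_set (T ` V)"
  define F where "F n = closure (T ` (V \<inter> cball 0 (real n)))" for n
  have FR: "F n \<subseteq> T ` V" for n
    unfolding F_def by (rule closure_minimal[OF _ R]) blast
  have "\<exists>n. ?X interior_of F n \<noteq> {}"
  proof (rule ccontr)
    assume "\<not> (\<exists>n. ?X interior_of F n \<noteq> {})"
    then have "?X interior_of \<Union>(range F) = {}"
    proof (intro Baire_category_alt disjI1)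
      show "completely_metrizable_space ?X"
        using completely_metrizable_space_closedin[OF completely_metrizable_space_euclidean] R by simp
      show "countable (range F)" by simp
      fix W assume "W \<in> range F"
      then obtain n where n: "W = F n" by blast
      then have "closed W" by (simp add: F_def)
      then have "closedin ?X W" using FR[of n] by (simp add: closed_subset n)
      then show "closedin ?X W \<and> ?X interior_of W = {}"
        using \<open>\<not> (\<exists>n. ?X interior_of F n \<noteq> {})\<close> n by blast
    qed
    moreover have "\<Union>(range F) = T ` V"
    proof (intro equalityI subsetI)
      fix y assume "y \<in> T ` V"
      then obtain x where x: "x \<in> V" "y = T x" by blast
      obtain n where "norm x \<le> real n" using real_arch_simple by blast
      then have "y \<in> T ` (V \<inter> cball 0 (real n))" using x by auto
      then have "y \<in> F n" unfolding F_def by (rule subsetD[OF closure_subset])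
      then show "y \<in> \<Union>(range F)" by blast
    qed (use FR in blast)
    ultimately have "T ` V = {}" using interior_of_topspace[of ?X] by simp
    then show False using V subspace_0 by blast
  qed
  then obtain n y0 where "y0 \<in> ?X interior_of F n" by blast
  then obtain W where W: "openin ?X W" "y0 \<in> W" "W \<subseteq> F n" unfolding interior_of_def by blast
  then obtain r where r: "r > 0" "ball y0 r \<inter> T ` V \<subseteq> W" and y0: "y0 \<in> T ` V"
    unfolding openin_contains_ball by blast
  have near: "\<exists>x\<in>V. norm x \<le> 2 * real n \<and> norm (y - T x) < e"
    if y: "y \<in> T ` V" "norm y < r" and e: "e > 0" for y e
  proof -
    have e': "e / 2 > 0" using e by simp
    have "y0 + y \<in> T ` V"
      using y y0 linear_subspace_image[OF T.linear V] subspace_add by blast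
    moreover have "y0 + y \<in> ball y0 r" using y(2) by (simp add: dist_norm)
    ultimately have "y0 + y \<in> F n" using r(2) W(3) by blast
    then obtain a where a: "a \<in> V" "norm a \<le> real n" "dist (T a) (y0 + y) < e / 2"
      unfolding F_def closure_approachable using e' by fastforce
    have "y0 \<in> F n" using W by blast
    then obtain b where b: "b \<in> V" "norm b \<le> real n" "dist (T b) y0 < e / 2"
      unfolding F_def closure_approachable using e' by fastforce
    have "y - T (a - b) = (T b - y0) - (T a - (y0 + y))" by (simp add: T.diff)
    then have "norm (y - T (a - b)) \<le> norm (T b - y0) + norm (T a - (y0 + y))"
      by (simp only: norm_triangle_ineq4)
    then have "norm (y - T (a - b)) < e" using a(3) b(3) unfolding dist_norm by linarith
    moreover have "norm (a - b) \<le> 2 * real n"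
      using norm_triangle_ineq4[of a b] a(2) b(2) by linarith
    ultimately show ?thesis using a(1) b(1) V subspace_diff by blast
  qed
  define K where "K = 4 * real n / r"
  have K: "K \<ge> 0" using r by (simp add: K_def)
  have "\<exists>x\<in>V. norm x \<le> K * norm y \<and> norm (y - T x) \<le> norm y / 2" if y: "y \<in> T ` V" for y
  proof (cases "y = 0")
    case True
    then show ?thesis using V by (intro bexI[of _ 0]) (auto simp: T.zero subspace_0)
  next
    case False
    define c where "c = r / (2 * norm y)"
    have c: "c > 0" using False r by (simp add: c_def)
    have "c *\<^sub>R y \<in> T ` V" using y linear_subspace_image[OF T.linear V] subspace_scale by blast
    moreover have "norm (c *\<^sub>R y) < r" using False r c by (simp add: c_def)
    moreover have "c * (norm y / 2) > 0" using False c by simp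
    ultimately obtain x where x: "x \<in> V" "norm x \<le> 2 * real n" "norm (c *\<^sub>R y - T x) < c * (norm y / 2)"
      using near by blast
    have "norm (x /\<^sub>R c) \<le> K * norm y"
      using x(2) c False r by (simp add: c_def K_def field_simps)
    moreover have "norm (y - T (x /\<^sub>R c)) \<le> norm y / 2"
    proof -
      have "c *\<^sub>R (y - T (x /\<^sub>R c)) = c *\<^sub>R y - T x"
        using c by (simp add: scaleR_diff_right T.scaleR)
      then have "c * norm (y - T (x /\<^sub>R c)) < c * (norm y / 2)"
        using x(3) c by (metis abs_of_pos norm_scaleR)
      then show ?thesis using c by simp
    qed
    ultimately show ?thesis using x(1) V subspace_scale by blast
  qed
  then show ?thesis using K by blast
qed

lemma closed_range_bounded_preimage:
  fixes T :: "'b::banach \<Rightarrow> 'c::banach"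
  assumes T: "bounded_linear T" and V: "subspace V" "closed V" and R: "closed (T ` V)"
  shows "\<exists>C\<ge>0. \<forall>y\<in>T ` V. \<exists>x\<in>V. T x = y \<and> norm x \<le> C * norm y"
proof -
  interpret T: bounded_linear T by fact
  obtain K where K: "K \<ge> 0" and
      "\<forall>y\<in>T ` V. \<exists>x\<in>V. norm x \<le> K * norm y \<and> norm (y - T x) \<le> norm y / 2"
    using closed_range_approximate_preimage[OF T V(1) R] by blast
  then obtain s where s: "\<And>y. y \<in> T ` V \<Longrightarrow> s y \<in> V" "\<And>y. y \<in> T ` V \<Longrightarrow> norm (s y) \<le> K * norm y"
      "\<And>y. y \<in> T ` V \<Longrightarrow> norm (y - T (s y)) \<le> norm y / 2" by metis
  have "\<exists>x\<in>V. T x = y \<and> norm x \<le> (2 * K) * norm y" if y: "y \<in> T ` V" for y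
  proof -
    define Y where "Y k = ((\<lambda>y. y - T (s y)) ^^ k) y" for k
    have Y_Suc: "Y (Suc k) = Y k - T (s (Y k))" for k by (simp add: Y_def)
    have YR: "Y k \<in> T ` V" for k
    proof (induction k)
      case (Suc k)
      have "T (s (Y k)) \<in> T ` V" using s(1)[OF Suc] by blast
      then show ?case
        unfolding Y_Suc using Suc linear_subspace_image[OF T.linear V(1)] subspace_diff by blast
    qed (use y in \<open>simp add: Y_def\<close>)
    have Yn: "norm (Y k) \<le> norm y * (1/2) ^ k" for k
    proof (induction k)
      case (Suc k)
      then show ?case using s(3)[OF YR[of k]] by (simp add: Y_Suc)
    qed (simp add: Y_def)
    have sn: "norm (s (Y k)) \<le> K * norm y * (1/2) ^ k" for k
      using s(2)[OF YR[of k]] mult_left_mono[OF Yn[of k] K] by (simp add: mult.assoc)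
    have geo: "(\<lambda>k. K * norm y * (1/2) ^ k) sums (K * norm y * 2)"
      using sums_mult[OF geometric_sums[of "1/2 :: real"], of "K * norm y"] by simp
    have sum: "summable (\<lambda>k. norm (s (Y k)))"
      by (rule summable_comparison_test'[OF sums_summable[OF geo], of 0]) (use sn in auto)
    define x where "x = (\<Sum>k. s (Y k))"
    have x: "(\<lambda>k. s (Y k)) sums x"
      unfolding x_def using summable_norm_cancel[OF sum] by (rule summable_sums)
    have "x \<in> V"
    proof (rule closed_sequentially[OF V(2)])
      show "(\<lambda>n. \<Sum>k<n. s (Y k)) \<longlonglongrightarrow> x" using x by (simp add: sums_def)
      show "(\<Sum>k<n. s (Y k)) \<in> V" for n using s(1)[OF YR] V(1) by (intro subspace_sum) auto
    qed
    moreover have "T x = y"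
    proof -
      have "Y \<longlonglongrightarrow> 0"
      proof (rule Lim_null_comparison)
        show "(\<lambda>k. norm y * (1/2) ^ k) \<longlonglongrightarrow> 0"
          by (intro tendsto_mult_right_zero LIMSEQ_realpow_zero) auto
      qed (use Yn in auto)
      then have "(\<lambda>k. Y k - Y (Suc k)) sums (Y 0 - 0)" by (rule telescope_sums')
      then have "(\<lambda>k. T (s (Y k))) sums y" by (simp add: Y_Suc) (simp add: Y_def)
      then show ?thesis using T.sums[OF x] sums_unique2 by blast
    qed
    moreover have "norm x \<le> (2 * K) * norm y"
    proof -
      have "norm x \<le> (\<Sum>k. norm (s (Y k)))" unfolding x_def by (rule summable_norm[OF sum])
      also have "\<dots> \<le> (\<Sum>k. K * norm y * (1/2) ^ k)" by (rule suminf_le[OF sn sum sums_summable[OF geo]])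
      also have "\<dots> = K * norm y * 2" using sums_unique[OF geo] by simp
      finally show ?thesis by simp
    qed
    ultimately show ?thesis by blast
  qed
  then show ?thesis using K by (intro exI[of _ "2 * K"]) auto
qed

section \<open>The spectrum of a self-adjoint operator\<close>

lemma spectrum_iff:
  assumes T: "T \<in> bounded_ops"
  shows "z \<in> spectrum T \<longleftrightarrow> \<not> invertible_op (T - cscalar z)"
proof -
  have "(\<exists>S. S \<in> bounded_ops \<and> (\<forall>x. S (T x - z *\<^sub>C x) = x) \<and> (\<forall>x. T (S x) - z *\<^sub>C S x = x))
      \<longleftrightarrow> invertible_op (T - cscalar z)" (is "?l \<longleftrightarrow> ?r")
  proof
    assume ?l
    then obtain S where S: "S \<in> bounded_ops" "\<And>x. S (T x - z *\<^sub>C x) = x" "\<And>x. T (S x) - z *\<^sub>C S x = x" by blast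
    have "S o\<^sub>L (T - cscalar z) = id_blinfun" "(T - cscalar z) o\<^sub>L S = id_blinfun"
      by (rule blinfun_eqI; simp add: S blinfun.diff_left)+
    then show ?r by (rule inv_op_eqI)
  next
    assume r: ?r
    let ?S = "inv_op (T - cscalar z)"
    have "?S \<in> bounded_ops" using bounded_ops_inv_op[OF bounded_ops_diff[OF T bounded_ops_cscalar] r] .
    moreover have "?S (T x - z *\<^sub>C x) = x" for x
      using arg_cong[OF inv_op_left[OF r], of "\<lambda>S. S x"] by (simp add: blinfun.diff_left)
    moreover have "T (?S x) - z *\<^sub>C ?S x = x" for x
      using arg_cong[OF inv_op_right[OF r], of "\<lambda>S. S x"] by (simp add: blinfun.diff_left)
    ultimately show ?l by blast
  qed
  then show ?thesis by (auto simp: spectrum_def)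
qed

lemma invertible_op_of_bounded_below:
  fixes B :: "'x::banach \<Rightarrow>\<^sub>L 'x"
  assumes c: "c > 0" "\<And>x. c * norm x \<le> norm (B x)" and surj: "surj B"
  shows "invertible_op B"
proof -
  have inj: "inj B"
  proof (rule injI)
    fix x y assume "B x = B y"
    then have "c * norm (x - y) \<le> 0" using c(2)[of "x - y"] by (simp add: blinfun.diff_right)
    then show "x = y" using c(1) by (simp add: mult_le_0_iff)
  qed
  have BI: "B (inv B x) = x" for x using surj by (rule surj_f_inv_f)
  have "bounded_linear (inv B)"
  proof (rule bounded_linear_intro[where K = "1 / c"])
    show "inv B (x + y) = inv B x + inv B y" for x y
      by (rule injD[OF inj]) (simp add: BI blinfun.add_right)
    show "inv B (r *\<^sub>R x) = r *\<^sub>R inv B x" for r x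
      by (rule injD[OF inj]) (simp add: BI blinfun.scaleR_right)
    show "norm (inv B x) \<le> norm x * (1 / c)" for x
      using c(2)[of "inv B x"] c(1) by (simp add: BI field_simps)
  qed
  then have "Blinfun (inv B) x = inv B x" for x by (simp add: bounded_linear_Blinfun_apply)
  then have "Blinfun (inv B) o\<^sub>L B = id_blinfun" and "B o\<^sub>L Blinfun (inv B) = id_blinfun"
    using inj by (auto intro!: blinfun_eqI simp: BI)
  then show ?thesis by (rule inv_op_eqI)
qed

text \<open>The operator \<open>A - z\<close> is normal, so its adjoint is bounded below too. Hence the range, which is closed,
  has no orthogonal complement.\<close>

lemma selfadjoint_bounded_below_imp_invertible:
  fixes A :: "'a::complex_hilbert_space \<Rightarrow>\<^sub>L 'a"
  assumes A: "selfadjoint A" and c: "c > 0" "\<And>x. c * norm x \<le> norm ((A - cscalar z) x)"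
  shows "invertible_op (A - cscalar z)"
proof (rule invertible_op_of_bounded_below[OF c])
  let ?B = "A - cscalar z"
  have A': "A \<in> bounded_ops" "radj A = A" using A by (auto simp: selfadjoint_iff)
  have comm: "A o\<^sub>L cscalar w = cscalar w o\<^sub>L A" for w using A'(1) by (simp add: mem_bounded_ops)
  have "cscalar (cnj z) o\<^sub>L cscalar z = cscalar z o\<^sub>L (cscalar (cnj z) :: 'a \<Rightarrow>\<^sub>L 'a)"
    by (rule blinfun_eqI) (simp add: scaleC_scaleC mult.commute)
  then have normal: "radj ?B o\<^sub>L ?B = ?B o\<^sub>L radj ?B"
    using comm[of z] comm[of "cnj z"] by (simp add: radj_diff radj_cscalar A' compose_simps)
  have norm_eq: "norm (radj ?B x) = norm (?B x)" for x
  proof -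
    have "(norm (?B x))\<^sup>2 = inner x ((radj ?B o\<^sub>L ?B) x)"
      by (simp add: power2_norm_eq_inner inner_radj)
    also have "\<dots> = inner (radj ?B x) (radj ?B x)"
      unfolding normal by (simp add: inner_radj[of "radj ?B"])
    finally show ?thesis by (simp add: power2_norm_eq_inner norm_eq_sqrt_inner)
  qed
  have "complete (?B ` UNIV)"
    by (rule complete_isometric_image[OF c(1) subspace_UNIV blinfun.bounded_linear_right])
      (use c(2) in \<open>auto simp: complete_UNIV\<close>)
  then have closed: "closed (range ?B)" by (rule complete_imp_closed)
  have subsp: "subspace (range ?B)"
    by (rule linear_subspace_image[OF bounded_linear.linear[OF blinfun.bounded_linear_right] subspace_UNIV])
  have "x \<in> range ?B" for x
  proof -
    obtain p where p: "p \<in> range ?B" "\<And>s. s \<in> range ?B \<Longrightarrow> inner (x - p) s = 0"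
      using orthogonal_projection_exists[OF subsp closed] by blast
    have "inner (radj ?B (x - p)) y = 0" for y
      using p(2)[of "?B y"] by (simp add: inner_radj[of "radj ?B"])
    then have "radj ?B (x - p) = 0" by (metis inner_eq_zero_iff)
    then have "c * norm (x - p) \<le> 0" using c(2)[of "x - p"] norm_eq[of "x - p"] by simp
    then show ?thesis using c(1) p(1) by (simp add: mult_le_0_iff)
  qed
  then show "surj ?B" by blast
qed

text \<open>The vectors \<open>(A - Re z) x\<close> and \<open>\<i> x\<close> are orthogonal for the real inner product.\<close>

lemma selfadjoint_nonreal_bounded_below:
  fixes A :: "'a::complex_hilbert_space \<Rightarrow>\<^sub>L 'a"
  assumes A: "selfadjoint A"
  shows "\<bar>Im z\<bar> * norm x \<le> norm ((A - cscalar z) x)"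
proof -
  have A': "A \<in> bounded_ops" "radj A = A" using A by (auto simp: selfadjoint_iff)
  define y where "y = A x - Re z *\<^sub>R x"
  define w where "w = Im z *\<^sub>R (\<i> *\<^sub>C x)"
  have Ai: "A (\<i> *\<^sub>C x) = \<i> *\<^sub>C A x" using A'(1) by (simp add: bounded_ops_def)
  have cnj_i: "(- \<i>) *\<^sub>C v = - (\<i> *\<^sub>C v)" for v :: 'a
    using scaleC_add_left[of \<i> "- \<i>" v] scaleC_of_real[of 0 v]
    by (simp add: eq_neg_iff_add_eq_0 add.commute)
  have "inner x (\<i> *\<^sub>C x) = 0"
    using inner_scaleC_left[of \<i> x x] by (simp add: cnj_i inner_commute)
  moreover have "inner (A x) (\<i> *\<^sub>C x) = 0"
  proof -
    have "inner (A x) (\<i> *\<^sub>C x) = inner x (A (\<i> *\<^sub>C x))" using inner_radj[of A x] A'(2) by simp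
    also have "\<dots> = - inner (\<i> *\<^sub>C x) (A x)"
      unfolding Ai using inner_scaleC_left[of \<i> x "A x"] by (simp add: cnj_i)
    finally show ?thesis by (simp add: inner_commute)
  qed
  ultimately have orth: "inner y w = 0" by (simp add: y_def w_def inner_diff)
  have "z *\<^sub>C x = complex_of_real (Re z) *\<^sub>C x + complex_of_real (Im z) *\<^sub>C (\<i> *\<^sub>C x)"
    unfolding scaleC_scaleC scaleC_add_left[symmetric] using complex_eq[of z] by (simp add: mult.commute)
  then have eq: "(A - cscalar z) x = y - w"
    by (simp add: y_def w_def scaleC_of_real blinfun.diff_left)
  have "(norm w)\<^sup>2 \<le> (norm (y - w))\<^sup>2"
    using orth by (simp add: power2_norm_eq_inner inner_diff inner_commute)
  then have "norm w \<le> norm (y - w)" by (rule power2_le_imp_le) simp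
  then show ?thesis by (simp add: eq w_def norm_scaleC)
qed

lemma selfadjoint_spectrum_real:
  assumes A: "selfadjoint A" and z: "z \<in> spectrum A"
  shows "z = complex_of_real (Re z)"
proof (rule ccontr)
  assume "z \<noteq> complex_of_real (Re z)"
  then have "\<bar>Im z\<bar> > 0" by (auto simp: complex_eq_iff)
  then have "invertible_op (A - cscalar z)"
    using selfadjoint_bounded_below_imp_invertible[OF A] selfadjoint_nonreal_bounded_below[OF A] by blast
  then show False using z A by (simp add: spectrum_iff selfadjoint_iff)
qed

lemma approximate_eigenvector:
  assumes A: "selfadjoint A" and z: "complex_of_real l \<in> spectrum A" and e: "e > 0"
  obtains x where "norm x = 1" "norm (A x - l *\<^sub>R x) < e"
proof -
  have app: "(A - cscalar (complex_of_real l)) x = A x - l *\<^sub>R x" for x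
    by (simp add: blinfun.diff_left scaleC_of_real)
  have "\<exists>x. norm x = 1 \<and> norm (A x - l *\<^sub>R x) < e"
  proof (rule ccontr)
    assume *: "\<not> (\<exists>x. norm x = 1 \<and> norm (A x - l *\<^sub>R x) < e)"
    have "e * norm x \<le> norm ((A - cscalar (complex_of_real l)) x)" for x
    proof (cases "x = 0")
      case False
      have "e \<le> norm (A (x /\<^sub>R norm x) - l *\<^sub>R (x /\<^sub>R norm x))"
        using * False by (metis linorder_not_less norm_sgn sgn_div_norm)
      also have "A (x /\<^sub>R norm x) - l *\<^sub>R (x /\<^sub>R norm x) = (A x - l *\<^sub>R x) /\<^sub>R norm x"
        by (simp add: blinfun.scaleR_right scaleR_diff_right)
      finally have "e \<le> norm (A x - l *\<^sub>R x) / norm x" by (simp add: divide_inverse mult.commute)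
      then show ?thesis using False by (simp add: app field_simps)
    qed simp
    then have "invertible_op (A - cscalar (complex_of_real l))"
      by (rule selfadjoint_bounded_below_imp_invertible[OF A e])
    then show False using z A by (simp add: spectrum_iff selfadjoint_iff)
  qed
  then show ?thesis using that by blast
qed

lemma spectrum_bound:
  assumes A: "selfadjoint A" and z: "complex_of_real l \<in> spectrum A"
  shows "\<bar>l\<bar> \<le> norm A"
proof (rule field_le_epsilon)
  fix e :: real assume e: "e > 0"
  obtain x where x: "norm x = 1" "norm (A x - l *\<^sub>R x) < e" by (rule approximate_eigenvector[OF A z e])
  have "\<bar>l\<bar> = norm (l *\<^sub>R x)" using x by simp
  also have "\<dots> \<le> norm (A x) + norm (A x - l *\<^sub>R x)"
    using norm_triangle_ineq4[of "A x" "A x - l *\<^sub>R x"] by simp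
  also have "\<dots> \<le> norm A + e" using norm_blinfun[of A x] x by simp
  finally show "\<bar>l\<bar> \<le> norm A + e" .
qed

text \<open>Both points are taken near an accumulation point, the second one nearer than the first.\<close>

lemma infinite_bounded_reals_close_points:
  fixes S :: "real set"
  assumes "infinite S" "bounded S" "d > 0"
  obtains a b where "a \<in> S" "b \<in> S" "a \<noteq> b" "\<bar>a - b\<bar> < d"
proof -
  obtain x where x: "x islimpt S"
    using Heine_Borel_imp_Bolzano_Weierstrass[of "closure S" S] assms closure_subset compact_closure by blast
  have d2: "d / 2 > 0" using assms by simp
  obtain a where a: "a \<in> S" "a \<noteq> x" "dist a x < d / 2"
    using x d2 unfolding islimpt_approachable by blast
  then have "min (dist a x) (d / 2) > 0" using d2 by simp
  then obtain b where b: "b \<in> S" "b \<noteq> x" "dist b x < min (dist a x) (d / 2)"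
    using x unfolding islimpt_approachable by blast
  have "a \<noteq> b" using b(3) by auto
  moreover have "\<bar>a - b\<bar> < d" using a(3) b(3) unfolding dist_real_def by linarith
  ultimately show ?thesis using that a(1) b(1) by blast
qed

section \<open>Closed range of the commutator\<close>

lemma norm_rank_one: "norm (rank_one v w) \<le> norm v * norm w"
proof (rule norm_blinfun_bound)
  show "norm (rank_one v w x) \<le> norm v * norm w * norm x" for x
    using mult_right_mono[OF cmod_cinner_le[of x w] norm_ge_zero[of v]]
    by (simp add: rank_one_apply norm_scaleC mult_ac)
qed simp

lemma rank_one_linear:
  "rank_one (v + v') w = rank_one v w + rank_one v' w"
  "rank_one v (w + w') = rank_one v w + rank_one v w'"
  "rank_one (r *\<^sub>R v) w = r *\<^sub>R rank_one v w"
  "rank_one v (r *\<^sub>R w) = r *\<^sub>R rank_one v w"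
proof -
  have l: "rank_one (v + v') w = rank_one v w + rank_one v' w" for v v' w
    by (rule blinfun_eqI) (simp add: rank_one_apply scaleC_add_right blinfun.add_left)
  have s: "rank_one (r *\<^sub>R v) w = r *\<^sub>R rank_one v w" for v w
    by (rule blinfun_eqI) (simp add: rank_one_apply scaleC_scaleR blinfun.scaleR_left)
  show "rank_one (v + v') w = rank_one v w + rank_one v' w" by (rule l)
  show "rank_one (r *\<^sub>R v) w = r *\<^sub>R rank_one v w" by (rule s)
  show "rank_one v (w + w') = rank_one v w + rank_one v w'"
    by (metis l radj_add radj_rank_one)
  show "rank_one v (r *\<^sub>R w) = r *\<^sub>R rank_one v w"
    by (metis s radj_scaleR radj_rank_one)
qed

lemma compose_rank_one:
  assumes "A \<in> bounded_ops"
  shows "A o\<^sub>L rank_one v w = rank_one (A v) w" "rank_one v w o\<^sub>L A = rank_one v (radj A w)"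
proof -
  have *: "A o\<^sub>L rank_one v w = rank_one (A v) w" if "A \<in> bounded_ops" for A v w
    using that by (intro blinfun_eqI) (simp add: rank_one_apply bounded_ops_def)
  show "A o\<^sub>L rank_one v w = rank_one (A v) w" by (rule *[OF assms])
  have "radj A o\<^sub>L rank_one w v = rank_one (radj A w) v" by (rule *[OF bounded_ops_radj[OF assms]])
  then show "rank_one v w o\<^sub>L A = rank_one v (radj A w)"
    by (metis radj_compose radj_radj radj_rank_one)
qed

text \<open>If \<open>v\<close> and \<open>w\<close> are approximate eigenvectors for distinct but close \<open>a\<close> and \<open>b\<close>, the commutator
  of \<open>A\<close> with \<open>x = v \<otimes> w - w \<otimes> v\<close> is small, of the size of \<open>a - b\<close>. Any other \<open>x'\<close> with that commutator
  differs from \<open>x\<close> by an operator that commutes with \<open>A\<close> and so has a small matrix entry at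
  \<open>(v, w)\<close>; hence \<open>x'\<close> is not small, and no bounded choice of \<open>x'\<close> is possible.\<close>

theorem closed_commutator_range_imp_finite_spectrum:
  fixes A :: "'a::complex_hilbert_space \<Rightarrow>\<^sub>L 'a"
  assumes A: "selfadjoint A" and R: "closed ((\<lambda>x. commutator x A) ` compact_ah_ops)"
  shows "finite (spectrum A)"
proof (rule ccontr)
  assume inf: "infinite (spectrum A)"
  have A': "A \<in> bounded_ops" "radj A = A" using A by (auto simp: selfadjoint_iff)
  define S where "S = Re ` spectrum A"
  have S: "complex_of_real a \<in> spectrum A" if "a \<in> S" for a
    using that selfadjoint_spectrum_real[OF A] by (force simp: S_def)
  have "inj_on Re (spectrum A)"
    by (rule inj_onI) (metis selfadjoint_spectrum_real[OF A])
  then have "infinite S" using inf by (simp add: S_def finite_image_iff)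
  moreover have "bounded S"
    using spectrum_bound[OF A S] by (auto intro!: boundedI[of _ "norm A"])
  moreover obtain C where C: "C \<ge> 0" "\<forall>y\<in>(\<lambda>x. commutator x A) ` compact_ah_ops.
      \<exists>x\<in>compact_ah_ops. commutator x A = y \<and> norm x \<le> C * norm y"
    using closed_range_bounded_preimage[OF bounded_linear_commutator subspace_compact_ah_ops
        closed_compact_ah_ops R] by blast
  moreover have "1 / (10 * (C + 1)) > 0" using C(1) by simp
  ultimately obtain a b where ab: "a \<in> S" "b \<in> S" "a \<noteq> b" "\<bar>a - b\<bar> < 1 / (10 * (C + 1))"
    using infinite_bounded_reals_close_points by blast
  define d where "d = \<bar>a - b\<bar>"
  have d: "d > 0" "C * d \<le> 1 / 10"
  proof -
    show "d > 0" using ab by (simp add: d_def)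
    have "C * d \<le> (C + 1) * d" using \<open>d > 0\<close> by (intro mult_right_mono) auto
    also have "\<dots> \<le> (C + 1) * (1 / (10 * (C + 1)))" using ab(4) C(1) by (intro mult_left_mono) (auto simp: d_def)
    also have "\<dots> = 1 / 10" using C(1) by simp
    finally show "C * d \<le> 1 / 10" .
  qed
  define e where "e = d / 16"
  have e: "e > 0" using d by (simp add: e_def)
  obtain v where v: "norm v = 1" "norm (A v - a *\<^sub>R v) < e"
    by (rule approximate_eigenvector[OF A S[OF ab(1)] e])
  obtain w where w: "norm w = 1" "norm (A w - b *\<^sub>R w) < e"
    by (rule approximate_eigenvector[OF A S[OF ab(2)] e])
  define p where "p = A v - a *\<^sub>R v"
  define q where "q = A w - b *\<^sub>R w"
  have Av: "A v = a *\<^sub>R v + p" and Aw: "A w = b *\<^sub>R w + q" by (simp_all add: p_def q_def)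
  have pq: "norm p < e" "norm q < e" using v w by (simp_all add: p_def q_def)
  define x where "x = rank_one v w - rank_one w v"
  have x: "x \<in> compact_ah_ops"
    by (simp add: x_def compact_ah_ops_def compact_ops_diff rank_one_compact radj_diff radj_rank_one)
  have nx: "norm x \<le> 2"
    using norm_triangle_ineq4[of "rank_one v w" "rank_one w v"] norm_rank_one[of v w] norm_rank_one[of w v] v w
    by (simp add: x_def)
  define y where "y = commutator x A"
  have y: "y = (b - a) *\<^sub>R rank_one v w + (b - a) *\<^sub>R rank_one w v
      + rank_one v q - rank_one w p - rank_one p w + rank_one q v"
    unfolding y_def x_def commutator_def compose_simps compose_rank_one[OF A'(1)] A'(2) Av Aw rank_one_linear
    by (simp add: algebra_simps)
  have ny: "norm y \<le> 9 / 4 * d"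
  proof -
    have "norm y \<le> d + d + e + e + e + e"
      unfolding y
      by (intro order.trans[OF norm_triangle_ineq4] order.trans[OF norm_triangle_ineq] add_mono)
        (use norm_rank_one[of v w] norm_rank_one[of w v] norm_rank_one[of v q] norm_rank_one[of w p]
          norm_rank_one[of p w] norm_rank_one[of q v] v w pq d in
          \<open>auto simp: d_def abs_minus_commute mult_left_le intro: order.trans\<close>)
    then show ?thesis by (simp add: e_def)
  qed
  have "y \<in> (\<lambda>x. commutator x A) ` compact_ah_ops" using x y_def by blast
  then obtain x' where x': "commutator x' A = y" "norm x' \<le> C * norm y" using C(2) by blast
  \<comment> \<open>The bound \<open>C d \<le> 1 / 10\<close> makes \<open>x'\<close> so small that it contradicts
    \<open>63 / 64 \<le> \<parallel>x'\<parallel> + (2 + \<parallel>x'\<parallel>) / 8\<close>, which follows from the estimates below.\<close>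
  have nx': "norm x' \<le> 9 / 40"
    using x'(2) mult_left_mono[OF ny C(1)] d(2) by simp
  define z where "z = x - x'"
  have nz: "norm z \<le> 2 + norm x'" using norm_triangle_ineq4[of x x'] nx by (simp add: z_def)
  \<comment> \<open>The difference of two operators with the same commutator commutes with \<open>A\<close>.\<close>
  have comm: "z (A u) = A (z u)" for u
  proof -
    have "commutator z A = 0" using x'(1) by (simp add: z_def y_def commutator_diff)
    then have "z o\<^sub>L A = A o\<^sub>L z" by (simp add: commutator_def)
    then show ?thesis by (metis blinfun_apply_blinfun_compose)
  qed
  have symm: "inner (A u) u' = inner u (A u')" for u u' using inner_radj[of A] A'(2) by simp
  have z1: "\<bar>inner (z v) w\<bar> \<le> norm z / 8"
  proof -
    have "(a - b) * inner (z v) w = inner (z v) q - inner (z p) w"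
    proof -
      have "inner (z (A v)) w = inner (z v) (A w)" by (simp add: comm symm)
      then show ?thesis
        by (simp add: Av Aw blinfun.add_right blinfun.scaleR_right inner_add algebra_simps)
    qed
    also have "\<bar>\<dots>\<bar> \<le> norm (z v) * norm q + norm (z p) * norm w"
      by (intro order.trans[OF abs_triangle_ineq4] add_mono Cauchy_Schwarz_ineq2)
    also have "\<dots> \<le> (norm z * norm v) * norm q + (norm z * norm p) * norm w"
      by (intro add_mono mult_right_mono norm_blinfun norm_ge_zero)
    also have "\<dots> \<le> norm z * e + norm z * e"
      using v w pq by (intro add_mono) (auto intro: mult_left_mono)
    finally have "d * \<bar>inner (z v) w\<bar> \<le> d * (norm z / 8)"
      by (simp add: abs_mult d_def[symmetric] e_def)
    then show ?thesis using d by simp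
  qed
  have vw: "cmod (cinner v w) \<le> 1 / 8"
  proof -
    have csymm: "cinner (A v) w = cinner v (A w)"
      using A by (simp add: selfadjoint_def is_adjoint_def)
    have l: "cinner (a *\<^sub>R v) w = complex_of_real a * cinner v w"
      using cinner_scaleC_left[of "complex_of_real a" v w] by (simp add: scaleC_of_real)
    have r: "cinner v (b *\<^sub>R w) = complex_of_real b * cinner v w"
      using cinner_scaleC_right[of v "complex_of_real b" w] by (simp add: scaleC_of_real)
    have add_right: "cinner v (u + u') = cinner v u + cinner v u'" for u u'
      by (metis cinner_add_left cinner_commute complex_cnj_add)
    have "complex_of_real (a - b) * cinner v w = cinner v q - cinner p w"
      using csymm by (simp add: Av Aw cinner_add_left add_right l r algebra_simps)
    then have "d * cmod (cinner v w) = cmod (cinner v q - cinner p w)"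
      by (metis d_def norm_mult norm_of_real)
    also have "\<dots> \<le> norm v * norm q + norm p * norm w"
      by (intro order.trans[OF norm_triangle_ineq4] add_mono cmod_cinner_le)
    also have "\<dots> \<le> d * (1 / 8)" using v w pq by (simp add: e_def)
    finally show ?thesis using d by simp
  qed
  have "inner (x v) w \<le> - (63 / 64)"
  proof -
    have "x v = cinner v w *\<^sub>C v - cinner v v *\<^sub>C w"
      by (simp add: x_def blinfun.diff_left rank_one_apply)
    moreover have "cinner v v *\<^sub>C w = w"
    proof -
      have "Im (cinner v v) = 0" using cinner_commute[of v v] by (metis Reals_cnj_iff complex_is_Real_iff)
      moreover have "Re (cinner v v) = 1" using v by (simp add: Re_cinner flip: power2_norm_eq_inner)
      ultimately have "cinner v v = 1" by (simp add: complex_eq_iff)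
      then show ?thesis by simp
    qed
    ultimately have "inner (x v) w = inner (cinner v w *\<^sub>C v) w - inner w w" by (simp add: inner_diff)
    also have "inner (cinner v w *\<^sub>C v) w = Re (cinner v w * cinner v w)"
      by (simp add: cinner_scaleC_left flip: Re_cinner)
    also have "inner w w = 1" using w by (simp flip: power2_norm_eq_inner)
    finally have "inner (x v) w = Re (cinner v w * cinner v w) - 1" .
    also have "Re (cinner v w * cinner v w) \<le> cmod (cinner v w) * cmod (cinner v w)"
      by (metis complex_Re_le_cmod norm_mult)
    also have "\<dots> \<le> (1 / 8) * (1 / 8)" using vw by (intro mult_mono) auto
    finally show ?thesis by simp
  qed
  moreover have "\<bar>inner (x' v) w\<bar> \<le> norm x'"
    using order.trans[OF Cauchy_Schwarz_ineq2[of "x' v" w]] norm_blinfun[of x' v] v w by simp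
  moreover have "inner (x v) w = inner (x' v) w + inner (z v) w"
    by (simp add: z_def blinfun.diff_left inner_diff)
  ultimately show False using z1 nz nx' by linarith
qed

text \<open>At the identity the differential of the orbit map is the commutator with \<open>A\<close>, so that its range
  is the tangent space of the orbit, which is closed.\<close>

theorem submersion_imp_finite_spectrum:
  assumes A: "selfadjoint A"
    and M: "complemented_submanifold (orbit_space A) (unitary_orbit A)"
    and S: "submersion unitary_fredholm_space unitary_fredholm (orbit_space A) (unitary_orbit A) (orbit_map A)"
  shows "finite (spectrum A)"
proof (rule closed_commutator_range_imp_finite_spectrum[OF A])
  have "orbit_map A id_blinfun = A" by (simp add: orbit_map_eq)
  moreover have "differential unitary_fredholm (orbit_map A) id_blinfun ` tangent_space unitary_fredholm id_blinfun
      = tangent_space (unitary_orbit A) (orbit_map A id_blinfun)"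
    using S by (simp add: submersion_def)
  moreover have "differential unitary_fredholm (orbit_map A) id_blinfun ` tangent_space unitary_fredholm id_blinfun
      = (\<lambda>x. commutator x A) ` compact_ah_ops"
    unfolding tangent_space_unitary_fredholm[OF unitary_fredholm_id] image_image
    by (intro image_cong refl) (use differential_orbit_map[OF unitary_fredholm_id, of _ A] in simp)
  moreover have "A \<in> unitary_orbit A"
    unfolding unitary_orbit_def using calculation(1) by (metis imageI unitary_fredholm_id)
  ultimately show "closed ((\<lambda>x. commutator x A) ` compact_ah_ops)"
    using M unfolding complemented_submanifold_def closed_complemented_def by metis
qed

section \<open>Spectral decomposition for finite spectrum\<close>

lemma cscalar_simps:
  "cscalar (a + b) = cscalar a + cscalar b" "cscalar (a * b) = cscalar a o\<^sub>L cscalar b"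
  "cscalar 0 = 0" "cscalar 1 = id_blinfun" "cscalar (- a) = - cscalar a"
  "cscalar (complex_of_real r) = r *\<^sub>R id_blinfun"
proof -
  show add: "cscalar (a + b) = cscalar a + cscalar b" for a b
    by (rule blinfun_eqI) (simp add: scaleC_add_left blinfun.add_left)
  show "cscalar (a * b) = cscalar a o\<^sub>L cscalar b"
    by (rule blinfun_eqI) (simp add: scaleC_scaleC)
  show real: "cscalar (complex_of_real r) = r *\<^sub>R id_blinfun" for r
    by (rule blinfun_eqI) (simp add: scaleC_of_real blinfun.scaleR_left)
  show zero: "cscalar 0 = 0" using real[of 0] by simp
  show "cscalar 1 = id_blinfun" using real[of 1] by simp
  show "cscalar (- a) = - cscalar a"
    using add[of a "- a"] by (simp add: zero eq_neg_iff_add_eq_0 add.commute)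
qed

definition poly_op :: "('a::complex_hilbert_space \<Rightarrow>\<^sub>L 'a) \<Rightarrow> complex poly \<Rightarrow> ('a \<Rightarrow>\<^sub>L 'a)" where
  "poly_op A f = fold_coeffs (\<lambda>c T. cscalar c + (A o\<^sub>L T)) f 0"

lemma poly_op_0 [simp]: "poly_op A 0 = 0"
  by (simp add: poly_op_def)

lemma poly_op_pCons: "poly_op A (pCons c f) = cscalar c + (A o\<^sub>L poly_op A f)"
proof (cases "c = 0 \<and> f = 0")
  case True
  then show ?thesis by (simp add: cscalar_simps)
next
  case False
  then show ?thesis by (auto simp: poly_op_def)
qed

lemma poly_op_add: "poly_op A (f + g) = poly_op A f + poly_op A g"
  by (induction f g rule: poly_induct2) (simp_all add: poly_op_pCons cscalar_simps compose_simps)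

lemma poly_op_linear_factor: "poly_op A [:- z, 1:] = A - cscalar z"
  by (simp add: poly_op_pCons cscalar_simps)

context
  fixes A :: "'a::complex_hilbert_space \<Rightarrow>\<^sub>L 'a"
  assumes A: "A \<in> bounded_ops"
begin

lemma poly_op_bounded: "poly_op A f \<in> bounded_ops"
  by (induction f) (simp_all add: poly_op_pCons bounded_ops_add bounded_ops_compose A)

lemma poly_op_smult: "poly_op A (smult c f) = cscalar c o\<^sub>L poly_op A f"
proof (induction f)
  case (pCons a f)
  have "A o\<^sub>L (cscalar c o\<^sub>L poly_op A f) = cscalar c o\<^sub>L (A o\<^sub>L poly_op A f)"
    using A unfolding mem_bounded_ops by (metis compose_assoc)
  then show ?case by (simp add: poly_op_pCons cscalar_simps compose_simps pCons)
qed simp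

lemma poly_op_mult: "poly_op A (f * g) = poly_op A f o\<^sub>L poly_op A g"
proof (induction f)
  case (pCons a f)
  then show ?case by (simp add: poly_op_add poly_op_smult poly_op_pCons cscalar_simps compose_simps)
qed simp

lemma poly_op_eigen:
  assumes P: "A o\<^sub>L P = cscalar z o\<^sub>L P"
  shows "poly_op A f o\<^sub>L P = cscalar (poly f z) o\<^sub>L P"
proof (induction f)
  case (pCons a f)
  have "A o\<^sub>L (cscalar w o\<^sub>L P) = cscalar w o\<^sub>L (cscalar z o\<^sub>L P)" for w
    using A P unfolding mem_bounded_ops by (metis compose_assoc)
  then have "A o\<^sub>L (poly_op A f o\<^sub>L P) = cscalar (z * poly f z) o\<^sub>L P"
    by (simp add: pCons cscalar_simps(2)[symmetric] compose_assoc[symmetric] mult.commute)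
  then show ?case by (simp add: poly_op_pCons compose_simps cscalar_simps(1))
qed (simp add: cscalar_simps)

text \<open>Half of the spectral mapping theorem: factor \<open>f\<close> into linear factors.\<close>

lemma poly_op_invertible:
  assumes "f \<noteq> 0" "\<And>z. poly f z = 0 \<Longrightarrow> z \<notin> spectrum A"
  shows "invertible_op (poly_op A f)"
  using assms
proof (induction "degree f" arbitrary: f rule: less_induct)
  case less
  show ?case
  proof (cases "degree f = 0")
    case True
    then obtain c where f: "f = [:c:]" by (rule degree_eq_zeroE)
    then have "c \<noteq> 0" using less by simp
    then have "cscalar (1 / c) o\<^sub>L cscalar c = (id_blinfun :: 'a \<Rightarrow>\<^sub>L 'a)"
      "cscalar c o\<^sub>L cscalar (1 / c) = (id_blinfun :: 'a \<Rightarrow>\<^sub>L 'a)"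
      by (simp_all add: cscalar_simps(2)[symmetric] cscalar_simps(4))
    then have "invertible_op (cscalar c :: 'a \<Rightarrow>\<^sub>L 'a)" by (rule inv_op_eqI)
    then show ?thesis by (simp add: f poly_op_pCons)
  next
    case False
    then have "\<not> (\<exists>a l. a \<noteq> 0 \<and> l = 0 \<and> f = pCons a l)" by auto
    then obtain z where z: "poly f z = 0" using fundamental_theorem_of_algebra_alt by blast
    then obtain g where g: "f = [:- z, 1:] * g" by (metis dvdE poly_eq_0_iff_dvd)
    then have g0: "g \<noteq> 0" using less by auto
    then have dg: "degree g < degree f"
      unfolding g by (subst degree_mult_eq) auto
    have roots: "w \<notin> spectrum A" if "poly g w = 0" for w using less(3)[of w] that by (simp add: g)
    have "invertible_op (poly_op A g)" by (rule less(1)[OF dg g0 roots])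
    moreover have "invertible_op (A - cscalar z)" using less(3)[OF z] by (simp add: spectrum_iff[OF A])
    ultimately show ?thesis unfolding g poly_op_mult poly_op_linear_factor by (intro invertible_op_compose)
  qed
qed

end

text \<open>For \<open>m = \<parallel>T\<parallel>\<close> one has \<open>\<parallel>(T\<^sup>2 - m\<^sup>2) x\<parallel>\<^sup>2 \<le> m\<^sup>2 (m\<^sup>2 \<parallel>x\<parallel>\<^sup>2 - \<parallel>T x\<parallel>\<^sup>2)\<close>. If \<open>T\<^sup>2 - m\<^sup>2\<close> were
  invertible, \<open>\<parallel>T x\<parallel>\<close> would therefore stay away from \<open>m\<close> on unit vectors.\<close>

lemma square_minus_norm_not_invertible:
  fixes T :: "'a::{real_inner,banach} \<Rightarrow>\<^sub>L 'a"
  assumes T: "radj T = T" "T \<noteq> 0"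
  shows "\<not> invertible_op ((T o\<^sub>L T) - (norm T)\<^sup>2 *\<^sub>R id_blinfun)"
proof
  assume inv: "invertible_op ((T o\<^sub>L T) - (norm T)\<^sup>2 *\<^sub>R id_blinfun)" (is "invertible_op ?B")
  define m where "m = norm T"
  have m: "m > 0" using T by (simp add: m_def)
  define K where "K = (norm (inv_op ?B))\<^sup>2 * m\<^sup>2 + 1"
  have K: "K > 0" by (simp add: K_def add_nonneg_pos)
  have bound: "(norm (T x))\<^sup>2 \<le> (m\<^sup>2 - 1 / K) * (norm x)\<^sup>2" for x
  proof -
    have symm: "inner (T u) v = inner u (T v)" for u v using inner_radj[of T] T by simp
    have Tm: "(norm (T u))\<^sup>2 \<le> m\<^sup>2 * (norm u)\<^sup>2" for u
      using power_mono[OF norm_blinfun[of T u], of 2] by (simp add: m_def power_mult_distrib)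
    have "(norm (?B x))\<^sup>2 = (norm (T (T x)))\<^sup>2 - 2 * m\<^sup>2 * (norm (T x))\<^sup>2 + m\<^sup>2 * m\<^sup>2 * (norm x)\<^sup>2"
    proof -
      have "?B x = T (T x) - m\<^sup>2 *\<^sub>R x" by (simp add: blinfun.diff_left blinfun.scaleR_left m_def)
      moreover have "inner (T (T x)) x = (norm (T x))\<^sup>2" by (simp only: symm power2_norm_eq_inner)
      moreover have "(norm (u - w))\<^sup>2 = (norm u)\<^sup>2 - 2 * inner u w + (norm w)\<^sup>2" for u w :: 'a
        by (simp add: power2_norm_eq_inner inner_diff inner_commute)
      ultimately show ?thesis
        by (simp only: inner_scaleR_right norm_scaleR power_mult_distrib abs_power2 power2_abs
            power2_eq_square[of "m\<^sup>2"] mult.assoc)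
    qed
    then have Bx: "(norm (?B x))\<^sup>2 \<le> m\<^sup>2 * (m\<^sup>2 * (norm x)\<^sup>2 - (norm (T x))\<^sup>2)"
      using Tm[of "T x"] by (simp add: algebra_simps)
    have "x = inv_op ?B (?B x)"
      using arg_cong[OF inv_op_left[OF inv], of "\<lambda>S. S x"] by simp
    then have "norm x \<le> norm (inv_op ?B) * norm (?B x)" by (metis norm_blinfun)
    then have "(norm x)\<^sup>2 \<le> (norm (inv_op ?B))\<^sup>2 * (norm (?B x))\<^sup>2"
      using power_mono[of "norm x" _ 2] by (fastforce simp: power_mult_distrib)
    also have "\<dots> \<le> (norm (inv_op ?B))\<^sup>2 * (m\<^sup>2 * (m\<^sup>2 * (norm x)\<^sup>2 - (norm (T x))\<^sup>2))"
      by (rule mult_left_mono[OF Bx]) simp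
    also have "\<dots> \<le> K * (m\<^sup>2 * (norm x)\<^sup>2 - (norm (T x))\<^sup>2)"
      unfolding K_def mult.assoc[symmetric] by (rule mult_right_mono) (use Tm[of x] in auto)
    finally show ?thesis using K by (simp add: field_simps)
  qed
  define M where "M = sqrt (max 0 (m\<^sup>2 - 1 / K))"
  have "norm T \<le> M"
  proof (rule norm_blinfun_bound)
    show "M \<ge> 0" by (simp add: M_def)
    fix x
    have "(norm (T x))\<^sup>2 \<le> max 0 (m\<^sup>2 - 1 / K) * (norm x)\<^sup>2"
      by (rule order.trans[OF bound]) (intro mult_right_mono; simp)
    also have "\<dots> = (M * norm x)\<^sup>2" by (simp add: M_def power_mult_distrib)
    finally show "norm (T x) \<le> M * norm x" by (rule power2_le_imp_le) (simp add: M_def)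
  qed
  moreover have "M < m"
  proof -
    have "max 0 (m\<^sup>2 - 1 / K) < m\<^sup>2" using m K by simp
    then have "M < sqrt (m\<^sup>2)" unfolding M_def by (rule real_sqrt_less_mono)
    then show ?thesis using m by simp
  qed
  ultimately show False by (simp add: m_def)
qed

definition root_poly :: "real set \<Rightarrow> complex poly" where
  "root_poly L = (\<Prod>a\<in>L. [:- complex_of_real a, 1:])"

lemma poly_root_poly: "finite L \<Longrightarrow> poly (root_poly L) z = (\<Prod>a\<in>L. z - complex_of_real a)"
  by (simp add: root_poly_def poly_prod)

lemma degree_root_poly: "finite L \<Longrightarrow> degree (root_poly L) = card L"
  unfolding root_poly_def by (subst degree_prod_eq_sum_degree) auto

lemma radj_poly_op_root_poly:
  assumes A: "selfadjoint A" and L: "finite L"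
  shows "radj (poly_op A (root_poly L)) = poly_op A (root_poly L)"
  using L
proof (induction L)
  case empty
  then show ?case by (simp add: root_poly_def one_pCons poly_op_pCons cscalar_simps)
next
  case (insert a L)
  have A': "A \<in> bounded_ops" "radj A = A" using A by (auto simp: selfadjoint_iff)
  have eq: "root_poly (insert a L) = [:- complex_of_real a, 1:] * root_poly L"
    using insert by (simp add: root_poly_def)
  have "radj (poly_op A (root_poly (insert a L))) = poly_op A (root_poly L * [:- complex_of_real a, 1:])"
    unfolding eq poly_op_mult[OF A'(1)] poly_op_linear_factor radj_compose insert
    by (simp add: radj_diff A' radj_cscalar)
  then show ?case by (simp add: eq mult.commute)
qed

text \<open>By the spectral mapping theorem a polynomial in \<open>A\<close> that vanishes on the spectrum has spectral
  radius zero, and for a self-adjoint operator the spectral radius is the norm. The extra linear factor makes the argument independent of whether the spectrum is empty, as it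
  is on the zero space.\<close>

lemma root_poly_annihilates:
  assumes A: "selfadjoint A" and L: "finite L" "\<And>z. z \<in> spectrum A \<Longrightarrow> z \<in> complex_of_real ` L"
  shows "poly_op A (root_poly L) = 0"
proof -
  have A': "A \<in> bounded_ops" "radj A = A" using A by (auto simp: selfadjoint_iff)
  let ?T = "poly_op A (root_poly L)"
  \<comment> \<open>A factor of degree one makes \<open>f\<^sup>2 - m\<^sup>2\<close> a nonzero polynomial in any case.\<close>
  have zero: "(A - cscalar (complex_of_real a)) o\<^sub>L ?T = 0" for a
  proof (rule ccontr)
    define f where "f = [:- complex_of_real a, 1:] * root_poly L"
    define m where "m = norm (poly_op A f)"
    assume "(A - cscalar (complex_of_real a)) o\<^sub>L ?T \<noteq> 0"
    then have nz: "poly_op A f \<noteq> 0"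
      by (simp only: f_def poly_op_mult[OF A'(1)] poly_op_linear_factor not_False_eq_True)
    have "radj (poly_op A f) = poly_op A (root_poly L * [:- complex_of_real a, 1:])"
      unfolding f_def poly_op_mult[OF A'(1)] poly_op_linear_factor radj_compose
      by (simp add: radj_poly_op_root_poly[OF A L(1)] radj_diff radj_cscalar A')
    then have sa: "radj (poly_op A f) = poly_op A f" by (simp add: f_def mult.commute)
    define g where "g = f * f - [:complex_of_real (m\<^sup>2):]"
    have "f \<noteq> 0" using nz by auto
    moreover have "degree f > 0"
    proof -
      have "root_poly L \<noteq> 0" using \<open>f \<noteq> 0\<close> unfolding f_def by (metis mult_zero_right)
      then show ?thesis unfolding f_def by (subst degree_mult_eq) auto
    qed
    ultimately have "degree (f * f) > 0" by (simp add: degree_mult_eq)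
    then have "g \<noteq> 0" unfolding g_def by (metis degree_pCons_0 eq_iff_diff_eq_0 less_irrefl)
    moreover have "z \<notin> spectrum A" if "poly g z = 0" for z
    proof
      assume "z \<in> spectrum A"
      then have "poly f z = 0" using L by (auto simp: f_def poly_root_poly)
      then show False using that nz by (simp add: g_def m_def)
    qed
    ultimately have "invertible_op (poly_op A g)" by (rule poly_op_invertible[OF A'(1)])
    moreover have "poly_op A g = (poly_op A f o\<^sub>L poly_op A f) - m\<^sup>2 *\<^sub>R id_blinfun"
    proof -
      have "poly_op A (g + [:complex_of_real (m\<^sup>2):]) = poly_op A f o\<^sub>L poly_op A f"
        by (simp only: g_def diff_add_cancel poly_op_mult[OF A'(1)])
      then have "poly_op A g + m\<^sup>2 *\<^sub>R id_blinfun = poly_op A f o\<^sub>L poly_op A f"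
        by (simp only: poly_op_add) (simp only: poly_op_pCons poly_op_0 cscalar_simps blinfun_compose_zero add_0_right)
      then show ?thesis by (metis add_diff_cancel_right')
    qed
    ultimately show False
      using square_minus_norm_not_invertible[OF sa nz] by (simp add: m_def)
  qed
  have "?T = ((A - cscalar (complex_of_real 0)) o\<^sub>L ?T) - ((A - cscalar (complex_of_real 1)) o\<^sub>L ?T)"
    unfolding cscalar_simps(6) by (simp add: compose_simps)
  also have "\<dots> = 0" by (simp only: zero diff_self)
  finally show ?thesis .
qed

text \<open>The projections are the values at \<open>A\<close> of the Lagrange basis polynomials.\<close>

theorem spectral_decomposition:
  fixes A :: "'a::complex_hilbert_space \<Rightarrow>\<^sub>L 'a"
  assumes A: "selfadjoint A" and fin: "finite (spectrum A)"
  shows "\<exists>L p. finite L \<and>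
    (\<forall>a\<in>L. p a \<in> bounded_ops \<and> radj (p a) = p a \<and> A o\<^sub>L p a = a *\<^sub>R p a \<and> p a o\<^sub>L A = a *\<^sub>R p a) \<and>
    (\<forall>a\<in>L. \<forall>b\<in>L. p a o\<^sub>L p b = (if a = b then p a else 0)) \<and> (\<Sum>a\<in>L. p a) = id_blinfun"
proof -
  have A': "A \<in> bounded_ops" "radj A = A" using A by (auto simp: selfadjoint_iff)
  define L where "L = Re ` spectrum A"
  have L: "finite L" "z \<in> complex_of_real ` L" if "z \<in> spectrum A" for z
    using that fin selfadjoint_spectrum_real[OF A that] by (auto simp: L_def)
  have finL: "finite L" using fin by (simp add: L_def)
  have T0: "poly_op A (root_poly L) = 0" by (rule root_poly_annihilates[OF A finL L(2)])
  define r where "r a = 1 / (\<Prod>b\<in>L - {a}. a - b)" for a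
  define l where "l a = smult (complex_of_real (r a)) (root_poly (L - {a}))" for a
  define p where "p a = poly_op A (l a)" for a
  have l_val: "poly (l a) (complex_of_real b) = (if a = b then 1 else 0)" if "a \<in> L" "b \<in> L" for a b
  proof (cases "a = b")
    case True
    have "(\<Prod>b\<in>L - {a}. a - b) \<noteq> 0" using finL by auto
    then show ?thesis using True finL
      by (simp add: l_def r_def poly_root_poly flip: of_real_diff of_real_prod)
  next
    case False
    then have "(\<Prod>c\<in>L - {a}. complex_of_real b - complex_of_real c) = 0"
      using finL that by (intro prod_zero) auto
    then show ?thesis using False finL by (simp add: l_def poly_root_poly)
  qed
  have Ap: "A o\<^sub>L p a = cscalar (complex_of_real a) o\<^sub>L p a" if a: "a \<in> L" for a
  proof -
    have "root_poly L = [:- complex_of_real a, 1:] * root_poly (L - {a})"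
      unfolding root_poly_def using finL a by (rule prod.remove)
    then have "[:- complex_of_real a, 1:] * l a = smult (complex_of_real (r a)) (root_poly L)"
      by (simp add: l_def)
    then have "(A - cscalar (complex_of_real a)) o\<^sub>L p a = 0"
      using poly_op_mult[OF A'(1), of "[:- complex_of_real a, 1:]" "l a"]
      by (simp only: poly_op_linear_factor p_def poly_op_smult[OF A'(1)] T0 blinfun_compose_zero)
    then show ?thesis by (simp add: compose_simps)
  qed
  have adj: "radj (p a) = p a" for a
    unfolding p_def l_def poly_op_smult[OF A'(1)] cscalar_simps(6)
    using radj_poly_op_root_poly[OF A, of "L - {a}"] finL by (simp add: compose_simps radj_scaleR)
  have "p a \<in> bounded_ops" for a unfolding p_def by (rule poly_op_bounded[OF A'(1)])
  moreover have Ap': "A o\<^sub>L p a = a *\<^sub>R p a" if "a \<in> L" for a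
    using Ap[OF that] by (simp add: cscalar_simps(6) compose_simps)
  moreover have "p a o\<^sub>L A = a *\<^sub>R p a" if "a \<in> L" for a
    using arg_cong[OF Ap'[OF that], of radj] by (simp add: radj_scaleR adj A')
  moreover have "p a o\<^sub>L p b = (if a = b then p a else 0)" if "a \<in> L" "b \<in> L" for a b
  proof -
    have "p a o\<^sub>L p b = cscalar (poly (l a) (complex_of_real b)) o\<^sub>L p b"
      unfolding p_def[of a] by (rule poly_op_eigen[OF A'(1) Ap[OF that(2)]])
    then show ?thesis using l_val[OF that] by (simp add: cscalar_simps)
  qed
  moreover have "(\<Sum>a\<in>L. p a) = id_blinfun"
  proof -
    have sum_op: "(\<Sum>a\<in>X. p a) = poly_op A (\<Sum>a\<in>X. l a)" if "finite X" for X
      using that by induction (simp_all add: p_def poly_op_add)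
    show ?thesis
    proof (cases "L = {}")
      case True
      then show ?thesis
        using T0 by (simp add: root_poly_def one_pCons poly_op_pCons cscalar_simps)
    next
      case False
      have "(\<Sum>a\<in>L. l a) = 1"
      proof (rule poly_eqI_degree)
        fix z assume "z \<in> complex_of_real ` L"
        then obtain b where b: "b \<in> L" "z = complex_of_real b" by blast
        have "poly (\<Sum>a\<in>L. l a) z = (\<Sum>a\<in>L. if a = b then 1 else 0)"
          unfolding poly_sum b(2) using l_val b(1) by (intro sum.cong) auto
        then show "poly (\<Sum>a\<in>L. l a) z = poly 1 z" using b finL by simp
      next
        have card: "card (complex_of_real ` L) = card L" by (simp add: card_image inj_on_def)
        have pos: "card L > 0" using False finL by (simp add: card_gt_0_iff)
        have "degree (l a) \<le> card L - 1" if "a \<in> L" for a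
          using that finL degree_smult_le[of "complex_of_real (r a)" "root_poly (L - {a})"]
          by (simp add: l_def degree_root_poly)
        then have "degree (\<Sum>a\<in>L. l a) \<le> card L - 1" by (intro degree_sum_le finL)
        then show "degree (\<Sum>a\<in>L. l a) < card (complex_of_real ` L)" using card pos by linarith
        show "degree (1 :: complex poly) < card (complex_of_real ` L)" using card pos by simp
      qed
      then show ?thesis using sum_op[OF finL] by (simp add: one_pCons poly_op_pCons cscalar_simps)
    qed
  qed
  ultimately show ?thesis using finL adj by (intro exI[of _ L] exI[of _ p]) simp
qed

section \<open>Multiplication operators\<close>

definition lmul :: "('a::real_normed_vector \<Rightarrow>\<^sub>L 'a) \<Rightarrow> ('a \<Rightarrow>\<^sub>L 'a) \<Rightarrow>\<^sub>L ('a \<Rightarrow>\<^sub>L 'a)" where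
  "lmul x = Blinfun (\<lambda>h. x o\<^sub>L h)"

definition rmul :: "('a::real_normed_vector \<Rightarrow>\<^sub>L 'a) \<Rightarrow> ('a \<Rightarrow>\<^sub>L 'a) \<Rightarrow>\<^sub>L ('a \<Rightarrow>\<^sub>L 'a)" where
  "rmul x = Blinfun (\<lambda>h. h o\<^sub>L x)"

lemma lmul_apply [simp]: "lmul x h = x o\<^sub>L h"
  by (simp add: lmul_def bounded_linear_Blinfun_apply
      bounded_bilinear.bounded_linear_right[OF bounded_bilinear_blinfun_compose])

lemma rmul_apply [simp]: "rmul x h = h o\<^sub>L x"
  by (simp add: rmul_def bounded_linear_Blinfun_apply
      bounded_bilinear.bounded_linear_left[OF bounded_bilinear_blinfun_compose])

lemma bounded_linear_lmul: "bounded_linear lmul"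
proof (rule bounded_linear_intro[where K = 1])
  show "lmul (x + y) = lmul x + lmul y" for x y :: "'a \<Rightarrow>\<^sub>L 'a"
    by (rule blinfun_eqI) (simp add: compose_simps blinfun.add_left)
  show "lmul (r *\<^sub>R x) = r *\<^sub>R lmul x" for r and x :: "'a \<Rightarrow>\<^sub>L 'a"
    by (rule blinfun_eqI) (simp add: compose_simps blinfun.scaleR_left)
  show "norm (lmul x) \<le> norm x * 1" for x :: "'a \<Rightarrow>\<^sub>L 'a"
    by (rule norm_blinfun_bound) (simp_all add: norm_blinfun_compose)
qed

lemma bounded_linear_rmul: "bounded_linear rmul"
proof (rule bounded_linear_intro[where K = 1])
  show "rmul (x + y) = rmul x + rmul y" for x y :: "'a \<Rightarrow>\<^sub>L 'a"
    by (rule blinfun_eqI) (simp add: compose_simps blinfun.add_left)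
  show "rmul (r *\<^sub>R x) = r *\<^sub>R rmul x" for r and x :: "'a \<Rightarrow>\<^sub>L 'a"
    by (rule blinfun_eqI) (simp add: compose_simps blinfun.scaleR_left)
  show "norm (rmul x) \<le> norm x * 1" for x :: "'a \<Rightarrow>\<^sub>L 'a"
    by (rule norm_blinfun_bound) (simp_all add: norm_blinfun_compose mult.commute[of "norm x"])
qed

lemma lmul_simps:
  "lmul (x + y) = lmul x + lmul y" "lmul id_blinfun = id_blinfun" "lmul (x o\<^sub>L y) = lmul x o\<^sub>L lmul y"
  using linear_simps(1)[OF bounded_linear_lmul] by (auto intro: blinfun_eqI simp: compose_assoc)

text \<open>The value at the identity of an inverse of \<^term>\<open>lmul x\<close> is an inverse of \<open>x\<close>.\<close>

lemma lmul_inv_op: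
  shows "invertible_op (lmul x) \<longleftrightarrow> invertible_op x" "inv_op (lmul x) = lmul (inv_op x)"
proof -
  have *: "invertible_op (lmul x) \<and> inv_op (lmul x) = lmul (inv_op x)" if "invertible_op x"
  proof -
    have "lmul (inv_op x) o\<^sub>L lmul x = id_blinfun" "lmul x o\<^sub>L lmul (inv_op x) = id_blinfun"
      using inv_op[OF that] by (metis lmul_simps(2,3))+
    then show ?thesis by (auto intro: inv_op_eqI)
  qed
  show iff: "invertible_op (lmul x) \<longleftrightarrow> invertible_op x"
  proof
    assume inv: "invertible_op (lmul x)"
    let ?S = "inv_op (lmul x)"
    have left: "?S (x o\<^sub>L h) = h" for h
      using arg_cong[OF inv_op_left[OF inv], of "\<lambda>T. T h"] by simp
    have right: "x o\<^sub>L ?S h = h" for h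
      using arg_cong[OF inv_op_right[OF inv], of "\<lambda>T. T h"] by simp
    let ?s = "?S id_blinfun"
    have "?s o\<^sub>L x = ?S (x o\<^sub>L (?s o\<^sub>L x))" by (simp only: left)
    also have "\<dots> = ?S (x o\<^sub>L id_blinfun)" by (simp only: compose_assoc[symmetric] right compose_id)
    finally have "?s o\<^sub>L x = id_blinfun" by (simp only: left)
    then show "invertible_op x" using right by (rule inv_op_eqI)
  qed (use * in blast)
  show "inv_op (lmul x) = lmul (inv_op x)"
  proof (cases "invertible_op x")
    case False
    then have "inv_op (lmul x) = 0" "inv_op x = 0" using iff by (simp_all add: inv_op_def)
    then show ?thesis using linear_simps(3)[OF bounded_linear_lmul] by simp
  qed (use * in blast)
qed

lemma rat_mono: "rat U G S f \<Longrightarrow> G \<subseteq> H \<Longrightarrow> rat U H S f"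
proof (induction rule: rat.induct)
  case (rat_linear l S f)
  then show ?case using rat.rat_linear by blast
next
  case (rat_mult \<beta> S f T g)
  then show ?case using rat.rat_mult by blast
next
  case (rat_slot \<gamma> S f i)
  then show ?case using rat.rat_slot by blast
qed (auto intro: rat.intros)

text \<open>Operator valued functions enter through their left multiplications. This allows expressions to
  contain inverses of operators that act on operators, as the inverse function theorem requires.\<close>

definition lrat :: "'b::real_normed_vector set
    \<Rightarrow> ('b \<Rightarrow> ('a::real_normed_vector \<Rightarrow>\<^sub>L 'a) \<Rightarrow>\<^sub>L ('a \<Rightarrow>\<^sub>L 'a)) set \<Rightarrow> ('b \<Rightarrow> 'a \<Rightarrow>\<^sub>L 'a) \<Rightarrow> bool" where
  "lrat U G f \<longleftrightarrow> rat U G {} (\<lambda>z vs. lmul (f z))"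

lemma rat_lmul: "lrat U G f \<Longrightarrow> rat U G {} (\<lambda>z vs. lmul (f z))"
  by (simp add: lrat_def)

lemma rat_linear_of_lrat:
  assumes l: "bounded_linear l" and f: "lrat U G f"
  shows "rat U G {} (\<lambda>z vs. l (f z))"
proof -
  have "bounded_linear (\<lambda>T :: ('a \<Rightarrow>\<^sub>L 'a) \<Rightarrow>\<^sub>L ('a \<Rightarrow>\<^sub>L 'a). l (T id_blinfun))"
    by (rule bounded_linear_compose[OF l bounded_linear_apply_blinfun])
  from rat_linear[OF this rat_lmul[OF f]] show ?thesis by simp
qed

lemma rat_rmul: "lrat U G f \<Longrightarrow> rat U G {} (\<lambda>z vs. rmul (f z))"
  by (rule rat_linear_of_lrat[OF bounded_linear_rmul])

lemma lrat_const: "lrat U G (\<lambda>z. c)"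
  unfolding lrat_def by (rule rat_const)

lemma lrat_linear: "bounded_linear l \<Longrightarrow> lrat U G f \<Longrightarrow> lrat U G (\<lambda>z. l (f z))"
  unfolding lrat_def[of U G "\<lambda>z. l (f z)"]
  by (rule rat_linear_of_lrat) (rule bounded_linear_compose[OF bounded_linear_lmul])

lemma lrat_add: "lrat U G f \<Longrightarrow> lrat U G g \<Longrightarrow> lrat U G (\<lambda>z. f z + g z)"
  unfolding lrat_def lmul_simps by (rule rat_add)

lemma lrat_compose: "lrat U G f \<Longrightarrow> lrat U G g \<Longrightarrow> lrat U G (\<lambda>z. f z o\<^sub>L g z)"
  unfolding lrat_def lmul_simps by (rule rat_compose)

lemma lrat_inv_op:
  assumes "lrat U G f" "\<And>z. z \<in> U \<Longrightarrow> invertible_op (f z)"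
  shows "lrat U G (\<lambda>z. inv_op (f z))"
  using assms unfolding lrat_def lmul_inv_op(2)[symmetric] by (intro rat_inv_op) (simp_all add: lmul_inv_op(1))

lemma lrat_cayley:
  assumes "lrat U G f" "\<And>z. z \<in> U \<Longrightarrow> invertible_op (id_blinfun + f z)"
  shows "lrat U G (\<lambda>z. cayley (f z))"
proof -
  have "lrat U G (\<lambda>z. 2 *\<^sub>R inv_op (id_blinfun + f z) + - id_blinfun)"
    by (intro lrat_add lrat_const lrat_linear[OF bounded_linear_scaleR_right] lrat_inv_op assms)
  then show ?thesis by (simp add: cayley_def)
qed

section \<open>Local inverses\<close>

lemma perturbation_expands:
  assumes "norm (N x - N y) \<le> 1 / 2 * norm (x - y)"
  shows "norm (x - y) \<le> 2 * norm ((x + N x) - (y + N y))"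
proof -
  have "x - y = ((x + N x) - (y + N y)) - (N x - N y)" by simp
  then have "norm (x - y) \<le> norm ((x + N x) - (y + N y)) + norm (N x - N y)"
    by (metis norm_triangle_ineq4)
  then show ?thesis using assms by linarith
qed

text \<open>The solution is the fixed point of the contraction \<open>y \<mapsto> z - N y\<close> on a closed ball of the subspace
  \<open>V\<close>.\<close>

lemma perturbation_inverse:
  fixes N :: "'b::banach \<Rightarrow> 'b"
  assumes V: "subspace V" "closed V" and r: "r > 0"
    and N0: "N 0 = 0" and NV: "\<And>y. y \<in> V \<Longrightarrow> norm y < r \<Longrightarrow> N y \<in> V"
    and lip: "\<And>x y. x \<in> V \<Longrightarrow> y \<in> V \<Longrightarrow> norm x < r \<Longrightarrow> norm y < r \<Longrightarrow>
      norm (N x - N y) \<le> 1 / 2 * norm (x - y)"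
    and z: "z \<in> V" "norm z < r / 2"
  shows "\<exists>y\<in>V. norm y < r \<and> y + N y = z"
proof -
  define s where "s = 2 * norm z"
  have s: "s < r" "s \<ge> 0" using z by (simp_all add: s_def)
  have "\<exists>!y\<in>V \<inter> cball 0 s. z - N y = y"
  proof (rule Banach_fix[of _ "1/2"])
    show "complete (V \<inter> cball 0 s)" using V(2) by (simp add: complete_eq_closed closed_Int)
    show "V \<inter> cball 0 s \<noteq> {}" using V(1) s subspace_0 by force
    show "(\<lambda>y. z - N y) ` (V \<inter> cball 0 s) \<subseteq> V \<inter> cball 0 s"
    proof clarify
      fix y assume y: "y \<in> V" "y \<in> cball 0 s"
      have "norm (N y) \<le> 1 / 2 * norm y"
        using lip[of y 0] y s V(1) r by (simp add: N0 subspace_0)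
      then have "norm (z - N y) \<le> s"
        using norm_triangle_ineq4[of z "N y"] y(2) by (simp add: s_def)
      then show "z - N y \<in> V \<inter> cball 0 s"
        using NV[of y] y s z(1) V(1) by (simp add: subspace_diff)
    qed
    show "dist (z - N x) (z - N y) \<le> 1 / 2 * dist x y"
      if "x \<in> V \<inter> cball 0 s" "y \<in> V \<inter> cball 0 s" for x y
      using lip[of y x] that s by (simp add: dist_norm norm_minus_commute)
  qed auto
  then obtain y where "y \<in> V" "norm y \<le> s" "z - N y = y" by auto
  then show ?thesis using s by (intro bexI[of _ y]) (auto simp: algebra_simps)
qed

text \<open>Apply the inverse of \<open>J\<close> to the linearization of \<open>f\<close> at \<open>g z\<close>; the Lipschitz bound for \<open>g\<close> turns its error
  into one of higher order in \<open>w - z\<close>.\<close>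

lemma has_derivative_of_right_inverse:
  fixes f :: "'b::real_normed_vector \<Rightarrow> 'b" and J :: "'b \<Rightarrow>\<^sub>L 'b"
  assumes J: "(f has_derivative J) (at (g z))" "invertible_op J"
    and z: "z \<in> W" and fg: "\<And>w. w \<in> W \<Longrightarrow> f (g w) = w"
    and lip: "\<And>w. w \<in> W \<Longrightarrow> norm (g w - g z) \<le> 2 * norm (w - z)"
  shows "(g has_derivative inv_op J) (at z within W)"
  unfolding has_derivative_within_alt
proof (intro conjI allI impI)
  show "bounded_linear (inv_op J)" by (rule blinfun.bounded_linear_right)
  fix e :: real assume e: "e > 0"
  define M where "M = 2 * (norm (inv_op J) + 1)"
  have M: "M > 0" by (simp add: M_def add_nonneg_pos)
  then have "e / M > 0" using e by simp
  then obtain d where d: "d > 0"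
      "\<And>y. norm (y - g z) < d \<Longrightarrow> norm (f y - f (g z) - J (y - g z)) \<le> e / M * norm (y - g z)"
    using J(1) unfolding has_derivative_at_alt by blast
  have "norm (g w - g z - inv_op J (w - z)) \<le> e * norm (w - z)"
    if w: "w \<in> W" "norm (w - z) < d / 2" for w
  proof -
    have cancel: "inv_op J (J h) = h" for h
      using arg_cong[OF inv_op_left[OF J(2)], of "\<lambda>T. T h"] by simp
    have "norm (g w - g z) < d" using lip[OF w(1)] w(2) by linarith
    then have "norm (w - z - J (g w - g z)) \<le> e / M * norm (g w - g z)"
      using d(2)[of "g w"] fg w(1) z by simp
    also have "\<dots> \<le> e / M * (2 * norm (w - z))" using e M by (intro mult_left_mono lip w) simp
    finally have *: "norm (w - z - J (g w - g z)) \<le> e / M * (2 * norm (w - z))" .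
    have "g w - g z - inv_op J (w - z) = - inv_op J (w - z - J (g w - g z))"
      by (simp add: blinfun.diff_right cancel)
    then have "norm (g w - g z - inv_op J (w - z)) = norm (inv_op J (w - z - J (g w - g z)))" by simp
    also have "\<dots> \<le> norm (inv_op J) * norm (w - z - J (g w - g z))" by (rule norm_blinfun)
    also have "\<dots> \<le> (M / 2) * (e / M * (2 * norm (w - z)))" using * M by (intro mult_mono) (auto simp: M_def)
    also have "\<dots> = e * norm (w - z)" using M by simp
    finally show ?thesis .
  qed
  then show "\<exists>d>0. \<forall>y\<in>W. norm (y - z) < d \<longrightarrow> norm (g y - g z - inv_op J (y - z)) \<le> e * norm (y - z)"
    using d(1) by (intro exI[of _ "d / 2"]) auto
qed

section \<open>Conjugation by Cayley transforms\<close>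

definition cayley_conj :: "('x::real_normed_vector \<Rightarrow>\<^sub>L 'x) \<Rightarrow> ('x \<Rightarrow>\<^sub>L 'x) \<Rightarrow> ('x \<Rightarrow>\<^sub>L 'x)" where
  "cayley_conj x Z = cayley x o\<^sub>L Z o\<^sub>L cayley (- x)"

text \<open>The partial derivative of \<^const>\<open>cayley_conj\<close> in \<open>x\<close>.\<close>

definition cayley_conj_deriv ::
    "('x::real_normed_vector \<Rightarrow>\<^sub>L 'x) \<Rightarrow> ('x \<Rightarrow>\<^sub>L 'x) \<Rightarrow> ('x \<Rightarrow>\<^sub>L 'x) \<Rightarrow>\<^sub>L ('x \<Rightarrow>\<^sub>L 'x)" where
  "cayley_conj_deriv x Z =
     (lmul (cayley x o\<^sub>L Z o\<^sub>L (2 *\<^sub>R inv_op (id_blinfun - x))) o\<^sub>L rmul (inv_op (id_blinfun - x)))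
     - (lmul (2 *\<^sub>R inv_op (id_blinfun + x)) o\<^sub>L rmul (inv_op (id_blinfun + x) o\<^sub>L Z o\<^sub>L cayley (- x)))"

abbreviation cayley_domain :: "('x::real_normed_vector \<Rightarrow>\<^sub>L 'x) set" where
  "cayley_domain \<equiv> {x. invertible_op (id_blinfun + x) \<and> invertible_op (id_blinfun - x)}"

lemma open_cayley_domain: "open (cayley_domain :: ('x::banach \<Rightarrow>\<^sub>L 'x) set)"
proof -
  have "open ((\<lambda>x. id_blinfun + x) -` {T :: 'x \<Rightarrow>\<^sub>L 'x. invertible_op T} \<inter> (\<lambda>x. id_blinfun - x) -` {T. invertible_op T})"
    by (intro open_Int open_vimage open_invertible continuous_intros)
  moreover have "cayley_domain = (\<lambda>x. id_blinfun + x) -` {T :: 'x \<Rightarrow>\<^sub>L 'x. invertible_op T} \<inter> (\<lambda>x. id_blinfun - x) -` {T. invertible_op T}"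
    by auto
  ultimately show ?thesis by simp
qed

lemma cayley_conj_has_derivative:
  fixes f Z :: "'b::real_normed_vector \<Rightarrow> 'x::banach \<Rightarrow>\<^sub>L 'x"
  assumes f: "(f has_derivative f') (at y)" and Z: "(Z has_derivative Z') (at y)"
    and dom: "f y \<in> cayley_domain"
  shows "((\<lambda>y. cayley_conj (f y) (Z y)) has_derivative
    (\<lambda>h. cayley_conj_deriv (f y) (Z y) (f' h) + (cayley (f y) o\<^sub>L Z' h o\<^sub>L cayley (- f y)))) (at y)"
proof -
  let ?P = "inv_op (id_blinfun + f y)" and ?M = "inv_op (id_blinfun - f y)"
  note comp = bounded_bilinear.FDERIV[OF bounded_bilinear_blinfun_compose]
  have p: "invertible_op (id_blinfun + f y)" and m: "invertible_op (id_blinfun + - f y)" using dom by auto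
  have 1: "((\<lambda>y. cayley (f y)) has_derivative (\<lambda>h. - 2 *\<^sub>R (?P o\<^sub>L f' h o\<^sub>L ?P))) (at y)"
    by (rule has_derivative_compose[OF f cayley_has_derivative[OF p]])
  have 2: "((\<lambda>y. cayley (- f y)) has_derivative
      (\<lambda>h. - 2 *\<^sub>R (inv_op (id_blinfun + - f y) o\<^sub>L - f' h o\<^sub>L inv_op (id_blinfun + - f y)))) (at y)"
    by (rule has_derivative_compose[OF has_derivative_minus[OF f] cayley_has_derivative[OF m]])
  have "((\<lambda>y. cayley_conj (f y) (Z y)) has_derivative
      (\<lambda>h. ((cayley (f y) o\<^sub>L Z y) o\<^sub>L (- 2 *\<^sub>R (inv_op (id_blinfun + - f y) o\<^sub>L - f' h o\<^sub>L inv_op (id_blinfun + - f y))))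
        + (((cayley (f y) o\<^sub>L Z' h) + ((- 2 *\<^sub>R (?P o\<^sub>L f' h o\<^sub>L ?P)) o\<^sub>L Z y)) o\<^sub>L cayley (- f y)))) (at y)"
    unfolding cayley_conj_def by (rule comp[OF comp[OF 1 Z] 2])
  then show ?thesis
    by (rule has_derivative_eq_rhs)
      (simp add: fun_eq_iff cayley_conj_deriv_def blinfun.diff_left compose_simps)
qed

lemma rat_cayley_conj_deriv:
  assumes x: "lrat U G x" and Z: "lrat U G Z" and dom: "\<And>z. z \<in> U \<Longrightarrow> x z \<in> cayley_domain"
  shows "rat U G {} (\<lambda>z vs. cayley_conj_deriv (x z) (Z z))"
proof -
  have minus: "lrat U G (\<lambda>z. - x z)"
    by (rule lrat_linear[OF bounded_linear_minus[OF bounded_linear_ident] x])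
  have m: "lrat U G (\<lambda>z. inv_op (id_blinfun - x z))"
    using lrat_inv_op[OF lrat_add[OF lrat_const minus], of id_blinfun] dom by simp
  have p: "lrat U G (\<lambda>z. inv_op (id_blinfun + x z))"
    using lrat_inv_op[OF lrat_add[OF lrat_const x], of id_blinfun] dom by simp
  have c: "lrat U G (\<lambda>z. cayley (x z))" by (rule lrat_cayley[OF x]) (use dom in auto)
  have c': "lrat U G (\<lambda>z. cayley (- x z))" by (rule lrat_cayley[OF minus]) (use dom in auto)
  show ?thesis
    unfolding cayley_conj_deriv_def
    by (intro rat_diff rat_compose rat_lmul rat_rmul lrat_compose
        lrat_linear[OF bounded_linear_scaleR_right] c c' Z m p)
qed

lemma continuous_on_cayley_conj_deriv:
  fixes f Z :: "'b::real_normed_vector \<Rightarrow> 'x::banach \<Rightarrow>\<^sub>L 'x"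
  assumes f: "continuous_on S f" and Z: "continuous_on S Z" and dom: "\<And>y. y \<in> S \<Longrightarrow> f y \<in> cayley_domain"
  shows "continuous_on S (\<lambda>y. cayley_conj_deriv (f y) (Z y))"
proof -
  have p: "continuous_on S (\<lambda>y. inv_op (id_blinfun + f y))"
    by (rule continuous_on_compose2[OF continuous_on_inv_op]) (use dom in \<open>auto intro!: continuous_intros f\<close>)
  have m: "continuous_on S (\<lambda>y. inv_op (id_blinfun - f y))"
    by (rule continuous_on_compose2[OF continuous_on_inv_op]) (use dom in \<open>auto intro!: continuous_intros f\<close>)
  have c: "continuous_on S (\<lambda>y. cayley (f y))"
    unfolding cayley_def by (intro continuous_intros p)
  have c': "continuous_on S (\<lambda>y. cayley (- f y))"
    using m unfolding cayley_def by (auto intro!: continuous_intros)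
  note lm = bounded_linear.continuous_on[OF bounded_linear_lmul]
  note rm = bounded_linear.continuous_on[OF bounded_linear_rmul]
  show ?thesis
    unfolding cayley_conj_deriv_def by (intro continuous_intros lm rm c c' Z m p)
qed

section \<open>Operators with finite spectral resolution\<close>

lemma bounded_linear_sandwich:
  fixes S :: "'b::real_normed_vector \<Rightarrow>\<^sub>L 'c::real_normed_vector" and T :: "'a::real_normed_vector \<Rightarrow>\<^sub>L 'd::real_normed_vector"
  shows "bounded_linear (\<lambda>h. S o\<^sub>L h o\<^sub>L T)"
  by (rule bounded_linear_compose[OF bounded_bilinear.bounded_linear_left[OF bounded_bilinear_blinfun_compose]
        bounded_bilinear.bounded_linear_right[OF bounded_bilinear_blinfun_compose]])

text \<open>The spectral theorem in finite form, \<open>A = \<Sum> a p\<^sub>a\<close>. Relative to the projections \<open>p\<^sub>a\<close>, operators are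
  block matrices, and the entry at \<open>(a, b)\<close> is \<open>p\<^sub>a x p\<^sub>b\<close>.\<close>

locale finite_resolution =
  fixes A :: "'a::complex_hilbert_space \<Rightarrow>\<^sub>L 'a" and L :: "real set" and p :: "real \<Rightarrow> 'a \<Rightarrow>\<^sub>L 'a"
  assumes A_bounded: "A \<in> bounded_ops" and A_radj: "radj A = A" and finite_L: "finite L"
    and p_bounded: "a \<in> L \<Longrightarrow> p a \<in> bounded_ops" and p_radj: "a \<in> L \<Longrightarrow> radj (p a) = p a"
    and A_p: "a \<in> L \<Longrightarrow> A o\<^sub>L p a = a *\<^sub>R p a" and p_A: "a \<in> L \<Longrightarrow> p a o\<^sub>L A = a *\<^sub>R p a"
    and p_p: "a \<in> L \<Longrightarrow> b \<in> L \<Longrightarrow> p a o\<^sub>L p b = (if a = b then p a else 0)"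
    and sum_p: "(\<Sum>a\<in>L. p a) = id_blinfun"
begin

lemma eq_if_entries_eq:
  assumes "\<And>a b. a \<in> L \<Longrightarrow> b \<in> L \<Longrightarrow> p a o\<^sub>L x o\<^sub>L p b = p a o\<^sub>L y o\<^sub>L p b"
  shows "x = y"
proof -
  have "x = (\<Sum>a\<in>L. \<Sum>b\<in>L. p a o\<^sub>L x o\<^sub>L p b)" for x
  proof -
    have "x = (\<Sum>a\<in>L. p a) o\<^sub>L x o\<^sub>L (\<Sum>b\<in>L. p b)" by (simp add: sum_p)
    also have "\<dots> = (\<Sum>a\<in>L. \<Sum>b\<in>L. p a o\<^sub>L x o\<^sub>L p b)"
      by (simp add: compose_simps) (rule sum.swap)
    finally show ?thesis .
  qed
  from this[of x] this[of y] show ?thesis using assms by (metis (no_types, lifting) sum.cong)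
qed

lemma p_p_left: "a \<in> L \<Longrightarrow> b \<in> L \<Longrightarrow> p a o\<^sub>L (p b o\<^sub>L x) = (if a = b then p a o\<^sub>L x else 0)"
  by (simp add: p_p flip: compose_assoc)

lemma p_A_left: "a \<in> L \<Longrightarrow> p a o\<^sub>L (A o\<^sub>L x) = a *\<^sub>R (p a o\<^sub>L x)"
  by (simp add: p_A compose_simps flip: compose_assoc)

definition diag :: "('a \<Rightarrow>\<^sub>L 'a) \<Rightarrow> ('a \<Rightarrow>\<^sub>L 'a)" where
  "diag h = (\<Sum>a\<in>L. p a o\<^sub>L h o\<^sub>L p a)"

text \<open>On operators without diagonal part this is the inverse of the commutator with \<open>A\<close>, which
  multiplies the entry at \<open>(a, b)\<close> by \<open>b - a\<close>. The convention \<open>inverse 0 = 0\<close> removes the diagonal.\<close>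

definition comm_inverse :: "('a \<Rightarrow>\<^sub>L 'a) \<Rightarrow> ('a \<Rightarrow>\<^sub>L 'a)" where
  "comm_inverse h = (\<Sum>a\<in>L. \<Sum>b\<in>L. inverse (b - a) *\<^sub>R (p a o\<^sub>L h o\<^sub>L p b))"

lemma diag_entry:
  assumes "a \<in> L" "b \<in> L"
  shows "p a o\<^sub>L diag h o\<^sub>L p b = (if a = b then p a o\<^sub>L h o\<^sub>L p b else 0)"
proof -
  have "p a o\<^sub>L diag h o\<^sub>L p b = (\<Sum>c\<in>L. if c = a then (if a = b then p a o\<^sub>L h o\<^sub>L p b else 0) else 0)"
    unfolding diag_def compose_simps by (intro sum.cong refl) (use assms in \<open>auto simp: p_p p_p_left\<close>)
  then show ?thesis using assms finite_L by simp
qed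

lemma comm_inverse_entry:
  assumes "a \<in> L" "b \<in> L"
  shows "p a o\<^sub>L comm_inverse h o\<^sub>L p b = inverse (b - a) *\<^sub>R (p a o\<^sub>L h o\<^sub>L p b)"
proof -
  have "p a o\<^sub>L comm_inverse h o\<^sub>L p b =
      (\<Sum>c\<in>L. \<Sum>d\<in>L. if c = a then (if d = b then inverse (b - a) *\<^sub>R (p a o\<^sub>L h o\<^sub>L p b) else 0) else 0)"
    unfolding comm_inverse_def compose_simps by (intro sum.cong refl) (use assms in \<open>auto simp: p_p p_p_left\<close>)
  also have "\<dots> = (\<Sum>c\<in>L. if c = a then inverse (b - a) *\<^sub>R (p a o\<^sub>L h o\<^sub>L p b) else 0)"
    using assms finite_L by (intro sum.cong refl) simp
  also have "\<dots> = inverse (b - a) *\<^sub>R (p a o\<^sub>L h o\<^sub>L p b)" using assms finite_L by simp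
  finally show ?thesis .
qed

lemma commutator_entry:
  assumes "a \<in> L" "b \<in> L"
  shows "p a o\<^sub>L commutator x A o\<^sub>L p b = (b - a) *\<^sub>R (p a o\<^sub>L x o\<^sub>L p b)"
  using assms by (simp add: commutator_def compose_simps p_A_left A_p scaleR_diff_left)

lemma bounded_linear_diag: "bounded_linear diag"
  unfolding diag_def by (intro bounded_linear_sum bounded_linear_sandwich)

lemma bounded_linear_comm_inverse: "bounded_linear comm_inverse"
  unfolding comm_inverse_def
  by (intro bounded_linear_sum bounded_linear_compose[OF bounded_linear_scaleR_right] bounded_linear_sandwich)

lemma diag_simps:
  "diag (x + y) = diag x + diag y" "diag (x - y) = diag x - diag y" "diag (r *\<^sub>R x) = r *\<^sub>R diag x" "diag 0 = 0"
  using linear_simps[OF bounded_linear_diag] by auto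

lemma diag_diag [simp]: "diag (diag x) = diag x"
  by (rule eq_if_entries_eq) (simp add: diag_entry)

lemma diag_commutator [simp]: "diag (commutator x A) = 0"
  by (rule eq_if_entries_eq) (simp add: diag_entry commutator_entry)

lemma entry_diff: "p a o\<^sub>L (x - y) o\<^sub>L p b = (p a o\<^sub>L x o\<^sub>L p b) - (p a o\<^sub>L y o\<^sub>L p b)"
  by (simp add: compose_simps)

lemma commutator_comm_inverse: "commutator (comm_inverse x) A = x - diag x"
  by (rule eq_if_entries_eq) (simp add: diag_entry comm_inverse_entry commutator_entry entry_diff)

lemma commutator_eq_0_iff: "commutator x A = 0 \<longleftrightarrow> diag x = x"
proof
  assume 0: "commutator x A = 0"
  show "diag x = x"
  proof (rule eq_if_entries_eq)
    fix a b assume ab: "a \<in> L" "b \<in> L"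
    have "(b - a) *\<^sub>R (p a o\<^sub>L x o\<^sub>L p b) = 0" using commutator_entry[OF ab, of x] 0 by simp
    then show "p a o\<^sub>L diag x o\<^sub>L p b = p a o\<^sub>L x o\<^sub>L p b" using ab by (auto simp: diag_entry)
  qed
next
  assume d: "diag x = x"
  have "commutator (diag x) A = 0"
    by (rule eq_if_entries_eq) (simp add: diag_entry commutator_entry)
  then show "commutator x A = 0" by (simp add: d)
qed

lemma radj_entry:
  assumes "a \<in> L" "b \<in> L"
  shows "radj (p a o\<^sub>L x o\<^sub>L p b) = p b o\<^sub>L radj x o\<^sub>L p a"
  using assms by (simp add: p_radj compose_assoc)

lemma radj_diag: "radj (diag x) = diag (radj x)"
  unfolding diag_def radj_sum by (intro sum.cong refl radj_entry)

lemma radj_comm_inverse: "radj (comm_inverse x) = - comm_inverse (radj x)"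
proof -
  have "radj (comm_inverse x) = (\<Sum>a\<in>L. \<Sum>b\<in>L. inverse (b - a) *\<^sub>R (p b o\<^sub>L radj x o\<^sub>L p a))"
    unfolding comm_inverse_def radj_sum radj_scaleR by (intro sum.cong refl) (simp only: radj_entry)
  also have "\<dots> = (\<Sum>b\<in>L. \<Sum>a\<in>L. inverse (b - a) *\<^sub>R (p b o\<^sub>L radj x o\<^sub>L p a))" by (rule sum.swap)
  also have "\<dots> = (\<Sum>b\<in>L. \<Sum>a\<in>L. - (inverse (a - b) *\<^sub>R (p b o\<^sub>L radj x o\<^sub>L p a)))"
    by (intro sum.cong refl) (simp flip: scaleR_minus_left inverse_minus_eq)
  finally show ?thesis by (simp add: comm_inverse_def sum_negf)
qed

lemma compact_sandwich:
  "x \<in> compact_ops \<Longrightarrow> a \<in> L \<Longrightarrow> b \<in> L \<Longrightarrow> p a o\<^sub>L x o\<^sub>L p b \<in> compact_ops"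
  by (intro compact_ops_compose_right compact_ops_compose_left p_bounded)

lemma diag_compact: "x \<in> compact_ops \<Longrightarrow> diag x \<in> compact_ops"
  unfolding diag_def by (intro compact_ops_sum compact_sandwich)

lemma diag_compact_sa: "x \<in> compact_sa_ops \<Longrightarrow> diag x \<in> compact_sa_ops"
  by (simp add: compact_sa_ops_eq diag_compact radj_diag)

lemma diag_compact_ah: "x \<in> compact_ah_ops \<Longrightarrow> diag x \<in> compact_ah_ops"
  using linear_simps(4)[OF bounded_linear_diag] by (simp add: compact_ah_ops_def diag_compact radj_diag)

lemma comm_inverse_compact_ah: "x \<in> compact_sa_ops \<Longrightarrow> comm_inverse x \<in> compact_ah_ops"
  unfolding compact_sa_ops_eq compact_ah_ops_def
  by (auto simp: radj_comm_inverse) (auto simp: comm_inverse_def intro!: compact_ops_sum compact_ops_scaleR compact_sandwich)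

lemma commutator_compact_sa:
  assumes x: "x \<in> compact_ah_ops"
  shows "commutator x A \<in> compact_sa_ops"
proof -
  have K: "x \<in> compact_ops" using x by (simp add: compact_ah_ops_def)
  have "commutator x A \<in> compact_ops"
    unfolding commutator_def
    by (rule compact_ops_diff[OF compact_ops_compose_right[OF A_bounded K] compact_ops_compose_left[OF A_bounded K]])
  then show ?thesis
    using x by (simp add: compact_sa_ops_eq compact_ah_ops_def commutator_def radj_diff A_radj compose_simps)
qed

text \<open>The tangent space of the orbit at \<open>A\<close>.\<close>

definition off_diag :: "('a \<Rightarrow>\<^sub>L 'a) set" where
  "off_diag = {f \<in> compact_sa_ops. diag f = 0}"

lemma subspace_off_diag: "subspace off_diag"
  using subspace_compact_sa_ops by (auto simp: off_diag_def subspace_def diag_simps)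

lemma closed_off_diag: "closed off_diag"
proof -
  have "off_diag = compact_sa_ops \<inter> {f. diag f = 0}" by (auto simp: off_diag_def)
  moreover have "closed {f. diag f = 0}"
    by (intro closed_Collect_eq continuous_intros linear_continuous_on bounded_linear_diag)
  ultimately show ?thesis using closed_compact_sa_ops by (metis closed_Int)
qed

lemma commutator_image: "(\<lambda>x. commutator x A) ` compact_ah_ops = off_diag"
proof (intro equalityI subsetI)
  fix f assume f: "f \<in> off_diag"
  then have "f = commutator (comm_inverse f) A" by (simp add: commutator_comm_inverse off_diag_def)
  moreover have "comm_inverse f \<in> compact_ah_ops" using f by (intro comm_inverse_compact_ah) (simp add: off_diag_def)
  ultimately show "f \<in> (\<lambda>x. commutator x A) ` compact_ah_ops" by blast
qed (auto simp: off_diag_def commutator_compact_sa)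

section \<open>The action on the orbit\<close>

lemma conj_A_diff:
  assumes u: "u \<in> unitary_fredholm"
  shows "(u o\<^sub>L A o\<^sub>L radj u) - A \<in> compact_sa_ops"
proof -
  note uD = unitary_fredholmD[OF u]
  have r: "radj u - id_blinfun \<in> compact_ops" by (rule unitary_fredholmD(3)[OF unitary_fredholm_radj[OF u]])
  have "(u o\<^sub>L A o\<^sub>L radj u) - A = ((u - id_blinfun) o\<^sub>L (A o\<^sub>L radj u)) + (A o\<^sub>L (radj u - id_blinfun))"
    by (simp add: compose_simps)
  also have "\<dots> \<in> compact_ops"
    by (intro compact_ops_add compact_ops_compose_left compact_ops_compose_right bounded_ops_compose
        A_bounded uD r)
  finally show ?thesis by (simp add: compact_sa_ops_eq radj_diff A_radj compose_assoc)
qed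

lemma conj_compact_sa:
  assumes u: "u \<in> unitary_fredholm" and k: "k \<in> compact_sa_ops"
  shows "u o\<^sub>L k o\<^sub>L radj u \<in> compact_sa_ops"
proof -
  have "u o\<^sub>L k o\<^sub>L radj u \<in> compact_ops"
    using k compact_ops_compose_right[OF unitary_fredholmD(2)[OF u] compact_ops_compose_left[OF unitary_fredholmD(1)[OF u]]]
    by (simp add: compact_sa_ops_eq)
  then show ?thesis using k by (simp add: compact_sa_ops_eq compose_assoc)
qed

lemma mem_orbit_space: "B \<in> orbit_space A \<longleftrightarrow> B - A \<in> compact_sa_ops"
proof
  assume "B - A \<in> compact_sa_ops"
  then have "A + (B - A) \<in> orbit_space A" unfolding orbit_space_def by (rule imageI)
  then show "B \<in> orbit_space A" by simp
next
  assume "B \<in> orbit_space A"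
  then obtain k where "k \<in> compact_sa_ops" "B = A + k" unfolding orbit_space_def by blast
  then show "B - A \<in> compact_sa_ops" by simp
qed

lemma direction_orbit_space: "direction (orbit_space A) = compact_sa_ops"
  unfolding orbit_space_def by (rule direction_translate[OF subspace_compact_sa_ops])

lemma conj_diff_mem:
  assumes u: "u \<in> unitary_fredholm" and B: "B - A \<in> compact_sa_ops"
  shows "(u o\<^sub>L B o\<^sub>L radj u) - A \<in> compact_sa_ops"
proof -
  have "(u o\<^sub>L B o\<^sub>L radj u) - A = (u o\<^sub>L (B - A) o\<^sub>L radj u) + ((u o\<^sub>L A o\<^sub>L radj u) - A)"
    by (simp add: compose_simps)
  then show ?thesis
    using conj_compact_sa[OF u B] conj_A_diff[OF u] subspace_add[OF subspace_compact_sa_ops] by metis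
qed

lemma unitary_orbit_eq: "unitary_orbit A = (\<lambda>u. u o\<^sub>L A o\<^sub>L radj u) ` unitary_fredholm"
  unfolding unitary_orbit_def by (intro image_cong refl) (rule orbit_map_eq)

lemma conj_mem_orbit:
  assumes u: "u \<in> unitary_fredholm" and B: "B \<in> unitary_orbit A"
  shows "u o\<^sub>L B o\<^sub>L radj u \<in> unitary_orbit A"
proof -
  obtain v where v: "v \<in> unitary_fredholm" "B = v o\<^sub>L A o\<^sub>L radj v" using B unitary_orbit_eq by auto
  have "u o\<^sub>L B o\<^sub>L radj u = (u o\<^sub>L v) o\<^sub>L A o\<^sub>L radj (u o\<^sub>L v)" by (simp add: v(2) compose_assoc)
  then show ?thesis unfolding unitary_orbit_eq using unitary_fredholm_compose[OF u v(1)] by (rule image_eqI)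
qed

lemma conj_mem_orbit_iff:
  assumes u: "u \<in> unitary_fredholm"
  shows "u o\<^sub>L B o\<^sub>L radj u \<in> unitary_orbit A \<longleftrightarrow> B \<in> unitary_orbit A"
proof
  assume "u o\<^sub>L B o\<^sub>L radj u \<in> unitary_orbit A"
  from conj_mem_orbit[OF unitary_fredholm_radj[OF u] this] show "B \<in> unitary_orbit A"
    by (simp add: compose_assoc unitary_fredholmD[OF u])
qed (rule conj_mem_orbit[OF u])

lemma orbit_subset: "unitary_orbit A \<subseteq> orbit_space A"
  by (auto simp: unitary_orbit_eq mem_orbit_space conj_A_diff)

text \<open>The spectral projections \<open>q b\<close> of a perturbation \<open>A + c\<close> in the orbit satisfy
  \<open>c p\<^sub>a q\<^sub>b = (b - a) p\<^sub>a q\<^sub>b\<close>. If \<open>c\<close> is smaller than all gaps, this forces \<open>p\<^sub>a q\<^sub>b = 0\<close> for \<open>a \<noteq> b\<close>.\<close>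

lemma commuting_perturbation_in_orbit:
  assumes d: "\<And>a b. a \<in> L \<Longrightarrow> b \<in> L \<Longrightarrow> a \<noteq> b \<Longrightarrow> d \<le> \<bar>a - b\<bar>" and c: "norm c < d" "diag c = c"
    and orb: "A + c \<in> unitary_orbit A"
  shows "c = 0"
proof -
  obtain w where w: "w \<in> unitary_fredholm" "A + c = w o\<^sub>L A o\<^sub>L radj w" using orb unitary_orbit_eq by auto
  note wD = unitary_fredholmD[OF w(1)]
  define q where "q b = w o\<^sub>L p b o\<^sub>L radj w" for b
  have sum_q: "(\<Sum>b\<in>L. q b) = id_blinfun"
  proof -
    have "(\<Sum>b\<in>L. q b) = w o\<^sub>L (\<Sum>b\<in>L. p b) o\<^sub>L radj w" by (simp add: q_def compose_simps)
    then show ?thesis by (simp add: sum_p wD)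
  qed
  have eig: "(A + c) o\<^sub>L q b = b *\<^sub>R q b" if b: "b \<in> L" for b
  proof -
    have "(A + c) o\<^sub>L q b = w o\<^sub>L (A o\<^sub>L p b) o\<^sub>L radj w"
      unfolding w(2) q_def by (simp only: compose_assoc wD(6))
    then show ?thesis by (simp add: A_p[OF b] q_def compose_simps)
  qed
  have comm: "p a o\<^sub>L c = c o\<^sub>L p a" if a: "a \<in> L" for a
  proof -
    have l: "p a o\<^sub>L diag c = p a o\<^sub>L c o\<^sub>L p a"
    proof -
      have "p a o\<^sub>L diag c = (\<Sum>b\<in>L. if b = a then p a o\<^sub>L c o\<^sub>L p a else 0)"
        unfolding diag_def compose_simps by (intro sum.cong refl) (use a in \<open>auto simp: p_p_left\<close>)
      then show ?thesis using a finite_L by simp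
    qed
    have r: "diag c o\<^sub>L p a = p a o\<^sub>L c o\<^sub>L p a"
    proof -
      have "diag c o\<^sub>L p a = (\<Sum>b\<in>L. if b = a then p a o\<^sub>L c o\<^sub>L p a else 0)"
        unfolding diag_def compose_simps by (intro sum.cong refl) (use a in \<open>auto simp: p_p\<close>)
      then show ?thesis using a finite_L by simp
    qed
    show ?thesis using l r c(2) by simp
  qed
  have entry: "c o\<^sub>L (p a o\<^sub>L q b) = (b - a) *\<^sub>R (p a o\<^sub>L q b)" if ab: "a \<in> L" "b \<in> L" for a b
  proof -
    have "b *\<^sub>R (p a o\<^sub>L q b) = p a o\<^sub>L ((A + c) o\<^sub>L q b)"
      unfolding eig[OF ab(2)] by (simp add: compose_simps)
    also have "\<dots> = a *\<^sub>R (p a o\<^sub>L q b) + (p a o\<^sub>L c o\<^sub>L q b)"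
      using p_A_left[OF ab(1), of "q b"] by (simp add: compose_simps)
    also have "p a o\<^sub>L c o\<^sub>L q b = c o\<^sub>L (p a o\<^sub>L q b)" unfolding comm[OF ab(1)] by (rule compose_assoc)
    finally show ?thesis by (simp add: scaleR_diff_left)
  qed
  have zero: "p a o\<^sub>L q b = 0" if ab: "a \<in> L" "b \<in> L" "a \<noteq> b" for a b
  proof (rule ccontr)
    assume nz: "p a o\<^sub>L q b \<noteq> 0"
    have "\<bar>b - a\<bar> * norm (p a o\<^sub>L q b) \<le> norm c * norm (p a o\<^sub>L q b)"
      using norm_blinfun_compose[of c "p a o\<^sub>L q b"] by (simp add: entry[OF ab(1,2)])
    then have "\<bar>b - a\<bar> \<le> norm c" using nz by simp
    then show False using d[OF ab(1,2,3)] c(1) by linarith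
  qed
  have "c o\<^sub>L p a = 0" if a: "a \<in> L" for a
  proof -
    have "p a = p a o\<^sub>L (\<Sum>b\<in>L. q b)" by (simp add: sum_q)
    also have "\<dots> = (\<Sum>b\<in>L. if b = a then p a o\<^sub>L q a else 0)"
      unfolding compose_simps by (intro sum.cong refl) (use a zero in auto)
    also have "\<dots> = p a o\<^sub>L q a" using a finite_L by simp
    finally have "c o\<^sub>L p a = c o\<^sub>L (p a o\<^sub>L q a)" by simp
    then show ?thesis using entry[OF a a] by simp
  qed
  then have "(\<Sum>a\<in>L. c o\<^sub>L p a) = 0" by simp
  then have "c o\<^sub>L (\<Sum>a\<in>L. p a) = 0" by (simp only: compose_simps)
  then show "c = 0" by (simp add: sum_p)
qed

lemma gap_exists: "\<exists>d>0. \<forall>a\<in>L. \<forall>b\<in>L. a \<noteq> b \<longrightarrow> d \<le> \<bar>a - b\<bar>"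
proof -
  define S where "S = insert 1 ((\<lambda>(a, b). \<bar>a - b\<bar>) ` ((L \<times> L) - Id))"
  have S: "finite S" "S \<noteq> {}" using finite_L by (simp_all add: S_def)
  have "Min S > 0" using S by (subst Min_gr_iff) (auto simp: S_def)
  moreover have "Min S \<le> \<bar>a - b\<bar>" if "a \<in> L" "b \<in> L" "a \<noteq> b" for a b
    using that by (intro Min_le S) (force simp: S_def)
  ultimately show ?thesis by blast
qed

section \<open>Charts of the orbit\<close>

definition half_inverse :: "('a \<Rightarrow>\<^sub>L 'a) \<Rightarrow> ('a \<Rightarrow>\<^sub>L 'a)" where
  "half_inverse y = (- 1 / 2) *\<^sub>R comm_inverse y"

text \<open>The inverse of the chart at \<open>A\<close>: the off-diagonal part of \<open>y\<close> moves along the orbit, by a unitary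
  operator that depends rationally on \<open>y\<close>, and the diagonal part moves transversally. The factor in
  \<^const>\<open>half_inverse\<close> compensates for the derivative \<open>-2\<close> of the Cayley transform at zero.\<close>

definition orbit_param :: "('a \<Rightarrow>\<^sub>L 'a) \<Rightarrow> ('a \<Rightarrow>\<^sub>L 'a)" where
  "orbit_param y = cayley_conj (half_inverse y) (A + diag y)"

definition orbit_param_deriv :: "('a \<Rightarrow>\<^sub>L 'a) \<Rightarrow> ('a \<Rightarrow>\<^sub>L 'a) \<Rightarrow>\<^sub>L ('a \<Rightarrow>\<^sub>L 'a)" where
  "orbit_param_deriv y = (cayley_conj_deriv (half_inverse y) (A + diag y) o\<^sub>L Blinfun half_inverse)
     + (lmul (cayley (half_inverse y)) o\<^sub>L rmul (cayley (- half_inverse y)) o\<^sub>L Blinfun diag)"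

lemma bounded_linear_half_inverse: "bounded_linear half_inverse"
  unfolding half_inverse_def
  by (rule bounded_linear_compose[OF bounded_linear_scaleR_right bounded_linear_comm_inverse])

lemma half_inverse_0 [simp]: "half_inverse 0 = 0"
  by (rule linear_simps(3)[OF bounded_linear_half_inverse])

lemma half_inverse_compact_ah: "y \<in> compact_sa_ops \<Longrightarrow> half_inverse y \<in> compact_ah_ops"
  unfolding half_inverse_def by (intro subspace_scale[OF subspace_compact_ah_ops] comm_inverse_compact_ah)

lemma orbit_param_0 [simp]: "orbit_param 0 = A"
  by (simp add: orbit_param_def cayley_conj_def diag_simps)

text \<open>Off the diagonal this is the identity \<open>[comm_inverse h, A] = h - diag h\<close>.\<close>

lemma orbit_param_deriv_0: "orbit_param_deriv 0 = id_blinfun"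
proof (rule blinfun_eqI)
  fix h
  have "orbit_param_deriv 0 h = 2 *\<^sub>R ((A o\<^sub>L half_inverse h) - (half_inverse h o\<^sub>L A)) + diag h"
    by (simp add: orbit_param_deriv_def cayley_conj_deriv_def diag_simps blinfun.add_left blinfun.diff_left
        bounded_linear_Blinfun_apply bounded_linear_half_inverse bounded_linear_diag compose_simps scaleR_diff_right)
  also have "2 *\<^sub>R ((A o\<^sub>L half_inverse h) - (half_inverse h o\<^sub>L A)) = commutator (comm_inverse h) A"
    by (simp add: half_inverse_def commutator_def compose_simps scaleR_diff_right)
  finally show "orbit_param_deriv 0 h = id_blinfun h" by (simp add: commutator_comm_inverse)
qed

abbreviation orbit_domain :: "('a \<Rightarrow>\<^sub>L 'a) set" where
  "orbit_domain \<equiv> {y. half_inverse y \<in> cayley_domain}"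

lemma orbit_param_has_derivative:
  assumes y: "y \<in> orbit_domain"
  shows "(orbit_param has_derivative orbit_param_deriv y) (at y)"
proof -
  have "((\<lambda>y. A + diag y) has_derivative diag) (at y)"
    using bounded_linear_imp_has_derivative[OF bounded_linear_diag] by (auto intro!: derivative_eq_intros)
  then have "((\<lambda>y. cayley_conj (half_inverse y) (A + diag y)) has_derivative
      (\<lambda>h. cayley_conj_deriv (half_inverse y) (A + diag y) (half_inverse h)
        + (cayley (half_inverse y) o\<^sub>L diag h o\<^sub>L cayley (- half_inverse y)))) (at y)"
    using y by (intro cayley_conj_has_derivative bounded_linear_imp_has_derivative bounded_linear_half_inverse) auto
  then have "(orbit_param has_derivative
      (\<lambda>h. cayley_conj_deriv (half_inverse y) (A + diag y) (half_inverse h)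
        + (cayley (half_inverse y) o\<^sub>L diag h o\<^sub>L cayley (- half_inverse y)))) (at y)"
    by (simp only: orbit_param_def[abs_def])
  then show ?thesis
    by (rule has_derivative_eq_rhs)
      (simp add: fun_eq_iff orbit_param_deriv_def blinfun.add_left compose_assoc
        bounded_linear_Blinfun_apply bounded_linear_half_inverse bounded_linear_diag)
qed

lemma rat_orbit_param_deriv:
  assumes f: "lrat U G f" and dom: "\<And>z. z \<in> U \<Longrightarrow> f z \<in> orbit_domain"
  shows "rat U G {} (\<lambda>z vs. orbit_param_deriv (f z))"
proof -
  have h: "lrat U G (\<lambda>z. half_inverse (f z))" by (rule lrat_linear[OF bounded_linear_half_inverse f])
  have m: "lrat U G (\<lambda>z. - half_inverse (f z))" by (rule lrat_linear[OF bounded_linear_minus[OF bounded_linear_ident] h])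
  have Z: "lrat U G (\<lambda>z. A + diag (f z))" by (intro lrat_add lrat_const lrat_linear[OF bounded_linear_diag f])
  have c: "lrat U G (\<lambda>z. cayley (half_inverse (f z)))" by (rule lrat_cayley[OF h]) (use dom in auto)
  have c': "lrat U G (\<lambda>z. cayley (- half_inverse (f z)))" by (rule lrat_cayley[OF m]) (use dom in auto)
  show ?thesis
    unfolding orbit_param_deriv_def
    by (intro rat_add rat_compose rat_const rat_lmul rat_rmul rat_cayley_conj_deriv h Z c c') (use dom in auto)
qed

lemma lrat_orbit_param:
  assumes f: "lrat U G f" and dom: "\<And>z. z \<in> U \<Longrightarrow> f z \<in> orbit_domain"
  shows "lrat U G (\<lambda>z. orbit_param (f z))"
proof -
  have h: "lrat U G (\<lambda>z. half_inverse (f z))" by (rule lrat_linear[OF bounded_linear_half_inverse f])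
  have m: "lrat U G (\<lambda>z. - half_inverse (f z))" by (rule lrat_linear[OF bounded_linear_minus[OF bounded_linear_ident] h])
  have Z: "lrat U G (\<lambda>z. A + diag (f z))" by (intro lrat_add lrat_const lrat_linear[OF bounded_linear_diag f])
  have c: "lrat U G (\<lambda>z. cayley (half_inverse (f z)))" by (rule lrat_cayley[OF h]) (use dom in auto)
  have c': "lrat U G (\<lambda>z. cayley (- half_inverse (f z)))" by (rule lrat_cayley[OF m]) (use dom in auto)
  show ?thesis unfolding orbit_param_def cayley_conj_def by (intro lrat_compose c c' Z)
qed

lemma orbit_domain_properties: "open orbit_domain" "0 \<in> orbit_domain"
proof -
  have "open (half_inverse -` cayley_domain)"
    by (intro open_vimage open_cayley_domain linear_continuous_on bounded_linear_half_inverse)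
  then show "open orbit_domain" by (simp add: vimage_def)
  show "0 \<in> orbit_domain" by simp
qed

lemma continuous_on_orbit_param_deriv: "continuous_on orbit_domain orbit_param_deriv"
proof -
  have h: "continuous_on S half_inverse" for S by (rule linear_continuous_on[OF bounded_linear_half_inverse])
  have Z: "continuous_on S (\<lambda>y. A + diag y)" for S
    by (intro continuous_intros linear_continuous_on bounded_linear_diag)
  have c: "continuous_on orbit_domain (\<lambda>y. cayley (half_inverse y))"
    by (rule continuous_on_compose2[OF continuous_on_cayley h]) auto
  have c': "continuous_on orbit_domain (\<lambda>y. cayley (- half_inverse y))"
    by (rule continuous_on_compose2[OF continuous_on_cayley continuous_on_minus[OF h]]) auto
  show ?thesis
    unfolding orbit_param_deriv_def
    by (intro continuous_intros bounded_linear.continuous_on[OF bounded_linear_lmul]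
        bounded_linear.continuous_on[OF bounded_linear_rmul] continuous_on_cayley_conj_deriv c c' h Z) auto
qed

text \<open>On self-adjoint arguments \<^const>\<open>orbit_param\<close> conjugates \<open>A + diag y\<close> by an element of the unitary
  Fredholm group.\<close>

lemma orbit_param_mem:
  assumes y: "y \<in> compact_sa_ops" "y \<in> orbit_domain"
  shows "orbit_param y - A \<in> compact_sa_ops"
    and "orbit_param y \<in> unitary_orbit A \<longleftrightarrow> A + diag y \<in> unitary_orbit A"
proof -
  let ?u = "cayley (half_inverse y)"
  have h: "half_inverse y \<in> compact_ah_ops" by (rule half_inverse_compact_ah[OF y(1)])
  have u: "?u \<in> unitary_fredholm" "radj ?u = cayley (- half_inverse y)"
    using cayley_unitary_fredholm[OF h] y(2) by auto
  have eq: "orbit_param y = ?u o\<^sub>L (A + diag y) o\<^sub>L radj ?u"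
    by (simp add: orbit_param_def cayley_conj_def u(2))
  show "orbit_param y - A \<in> compact_sa_ops"
    unfolding eq using diag_compact_sa[OF y(1)] by (intro conj_diff_mem[OF u(1)]) simp
  show "orbit_param y \<in> unitary_orbit A \<longleftrightarrow> A + diag y \<in> unitary_orbit A"
    unfolding eq by (rule conj_mem_orbit_iff[OF u(1)])
qed

end

section \<open>The inverse of the parametrization\<close>

lemma bounded_bilinear_lmul_apply:
  "bounded_bilinear (\<lambda>(T :: 'b::real_normed_vector \<Rightarrow>\<^sub>L ('a::real_normed_vector \<Rightarrow>\<^sub>L 'a)) h.
     lmul (blinfun_apply T h))"
proof
  have "norm (lmul (blinfun_apply T h)) \<le> norm T * norm h * 1" for T :: "'b \<Rightarrow>\<^sub>L ('a \<Rightarrow>\<^sub>L 'a)" and h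
  proof -
    have "norm (lmul (blinfun_apply T h)) \<le> norm (blinfun_apply T h)"
      by (rule norm_blinfun_bound) (simp_all add: norm_blinfun_compose)
    then show ?thesis using norm_blinfun[of T h] by simp
  qed
  then show "\<exists>K. \<forall>T h. norm (lmul (blinfun_apply T h) :: ('a \<Rightarrow>\<^sub>L 'a) \<Rightarrow>\<^sub>L ('a \<Rightarrow>\<^sub>L 'a)) \<le> norm T * norm (h :: 'b) * K"
    by blast
qed (simp_all add: blinfun.bilinear_simps linear_simps[OF bounded_linear_lmul])

text \<open>The function \<open>g\<close> is the local inverse of \<^const>\<open>finite_resolution.orbit_param\<close>, up to the shift by
  \<open>A\<close>. The last assumption says that near \<open>A\<close> the orbit has no diagonal part in this chart.\<close>

locale orbit_chart = finite_resolution +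
  fixes r :: real and g :: "('a \<Rightarrow>\<^sub>L 'a) \<Rightarrow> ('a \<Rightarrow>\<^sub>L 'a)"
  assumes r_pos: "r > 0"
    and domain: "\<And>y. norm y < r \<Longrightarrow> y \<in> orbit_domain" "\<And>y. norm y < r \<Longrightarrow> invertible_op (orbit_param_deriv y)"
    and g: "\<And>z. z \<in> compact_sa_ops \<Longrightarrow> norm z < r / 2 \<Longrightarrow> g z \<in> compact_sa_ops"
      "\<And>z. z \<in> compact_sa_ops \<Longrightarrow> norm z < r / 2 \<Longrightarrow> norm (g z) < r"
      "\<And>z. z \<in> compact_sa_ops \<Longrightarrow> norm z < r / 2 \<Longrightarrow> orbit_param (g z) = A + z"
    and g_orbit_param: "\<And>y. y \<in> compact_sa_ops \<Longrightarrow> norm y < r \<Longrightarrow> norm (orbit_param y - A) < r / 2 \<Longrightarrow>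
      g (orbit_param y - A) = y"
    and g_has_derivative: "\<And>z. z \<in> compact_sa_ops \<Longrightarrow> norm z < r / 2 \<Longrightarrow>
      (g has_derivative inv_op (orbit_param_deriv (g z))) (at z within {z \<in> compact_sa_ops. norm z < r / 2})"
    and diag_eq_0: "\<And>y. y \<in> compact_sa_ops \<Longrightarrow> norm y < r \<Longrightarrow> orbit_param y \<in> unitary_orbit A \<Longrightarrow> diag y = 0"

context finite_resolution
begin

text \<open>The inverse function theorem at zero, relative to the closed subspace of self-adjoint compact
  operators. The bound \<open>d / K\<close> on the radius keeps the diagonal part below the gaps between the eigenvalues.\<close>

lemma orbit_chart_exists: "\<exists>r g. orbit_chart A L p r g"
proof -
  obtain d where d: "d > 0" "\<And>a b. a \<in> L \<Longrightarrow> b \<in> L \<Longrightarrow> a \<noteq> b \<Longrightarrow> d \<le> \<bar>a - b\<bar>"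
    using gap_exists by blast
  have "continuous (at 0) orbit_param_deriv"
    using continuous_on_orbit_param_deriv orbit_domain_properties continuous_on_eq_continuous_at by blast
  then obtain r1 where r1: "r1 > 0" "\<And>y. norm y < r1 \<Longrightarrow> norm (orbit_param_deriv y - id_blinfun) < 1 / 2"
    unfolding continuous_at_eps_delta dist_norm orbit_param_deriv_0
    by (metis diff_zero half_gt_zero zero_less_one)
  obtain r2 where r2: "r2 > 0" "ball 0 r2 \<subseteq> orbit_domain"
    using orbit_domain_properties open_contains_ball by blast
  obtain K where K: "K > 0" "\<And>x. norm (diag x) \<le> norm x * K"
    using bounded_linear.pos_bounded[OF bounded_linear_diag] by blast
  define r where "r = Min {r1, r2, d / K}"
  have r: "r > 0" "r \<le> r1" "r \<le> r2" "r \<le> d / K" using r1 r2 d K by (auto simp: r_def)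
  have dom: "y \<in> orbit_domain" if "norm y < r" for y
  proof -
    have "y \<in> ball 0 r2" using that r by simp
    then show ?thesis using r2(2) by blast
  qed
  have near: "norm (orbit_param_deriv y - id_blinfun) \<le> 1 / 2" if "norm y < r" for y
    using r1(2)[of y] that r by simp
  have inv: "invertible_op (orbit_param_deriv y)" if "norm y < r" for y
    using invertible_one_minus[of "id_blinfun - orbit_param_deriv y"] near[OF that]
    by (simp add: norm_minus_commute)
  define N where "N y = orbit_param y - A - y" for y
  have N: "y + N y = orbit_param y - A" for y by (simp add: N_def)
  have N_deriv: "(N has_derivative (orbit_param_deriv y - id_blinfun)) (at y)" if "norm y < r" for y
  proof -
    have "(N has_derivative (\<lambda>h. orbit_param_deriv y h - 0 - h)) (at y)"
      unfolding N_def[abs_def]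
      by (intro has_derivative_diff orbit_param_has_derivative[OF dom[OF that]] has_derivative_const has_derivative_ident)
    then show ?thesis by (rule has_derivative_eq_rhs) (simp add: fun_eq_iff blinfun.diff_left)
  qed
  have N_deriv': "(N has_derivative (orbit_param_deriv y - id_blinfun)) (at y within ball 0 r)"
    if "y \<in> ball 0 r" for y
  proof -
    have "norm y < r" using that by simp
    then show ?thesis by (rule has_derivative_at_withinI[OF N_deriv])
  qed
  have N_onorm: "onorm (orbit_param_deriv y - id_blinfun) \<le> 1 / 2" if "y \<in> ball 0 r" for y
    using near[of y] that by (simp add: norm_blinfun.rep_eq)
  have lip: "norm (N x - N y) \<le> 1 / 2 * norm (x - y)" if x: "norm x < r" and y: "norm y < r" for x y
  proof -
    have xy: "x \<in> ball 0 r" "y \<in> ball 0 r" using x y by simp_all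
    show ?thesis
      by (rule differentiable_bound[where S = "ball 0 r" and x = x and y = y
            and f' = "\<lambda>y. blinfun_apply (orbit_param_deriv y - id_blinfun)",
            OF convex_ball N_deriv' N_onorm xy])
  qed
  have NV: "N y \<in> compact_sa_ops" if "y \<in> compact_sa_ops" "norm y < r" for y
    unfolding N_def
    by (intro subspace_diff[OF subspace_compact_sa_ops] orbit_param_mem(1)[OF that(1) dom[OF that(2)]] that(1))
  have ex: "\<exists>y\<in>compact_sa_ops. norm y < r \<and> y + N y = z" if "z \<in> compact_sa_ops" "norm z < r / 2" for z
    by (rule perturbation_inverse[OF subspace_compact_sa_ops closed_compact_sa_ops r(1) _ NV lip that])
      (simp add: N_def)
  define g where "g z = (SOME y. y \<in> compact_sa_ops \<and> norm y < r \<and> y + N y = z)" for z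
  have g: "g z \<in> compact_sa_ops \<and> norm (g z) < r \<and> g z + N (g z) = z"
    if "z \<in> compact_sa_ops" "norm z < r / 2" for z
  proof -
    have "\<exists>y. y \<in> compact_sa_ops \<and> norm y < r \<and> y + N y = z" using ex[OF that] by blast
    then show ?thesis unfolding g_def by (rule someI_ex)
  qed
  have expand: "norm (x - y) \<le> 2 * norm ((x + N x) - (y + N y))" if "norm x < r" "norm y < r" for x y
    by (rule perturbation_expands[OF lip[OF that]])
  show ?thesis
  proof (intro exI[of _ r] exI[of _ g], unfold_locales)
    show "r > 0" by (rule r(1))
    show "y \<in> orbit_domain" "invertible_op (orbit_param_deriv y)" if "norm y < r" for y
      using dom[OF that] inv[OF that] by blast+
  next
    fix z :: "'a \<Rightarrow>\<^sub>L 'a" assume z: "z \<in> compact_sa_ops" "norm z < r / 2"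
    show "g z \<in> compact_sa_ops" "norm (g z) < r" "orbit_param (g z) = A + z"
      using g[OF z] N[of "g z"] by (auto simp: algebra_simps)
    show "(g has_derivative inv_op (orbit_param_deriv (g z))) (at z within {z \<in> compact_sa_ops. norm z < r / 2})"
    proof (rule has_derivative_of_right_inverse[where f = "\<lambda>y. y + N y"])
      have "((\<lambda>y. orbit_param y - A) has_derivative (\<lambda>h. orbit_param_deriv (g z) h - 0)) (at (g z))"
        by (intro has_derivative_diff orbit_param_has_derivative[OF dom] has_derivative_const) (use g[OF z] in simp)
      then show "((\<lambda>y. y + N y) has_derivative orbit_param_deriv (g z)) (at (g z))" by (simp add: N)
      show "invertible_op (orbit_param_deriv (g z))" using inv g[OF z] by blast
      show "norm (g w - g z) \<le> 2 * norm (w - z)" if "w \<in> {z \<in> compact_sa_ops. norm z < r / 2}" for w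
        using expand[of "g w" "g z"] g[OF z] g[of w] that by simp
    qed (use z g in auto)
  next
    fix y assume y: "y \<in> compact_sa_ops" "norm y < r" "norm (orbit_param y - A) < r / 2"
    have gy: "g (orbit_param y - A) \<in> compact_sa_ops" "norm (g (orbit_param y - A)) < r"
        "g (orbit_param y - A) + N (g (orbit_param y - A)) = orbit_param y - A"
      using g[OF orbit_param_mem(1)[OF y(1) dom[OF y(2)]] y(3)] by auto
    then show "g (orbit_param y - A) = y" using expand[OF gy(2) y(2)] N[of y] by simp
  next
    fix y assume y: "y \<in> compact_sa_ops" "norm y < r" "orbit_param y \<in> unitary_orbit A"
    have "norm (diag y) \<le> norm y * K" by (rule K)
    also have "\<dots> < d / K * K" using y(2) r(4) K(1) by (intro mult_strict_right_mono) auto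
    finally have "norm (diag y) < d" using K(1) by simp
    then show "diag y = 0"
      using commuting_perturbation_in_orbit[OF d(2)] orbit_param_mem(2)[OF y(1) dom[OF y(2)]] y(3) by simp
  qed
qed

end

context orbit_chart
begin

abbreviation W :: "('a \<Rightarrow>\<^sub>L 'a) set" where
  "W \<equiv> {z \<in> compact_sa_ops. norm z < r / 2}"

text \<open>The composition satisfies a differential equation whose right hand side is rational in it and in
  the derivative of \<open>P\<close>.\<close>

lemma smooth_on_g_comp:
  assumes P: "\<And>x. x \<in> U \<Longrightarrow> P x \<in> W"
    and Q: "\<And>x. x \<in> U \<Longrightarrow> (P has_derivative blinfun_apply (Q x)) (at x within U)"
    and rat_Q: "rat U {lmul} {} (\<lambda>z vs. Q z)"
  shows "smooth_on V U (\<lambda>z. g (P z))"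
proof -
  define G where "G = {lmul, \<lambda>z. lmul (g (P z))}"
  have lrat: "lrat U G (\<lambda>z. g (P z))" unfolding lrat_def G_def by (rule rat_base) simp
  have "differentially_closed U G"
    unfolding differentially_closed_def
  proof
    fix b assume "b \<in> G"
    then consider "b = lmul" | "b = (\<lambda>z. lmul (g (P z)))" by (auto simp: G_def)
    then show "\<exists>m \<gamma>. rat U G {} (\<lambda>z vs. m z) \<and> bounded_bilinear \<gamma> \<and>
        (\<forall>z\<in>U. (b has_derivative (\<lambda>h. \<gamma> (m z) h)) (at z within U))"
    proof cases
      case 1
      obtain m \<gamma> where "rat U {lmul} {} (\<lambda>z vs. m z)" "bounded_bilinear \<gamma>"
          "\<forall>z\<in>U. (lmul has_derivative (\<lambda>h. \<gamma> (m z) h)) (at z within U)"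
        using differentially_closed_linear[OF bounded_linear_lmul, of U]
        unfolding differentially_closed_def by blast
      moreover from this(1) have "rat U G {} (\<lambda>z vs. m z)" by (rule rat_mono) (simp add: G_def)
      ultimately show ?thesis using 1 by blast
    next
      case 2
      define m where "m z = inv_op (orbit_param_deriv (g (P z))) o\<^sub>L Q z" for z
      have "rat U G {} (\<lambda>z vs. m z)"
        unfolding m_def
      proof (intro rat_compose rat_inv_op rat_orbit_param_deriv lrat)
        show "rat U G {} (\<lambda>z vs. Q z)" by (rule rat_mono[OF rat_Q]) (simp add: G_def)
      qed (use domain g P in auto)
      moreover have "(b has_derivative (\<lambda>h. lmul (m z h))) (at z within U)" if z: "z \<in> U" for z
      proof -
        have "(g has_derivative inv_op (orbit_param_deriv (g (P z)))) (at (P z) within P ` U)"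
          by (rule has_derivative_subset[OF g_has_derivative]) (use P z in auto)
        from has_derivative_in_compose[OF Q[OF z] this]
        have "((\<lambda>z. g (P z)) has_derivative (\<lambda>h. m z h)) (at z within U)" by (simp add: m_def)
        from bounded_linear.has_derivative[OF bounded_linear_lmul this] show ?thesis by (simp add: 2)
      qed
      ultimately show ?thesis using bounded_bilinear_lmul_apply by blast
    qed
  qed
  moreover have "bounded_linear (\<lambda>T :: ('a \<Rightarrow>\<^sub>L 'a) \<Rightarrow>\<^sub>L ('a \<Rightarrow>\<^sub>L 'a). T id_blinfun)"
    by (rule bounded_linear_apply_blinfun)
  ultimately have "smooth_on V U (\<lambda>z. lmul (g (P z)) id_blinfun)"
    by (rule rat_smooth_on[OF _ rat_lmul[OF lrat]])
  then show ?thesis by simp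
qed

lemma conj_unitary:
  assumes u: "u \<in> unitary_fredholm" and B: "B - A \<in> compact_sa_ops"
  shows "(radj u o\<^sub>L B o\<^sub>L u) - A \<in> compact_sa_ops"
  using conj_diff_mem[OF unitary_fredholm_radj[OF u] B] by simp

text \<open>Conjugation by \<open>u\<close> preserves the orbit and its affine space, so a chart at \<open>A\<close> is carried to all points
  of the orbit.\<close>

lemma orbit_submanifold_chart:
  fixes u :: "'a \<Rightarrow>\<^sub>L 'a"
  assumes u: "u \<in> unitary_fredholm"
  defines "U \<equiv> {B \<in> orbit_space A. norm ((radj u o\<^sub>L B o\<^sub>L u) - A) < r / 2}"
    and "\<phi> \<equiv> \<lambda>B. g ((radj u o\<^sub>L B o\<^sub>L u) - A)"
  shows "submanifold_chart (orbit_space A) (unitary_orbit A) (u o\<^sub>L A o\<^sub>L radj u) U \<phi> off_diag"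
proof -
  note uD = unitary_fredholmD[OF u]
  have cancel: "radj u o\<^sub>L (u o\<^sub>L B o\<^sub>L radj u) o\<^sub>L u = B" "u o\<^sub>L (radj u o\<^sub>L B o\<^sub>L u) o\<^sub>L radj u = B" for B
    by (simp_all add: compose_assoc uD)
  define \<kappa> where "\<kappa> y = u o\<^sub>L orbit_param y o\<^sub>L radj u" for y
  have W: "(radj u o\<^sub>L B o\<^sub>L u) - A \<in> W" if "B \<in> U" for B
    using that conj_unitary[OF u] by (simp add: U_def mem_orbit_space)
  have \<phi>: "\<phi> B \<in> compact_sa_ops" "norm (\<phi> B) < r" "orbit_param (\<phi> B) = radj u o\<^sub>L B o\<^sub>L u" if "B \<in> U" for B
    using W[OF that] g[of "(radj u o\<^sub>L B o\<^sub>L u) - A"] by (simp_all add: \<phi>_def)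
  have \<kappa>\<phi>: "\<kappa> (\<phi> B) = B" if "B \<in> U" for B using \<phi>(3)[OF that] by (simp add: \<kappa>_def cancel)
  have inj: "inj_on \<phi> U" by (metis \<kappa>\<phi> inj_on_def)
  define \<Omega> where "\<Omega> = {y. norm y < r \<and> norm (orbit_param y - A) < r / 2}"
  have \<Omega>: "\<kappa> y \<in> U \<and> \<phi> (\<kappa> y) = y" if "y \<in> compact_sa_ops" "y \<in> \<Omega>" for y
  proof
    have "orbit_param y - A \<in> compact_sa_ops" using that domain orbit_param_mem(1) by (simp add: \<Omega>_def)
    then show "\<kappa> y \<in> U"
      using that conj_diff_mem[OF u] by (simp add: U_def mem_orbit_space \<kappa>_def cancel \<Omega>_def)
    show "\<phi> (\<kappa> y) = y" using that g_orbit_param by (simp add: \<phi>_def \<kappa>_def cancel \<Omega>_def)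
  qed
  have image: "\<phi> ` U = compact_sa_ops \<inter> \<Omega>"
  proof (intro equalityI subsetI)
    fix y assume "y \<in> \<phi> ` U"
    then obtain B where B: "B \<in> U" "y = \<phi> B" by blast
    then show "y \<in> compact_sa_ops \<inter> \<Omega>" using \<phi>[OF B(1)] by (simp add: \<Omega>_def U_def)
  next
    fix y assume "y \<in> compact_sa_ops \<inter> \<Omega>"
    then show "y \<in> \<phi> ` U" using \<Omega>[of y] by (metis IntE imageI)
  qed
  have inv: "inv_into U \<phi> y = \<kappa> y" if "y \<in> \<phi> ` U" for y
    using that inj \<kappa>\<phi> by (auto simp: inv_into_f_f)
  have conj: "bounded_linear (\<lambda>B. radj u o\<^sub>L B o\<^sub>L u)" by (rule bounded_linear_sandwich)
  show ?thesis
    unfolding submanifold_chart_def direction_orbit_space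
  proof (intro conjI inj subspace_off_diag closed_off_diag)
    have "open {B. norm ((radj u o\<^sub>L B o\<^sub>L u) - A) < r / 2}"
      by (intro open_Collect_less continuous_intros linear_continuous_on conj)
    then have "openin (top_of_set (orbit_space A)) (orbit_space A \<inter> {B. norm ((radj u o\<^sub>L B o\<^sub>L u) - A) < r / 2})"
      by (rule openin_open_Int)
    then show "openin (top_of_set (orbit_space A)) U" by (simp add: U_def Int_def)
    show "u o\<^sub>L A o\<^sub>L radj u \<in> U"
      using conj_A_diff[OF u] r_pos by (simp add: U_def mem_orbit_space cancel)
    have "continuous_on (ball 0 r) orbit_param"
    proof (rule continuous_at_imp_continuous_on, rule ballI)
      fix y :: "'a \<Rightarrow>\<^sub>L 'a" assume "y \<in> ball 0 r"
      then have "norm y < r" by simp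
      then show "isCont orbit_param y"
        by (rule has_derivative_continuous[OF orbit_param_has_derivative[OF domain(1)]])
    qed
    then have "continuous_on (ball 0 r) (\<lambda>y. norm (orbit_param y - A))" by (intro continuous_intros)
    then have "open (ball 0 r \<inter> (\<lambda>y. norm (orbit_param y - A)) -` {..<r / 2})"
      by (rule continuous_open_preimage) auto
    moreover have "\<Omega> = ball 0 r \<inter> (\<lambda>y. norm (orbit_param y - A)) -` {..<r / 2}"
      by (auto simp: \<Omega>_def)
    ultimately have "open \<Omega>" by simp
    then show "openin (top_of_set compact_sa_ops) (\<phi> ` U)" unfolding image by (rule openin_open_Int)
    show "smooth_on compact_sa_ops U \<phi>"
      unfolding \<phi>_def
    proof (rule smooth_on_g_comp[OF W])
      fix B
      have "((\<lambda>B. (radj u o\<^sub>L B o\<^sub>L u) - A) has_derivative (\<lambda>h. (radj u o\<^sub>L h o\<^sub>L u) - 0)) (at B within U)"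
        by (intro has_derivative_diff bounded_linear_imp_has_derivative conj has_derivative_const)
      then show "((\<lambda>B. (radj u o\<^sub>L B o\<^sub>L u) - A) has_derivative (lmul (radj u) o\<^sub>L rmul u)) (at B within U)"
        by (rule has_derivative_eq_rhs) (simp add: fun_eq_iff compose_assoc)
      show "rat U {lmul} {} (\<lambda>z vs. lmul (radj u) o\<^sub>L rmul u)" by (rule rat_const)
    qed
    have "smooth_on compact_sa_ops (\<phi> ` U) \<kappa>"
    proof -
      have id: "lrat (\<phi> ` U) {lmul} (\<lambda>z. z)" unfolding lrat_def by (rule rat_base) simp
      have "lrat (\<phi> ` U) {lmul} \<kappa>"
        unfolding \<kappa>_def by (intro lrat_compose lrat_const lrat_orbit_param id) (use domain in \<open>auto simp: image \<Omega>_def\<close>)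
      from rat_smooth_on[OF differentially_closed_linear[OF bounded_linear_lmul] rat_lmul[OF this]
          bounded_linear_apply_blinfun[of id_blinfun]]
      show ?thesis by simp
    qed
    then show "smooth_on compact_sa_ops (\<phi> ` U) (inv_into U \<phi>)"
      by (rule smooth_on_cong) (simp add: inv)
    show "off_diag \<subseteq> compact_sa_ops" by (auto simp: off_diag_def)
    show "\<phi> ` (U \<inter> unitary_orbit A) = \<phi> ` U \<inter> off_diag"
    proof (intro equalityI subsetI)
      fix y assume "y \<in> \<phi> ` (U \<inter> unitary_orbit A)"
      then obtain B where B: "B \<in> U" "B \<in> unitary_orbit A" "y = \<phi> B" by blast
      have "orbit_param y \<in> unitary_orbit A"
        using conj_mem_orbit[OF unitary_fredholm_radj[OF u] B(2)] \<phi>(3)[OF B(1)] B(3) by simp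
      then have "diag y = 0" using \<phi>[OF B(1)] B(3) diag_eq_0 by blast
      then show "y \<in> \<phi> ` U \<inter> off_diag" using B \<phi>(1)[OF B(1)] by (simp add: off_diag_def)
    next
      fix y assume y: "y \<in> \<phi> ` U \<inter> off_diag"
      then have y': "y \<in> compact_sa_ops" "norm y < r" "diag y = 0"
        by (auto simp: image \<Omega>_def off_diag_def)
      have "A \<in> unitary_orbit A"
        unfolding unitary_orbit_eq by (rule image_eqI[OF _ unitary_fredholm_id]) simp
      then have "orbit_param y \<in> unitary_orbit A"
        using orbit_param_mem(2)[OF y'(1) domain(1)[OF y'(2)]] y'(3) by simp
      then have "\<kappa> y \<in> unitary_orbit A" unfolding \<kappa>_def by (rule conj_mem_orbit[OF u])
      then show "y \<in> \<phi> ` (U \<inter> unitary_orbit A)" using y \<kappa>\<phi> by force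
    qed
  qed
qed

lemma submanifold_orbit: "submanifold (orbit_space A) (unitary_orbit A)"
  unfolding submanifold_def
proof (intro conjI orbit_subset ballI)
  fix x assume "x \<in> unitary_orbit A"
  then obtain u where u: "u \<in> unitary_fredholm" "x = u o\<^sub>L A o\<^sub>L radj u" using unitary_orbit_eq by auto
  show "\<exists>U \<phi> F. submanifold_chart (orbit_space A) (unitary_orbit A) x U \<phi> F"
    unfolding u(2) by (intro exI, rule orbit_submanifold_chart[OF u(1)])
qed

text \<open>In the chart a curve in the orbit runs in the closed subspace \<^const>\<open>off_diag\<close>, and so does its velocity.
  Conversely, the orbit map takes Cayley curves to curves with the required velocity.\<close>

lemma tangent_space_orbit:
  fixes u :: "'a \<Rightarrow>\<^sub>L 'a"
  assumes u: "u \<in> unitary_fredholm"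
  shows "tangent_space (unitary_orbit A) (u o\<^sub>L A o\<^sub>L radj u) = (\<lambda>f. u o\<^sub>L f o\<^sub>L radj u) ` off_diag"
proof (intro equalityI subsetI)
  note uD = unitary_fredholmD[OF u]
  fix v assume "v \<in> tangent_space (unitary_orbit A) (u o\<^sub>L A o\<^sub>L radj u)"
  then obtain \<gamma> e where \<gamma>: "e > 0" "\<gamma> ` {-e<..<e} \<subseteq> unitary_orbit A" "\<gamma> 0 = u o\<^sub>L A o\<^sub>L radj u"
      "(\<gamma> has_vector_derivative v) (at 0)"
    unfolding tangent_space_def smooth_curve_def by blast
  define z where "z t = (radj u o\<^sub>L \<gamma> t o\<^sub>L u) - A" for t
  have z0: "z 0 = 0" by (simp add: z_def \<gamma>(3) compose_assoc uD)
  have conj: "bounded_linear (\<lambda>B. radj u o\<^sub>L B o\<^sub>L u)" by (rule bounded_linear_sandwich)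
  have z': "(z has_vector_derivative (radj u o\<^sub>L v o\<^sub>L u)) (at 0)"
    using has_vector_derivative_diff[OF bounded_linear.has_vector_derivative[OF conj \<gamma>(4)] has_vector_derivative_const, of A]
    by (simp add: z_def[abs_def])
  have "isCont z 0" by (rule has_vector_derivative_continuous[OF z'])
  then obtain d where d: "d > 0" "\<And>t. norm t < d \<Longrightarrow> norm (z t) < r / 2"
    unfolding continuous_at_eps_delta dist_norm z0 using r_pos by (metis diff_zero half_gt_zero)
  define e' where "e' = min d e"
  have e': "e' > 0" "e' \<le> d" "e' \<le> e" using d(1) \<gamma>(1) by (auto simp: e'_def)
  have orb: "\<gamma> t \<in> unitary_orbit A" if "t \<in> {-e'<..<e'}" for t
  proof -
    have "t \<in> {-e<..<e}" using that e' by auto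
    then show ?thesis using \<gamma>(2) by blast
  qed
  have zW: "z t \<in> W" if "t \<in> {-e'<..<e'}" for t
  proof -
    have "norm t < d" using that e' by auto
    moreover have "\<gamma> t - A \<in> compact_sa_ops" using orb[OF that] orbit_subset mem_orbit_space by blast
    ultimately show ?thesis using d(2) conj_unitary[OF u] by (simp add: z_def)
  qed
  define y where "y t = g (z t)" for t
  have y_mem: "y t \<in> off_diag" if t: "t \<in> {-e'<..<e'}" for t
  proof -
    have "orbit_param (y t) = radj u o\<^sub>L \<gamma> t o\<^sub>L u" using g(3)[of "z t"] zW[OF t] by (simp add: y_def z_def)
    then have "orbit_param (y t) \<in> unitary_orbit A"
      using conj_mem_orbit[OF unitary_fredholm_radj[OF u] orb[OF t]] by simp
    then show ?thesis using g(1,2)[of "z t"] zW[OF t] diag_eq_0 by (simp add: off_diag_def y_def)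
  qed
  have "0 \<in> W" using r_pos by (simp add: subspace_0[OF subspace_compact_sa_ops])
  have g0: "g 0 = 0"
    using g_orbit_param[OF subspace_0[OF subspace_compact_sa_ops]] r_pos by simp
  have g': "(g has_derivative id_blinfun) (at (z 0) within z ` {-e'<..<e'})"
  proof (rule has_derivative_subset)
    show "(g has_derivative id_blinfun) (at (z 0) within W)"
      using g_has_derivative[of 0] \<open>0 \<in> W\<close> by (simp add: z0 g0 orbit_param_deriv_0)
  qed (use zW in blast)
  have zt: "(z has_derivative (\<lambda>t. t *\<^sub>R (radj u o\<^sub>L v o\<^sub>L u))) (at 0 within {-e'<..<e'})"
    using z' unfolding has_vector_derivative_def by (rule has_derivative_at_withinI)
  have "((\<lambda>t. g (z t)) has_derivative (\<lambda>t. id_blinfun (t *\<^sub>R (radj u o\<^sub>L v o\<^sub>L u)))) (at 0 within {-e'<..<e'})"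
    by (rule has_derivative_in_compose[OF zt g'])
  moreover have "at (0 :: real) within {-e'<..<e'} = at 0" using e' by (intro at_within_open) auto
  ultimately have y': "(y has_vector_derivative (radj u o\<^sub>L v o\<^sub>L u)) (at 0)"
    by (simp add: has_vector_derivative_def y_def[abs_def])
  have "radj u o\<^sub>L v o\<^sub>L u \<in> off_diag"
  proof (rule vector_derivative_in_closed_subspace[OF subspace_off_diag closed_off_diag e'(1) _ y'])
    show "y t - y 0 \<in> off_diag" if "t \<in> {-e'<..<e'}" for t
      using y_mem[OF that] y_mem[of 0] e'(1) subspace_off_diag by (simp add: subspace_diff)
  qed
  moreover have "v = u o\<^sub>L (radj u o\<^sub>L v o\<^sub>L u) o\<^sub>L radj u" by (simp add: compose_assoc uD)
  ultimately show "v \<in> (\<lambda>f. u o\<^sub>L f o\<^sub>L radj u) ` off_diag" by blast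
next
  fix v assume "v \<in> (\<lambda>f. u o\<^sub>L f o\<^sub>L radj u) ` off_diag"
  then obtain x where x: "x \<in> compact_ah_ops" "v = u o\<^sub>L commutator x A o\<^sub>L radj u"
    unfolding commutator_image[symmetric] by blast
  obtain e where e: "e > 0" "\<forall>t\<in>{-e<..<e}. cayley_curve x t \<in> unitary_fredholm"
    "\<forall>u B :: 'a \<Rightarrow>\<^sub>L 'a. smooth_on UNIV {-e<..<e}
      (\<lambda>t. u o\<^sub>L cayley_curve x t o\<^sub>L B o\<^sub>L radj (u o\<^sub>L cayley_curve x t))"
    using cayley_curve_smooth[OF x(1)] by blast
  define \<gamma> where "\<gamma> t = u o\<^sub>L cayley_curve x t" for t
  have U: "\<gamma> t \<in> unitary_fredholm" if "t \<in> {-e<..<e}" for t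
    unfolding \<gamma>_def using e(2) that unitary_fredholm_compose[OF u] by blast
  have "smooth_on UNIV {-e<..<e} (\<lambda>t. \<gamma> t o\<^sub>L A o\<^sub>L radj (\<gamma> t))"
    unfolding \<gamma>_def using e(3) by (simp only: compose_assoc)
  then have "smooth_on UNIV {-e<..<e} (orbit_map A \<circ> \<gamma>)"
    by (rule smooth_on_cong) (simp only: orbit_map_eq[OF U] o_apply)
  moreover have "(orbit_map A \<circ> \<gamma>) ` {-e<..<e} \<subseteq> unitary_orbit A"
    using U unfolding unitary_orbit_def by auto
  moreover have "(orbit_map A \<circ> \<gamma>) 0 = u o\<^sub>L A o\<^sub>L radj u" by (simp add: \<gamma>_def orbit_map_eq[OF u])
  moreover have "(orbit_map A \<circ> \<gamma> has_vector_derivative v) (at 0)"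
  proof -
    have "v = ((u o\<^sub>L x) o\<^sub>L A o\<^sub>L radj u) + (u o\<^sub>L A o\<^sub>L radj (u o\<^sub>L x))"
      using x by (simp add: commutator_def compact_ah_ops_def compose_simps)
    then show ?thesis
      using orbit_map_has_vector_derivative[OF translated_cayley_curve[OF u x(1)], of A]
      by (simp add: \<gamma>_def[abs_def])
  qed
  ultimately have "smooth_curve (unitary_orbit A) (u o\<^sub>L A o\<^sub>L radj u) v (orbit_map A \<circ> \<gamma>)"
    unfolding smooth_curve_def using e(1) by auto
  then show "v \<in> tangent_space (unitary_orbit A) (u o\<^sub>L A o\<^sub>L radj u)"
    unfolding tangent_space_def by (intro CollectI exI)
qed

end

section \<open>The orbit map as a submersion\<close>

lemma closed_complemented_fixed_points:
  assumes V: "subspace V" "closed V" and P: "bounded_linear P"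
    and PV: "\<And>x. x \<in> V \<Longrightarrow> P x \<in> V" and PP: "\<And>x. x \<in> V \<Longrightarrow> P (P x) = P x"
  shows "closed_complemented V {x \<in> V. P x = x}"
proof -
  interpret P: bounded_linear P by fact
  have cont: "continuous_on UNIV P" by (rule linear_continuous_on[OF P])
  show ?thesis
    unfolding closed_complemented_def
  proof (intro conjI exI[of _ "{x \<in> V. P x = 0}"])
    show "subspace {x \<in> V. P x = x}" "subspace {x \<in> V. P x = 0}"
      using V(1) by (auto simp: subspace_def P.add P.scaleR P.zero)
    have "closed (V \<inter> {x. P x = x})" "closed (V \<inter> {x. P x = 0})"
      by (intro closed_Int V(2) closed_Collect_eq cont continuous_intros)+
    then show "closed {x \<in> V. P x = x}" "closed {x \<in> V. P x = 0}" by (simp_all add: Int_def)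
    show "{x \<in> V. P x = x} \<inter> {x \<in> V. P x = 0} = {0}"
      using subspace_0[OF V(1)] by (auto simp: P.zero)
    show "V = {w + c |w c. w \<in> {x \<in> V. P x = x} \<and> c \<in> {x \<in> V. P x = 0}}"
    proof (intro equalityI subsetI)
      fix x assume x: "x \<in> V"
      then have "P x \<in> {x \<in> V. P x = x}" "x - P x \<in> {x \<in> V. P x = 0}"
        using PV PP V(1) by (simp_all add: subspace_diff P.diff)
      moreover have "x = P x + (x - P x)" by simp
      ultimately show "x \<in> {w + c |w c. w \<in> {x \<in> V. P x = x} \<and> c \<in> {x \<in> V. P x = 0}}" by blast
    qed (use V(1) in \<open>auto simp: subspace_add\<close>)
  qed auto
qed

lemma unitary_fredholm_inverse:
  assumes "s \<in> unitary_fredholm"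
  shows "invertible_op s" "inv_op s = radj s"
  using inv_op_eqI[OF unitary_fredholmD(4,5)[OF assms]] by auto

context orbit_chart
begin

text \<open>The projection removes the diagonal part, in the block decomposition conjugated by \<open>u\<close>.\<close>

lemma complemented_tangent_space_orbit:
  fixes u :: "'a \<Rightarrow>\<^sub>L 'a"
  assumes u: "u \<in> unitary_fredholm"
  shows "closed_complemented compact_sa_ops (tangent_space (unitary_orbit A) (u o\<^sub>L A o\<^sub>L radj u))"
proof -
  note uD = unitary_fredholmD[OF u]
  define P where "P v = v - (u o\<^sub>L diag (radj u o\<^sub>L v o\<^sub>L u) o\<^sub>L radj u)" for v
  have "bounded_linear (\<lambda>v. u o\<^sub>L diag (radj u o\<^sub>L v o\<^sub>L u) o\<^sub>L radj u)"
    by (rule bounded_linear_compose[OF bounded_linear_sandwich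
          bounded_linear_compose[OF bounded_linear_diag bounded_linear_sandwich]])
  then have P: "bounded_linear P"
    unfolding P_def by (rule bounded_linear_sub[OF bounded_linear_ident])
  have conj: "radj u o\<^sub>L v o\<^sub>L u \<in> compact_sa_ops" if "v \<in> compact_sa_ops" for v
    using conj_compact_sa[OF unitary_fredholm_radj[OF u] that] by simp
  have PV: "P v \<in> compact_sa_ops" if "v \<in> compact_sa_ops" for v
    unfolding P_def
    by (intro subspace_diff[OF subspace_compact_sa_ops] conj_compact_sa[OF u] diag_compact_sa conj that)
  have conj_P: "radj u o\<^sub>L P v o\<^sub>L u = (radj u o\<^sub>L v o\<^sub>L u) - diag (radj u o\<^sub>L v o\<^sub>L u)" for v
    by (simp add: P_def compose_simps uD)
  have PP: "P (P v) = P v" for v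
    unfolding P_def[of "P v"] conj_P by (simp add: diag_simps)
  have "(\<lambda>f. u o\<^sub>L f o\<^sub>L radj u) ` off_diag = {v \<in> compact_sa_ops. P v = v}"
  proof (intro equalityI subsetI)
    fix v assume "v \<in> (\<lambda>f. u o\<^sub>L f o\<^sub>L radj u) ` off_diag"
    then obtain f where f: "f \<in> compact_sa_ops" "diag f = 0" "v = u o\<^sub>L f o\<^sub>L radj u"
      by (auto simp: off_diag_def)
    have "radj u o\<^sub>L v o\<^sub>L u = f" by (simp add: f(3) compose_assoc uD)
    then show "v \<in> {v \<in> compact_sa_ops. P v = v}"
      using conj_compact_sa[OF u f(1)] f by (simp add: P_def)
  next
    fix v assume v: "v \<in> {v \<in> compact_sa_ops. P v = v}"
    then have "diag (radj u o\<^sub>L v o\<^sub>L u) = 0" using conj_P[of v] by simp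
    then have "radj u o\<^sub>L v o\<^sub>L u \<in> off_diag" using v conj by (simp add: off_diag_def)
    moreover have "v = u o\<^sub>L (radj u o\<^sub>L v o\<^sub>L u) o\<^sub>L radj u" by (simp add: compose_assoc uD)
    ultimately show "v \<in> (\<lambda>f. u o\<^sub>L f o\<^sub>L radj u) ` off_diag" by blast
  qed
  then show ?thesis
    unfolding tangent_space_orbit[OF u]
    using closed_complemented_fixed_points[OF subspace_compact_sa_ops closed_compact_sa_ops P PV PP] by simp
qed

text \<open>The operators that commute with \<open>A\<close> are the block diagonal ones, so the projection onto the kernel takes
  the diagonal part.\<close>

lemma complemented_kernel:
  fixes u :: "'a \<Rightarrow>\<^sub>L 'a"
  assumes u: "u \<in> unitary_fredholm"
  shows "closed_complemented (tangent_space unitary_fredholm u)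
    {v \<in> tangent_space unitary_fredholm u. differential unitary_fredholm (orbit_map A) u v = 0}"
proof -
  note uD = unitary_fredholmD[OF u]
  let ?V = "tangent_space unitary_fredholm u"
  have mem: "v \<in> ?V \<longleftrightarrow> radj u o\<^sub>L v \<in> compact_ah_ops" for v
  proof
    assume "radj u o\<^sub>L v \<in> compact_ah_ops"
    moreover have "v = u o\<^sub>L (radj u o\<^sub>L v)" by (simp add: uD)
    ultimately show "v \<in> ?V" unfolding tangent_space_unitary_fredholm[OF u] by blast
  qed (auto simp: tangent_space_unitary_fredholm[OF u] uD)
  have lin: "bounded_linear (\<lambda>v. radj u o\<^sub>L v)"
    by (rule bounded_bilinear.bounded_linear_right[OF bounded_bilinear_blinfun_compose])
  have V_eq: "?V = (\<lambda>v. radj u o\<^sub>L v) -` compact_ah_ops" using mem by auto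
  have V: "subspace ?V" "closed ?V"
    unfolding V_eq
    by (rule linear_subspace_vimage[OF bounded_linear.linear[OF lin] subspace_compact_ah_ops])
      (intro closed_vimage closed_compact_ah_ops linear_continuous_on lin)
  define P where "P v = u o\<^sub>L diag (radj u o\<^sub>L v)" for v
  have P: "bounded_linear P"
    unfolding P_def
    by (rule bounded_linear_compose[OF bounded_bilinear.bounded_linear_right[OF bounded_bilinear_blinfun_compose]
          bounded_linear_compose[OF bounded_linear_diag lin]])
  have PV: "P v \<in> ?V" if "v \<in> ?V" for v
    using that diag_compact_ah unfolding mem by (simp add: P_def uD)
  have PP: "P (P v) = P v" for v by (simp add: P_def uD)
  have ker: "differential unitary_fredholm (orbit_map A) u v = 0 \<longleftrightarrow> P v = v" if v: "v \<in> ?V" for v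
  proof -
    obtain x where x: "x \<in> compact_ah_ops" "v = u o\<^sub>L x"
      using v unfolding tangent_space_unitary_fredholm[OF u] by blast
    have cancel: "u o\<^sub>L a o\<^sub>L radj u = 0 \<Longrightarrow> a = 0" for a
    proof -
      assume "u o\<^sub>L a o\<^sub>L radj u = 0"
      then have "radj u o\<^sub>L (u o\<^sub>L a o\<^sub>L radj u) o\<^sub>L u = 0" by simp
      then show "a = 0" by (simp add: compose_assoc uD)
    qed
    have "differential unitary_fredholm (orbit_map A) u v = 0 \<longleftrightarrow> commutator x A = 0"
      unfolding x(2) differential_orbit_map[OF u x(1)] using cancel by auto
    also have "\<dots> \<longleftrightarrow> diag x = x" by (rule commutator_eq_0_iff)
    also have "\<dots> \<longleftrightarrow> u o\<^sub>L diag x = u o\<^sub>L x" by (metis uD(6))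
    finally show ?thesis by (simp add: P_def x(2) uD)
  qed
  have "{v \<in> ?V. differential unitary_fredholm (orbit_map A) u v = 0} = {v \<in> ?V. P v = v}"
    using ker by blast
  then show ?thesis using closed_complemented_fixed_points[OF V P PV PP] by simp
qed

lemma differential_image:
  fixes u :: "'a \<Rightarrow>\<^sub>L 'a"
  assumes u: "u \<in> unitary_fredholm"
  shows "differential unitary_fredholm (orbit_map A) u ` tangent_space unitary_fredholm u
    = tangent_space (unitary_orbit A) (orbit_map A u)"
proof -
  have "differential unitary_fredholm (orbit_map A) u ` tangent_space unitary_fredholm u
      = (\<lambda>x. u o\<^sub>L commutator x A o\<^sub>L radj u) ` compact_ah_ops"
    unfolding tangent_space_unitary_fredholm[OF u] image_image
    by (intro image_cong refl differential_orbit_map[OF u])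
  also have "\<dots> = (\<lambda>f. u o\<^sub>L f o\<^sub>L radj u) ` off_diag"
    unfolding commutator_image[symmetric] image_image ..
  finally show ?thesis by (simp only: orbit_map_eq[OF u] tangent_space_orbit[OF u])
qed

text \<open>Since the charts at \<open>u\<close> and at its image are translates, the orbit map reads
  \<open>y \<mapsto> g (cayley y A cayley (-y) - A)\<close> in them, independently of \<open>u\<close>. The adjoint has disappeared
  because \<open>y\<close> is anti-hermitian, which leaves a rational expression inside \<open>g\<close>.\<close>

lemma smooth_orbit_map:
  "smooth_map unitary_fredholm_space unitary_fredholm (orbit_space A) (unitary_orbit A) (orbit_map A)"
  unfolding smooth_map_def
proof (intro conjI ballI)
  show "orbit_map A ` unitary_fredholm \<subseteq> unitary_orbit A" by (simp add: unitary_orbit_def)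
  fix u :: "'a \<Rightarrow>\<^sub>L 'a" assume u: "u \<in> unitary_fredholm"
  note uD = unitary_fredholmD[OF u]
  define S where "S = {w. invertible_op (radj u o\<^sub>L w)}"
  define f where "f w = norm (((radj u o\<^sub>L w) o\<^sub>L A o\<^sub>L inv_op (radj u o\<^sub>L w)) - A)" for w
  define N where "N = S \<inter> f -` {..<r / 2}"
  have "open ((\<lambda>w. radj u o\<^sub>L w) -` {T. invertible_op T})"
    by (intro open_vimage open_invertible continuous_intros)
  then have S: "open S" by (simp add: S_def vimage_def)
  have "continuous_on S (\<lambda>w. inv_op (radj u o\<^sub>L w))"
    by (rule continuous_on_compose2[OF continuous_on_inv_op]) (auto simp: S_def intro!: continuous_intros)
  then have "continuous_on S f" unfolding f_def by (intro continuous_intros)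
  then have N: "open N" unfolding N_def using S by (rule continuous_open_preimage) simp
  have uN: "u \<in> N" using r_pos by (simp add: N_def S_def f_def uD)
  define U where "U = {w \<in> unitary_fredholm_space. w \<in> N \<and> invertible_op (id_blinfun + (radj u o\<^sub>L w))}"
  define \<phi> where "\<phi> w = cayley (radj u o\<^sub>L w)" for w
  have chart: "submanifold_chart unitary_fredholm_space unitary_fredholm u U \<phi> compact_ah_ops"
    unfolding U_def \<phi>_def[abs_def] by (rule unitary_fredholm_chart(1)[OF u N uN])
  have inv: "inv_into U \<phi> y = u o\<^sub>L cayley y" "invertible_op (id_blinfun + y)" if "y \<in> \<phi> ` U" for y
    using unitary_fredholm_chart(2)[OF u N uN, of y] that unfolding U_def \<phi>_def[abs_def] by blast+
  define Y where "Y = {B \<in> orbit_space A. norm ((radj u o\<^sub>L B o\<^sub>L u) - A) < r / 2}"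
  define \<psi> where "\<psi> B = g ((radj u o\<^sub>L B o\<^sub>L u) - A)" for B
  have chart': "submanifold_chart (orbit_space A) (unitary_orbit A) (orbit_map A u) Y \<psi> off_diag"
    unfolding Y_def \<psi>_def[abs_def] orbit_map_eq[OF u] by (rule orbit_submanifold_chart[OF u])
  have conj: "radj u o\<^sub>L orbit_map A w o\<^sub>L u = (radj u o\<^sub>L w) o\<^sub>L A o\<^sub>L inv_op (radj u o\<^sub>L w)"
    if w: "w \<in> unitary_fredholm" for w
    using unitary_fredholm_inverse(2)[OF unitary_fredholm_compose[OF unitary_fredholm_radj[OF u] w]]
    by (simp add: orbit_map_eq[OF w] compose_assoc)
  have into: "orbit_map A ` (U \<inter> unitary_fredholm) \<subseteq> Y"
  proof
    fix B assume "B \<in> orbit_map A ` (U \<inter> unitary_fredholm)"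
    then obtain w where w: "w \<in> U" "w \<in> unitary_fredholm" "B = orbit_map A w" by blast
    have "B \<in> orbit_space A" using w orbit_subset unfolding unitary_orbit_def by blast
    then show "B \<in> Y" using w(1) conj[OF w(2)] by (simp add: Y_def w(3) U_def N_def f_def)
  qed
  let ?X = "\<phi> ` (U \<inter> unitary_fredholm)"
  have X: "y \<in> compact_ah_ops" "y \<in> \<phi> ` U" if "y \<in> ?X" for y
    using chart that unfolding submanifold_chart_def by blast+
  have dom: "y \<in> cayley_domain" if y: "y \<in> ?X" for y
  proof -
    have p: "invertible_op (id_blinfun + y)" by (rule inv(2)[OF X(2)[OF y]])
    moreover have "invertible_op (id_blinfun - y)"
      using invertible_op_radj(1)[OF p] X(1)[OF y] by (simp add: compact_ah_ops_def radj_add)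
    ultimately show ?thesis by simp
  qed
  have orb: "(radj u o\<^sub>L orbit_map A (inv_into U \<phi> y) o\<^sub>L u) = cayley_conj y A"
      "cayley_conj y A - A \<in> W" if y: "y \<in> ?X" for y
  proof -
    have w: "inv_into U \<phi> y = u o\<^sub>L cayley y" by (rule inv(1)[OF X(2)[OF y]])
    have c: "cayley y \<in> unitary_fredholm" "radj (cayley y) = cayley (- y)"
      using cayley_unitary_fredholm[OF X(1)[OF y]] dom[OF y] by auto
    have wU: "u o\<^sub>L cayley y \<in> U" using inv_into_into[OF X(2)[OF y]] by (simp add: w)
    have s: "radj u o\<^sub>L (u o\<^sub>L cayley y) = cayley y" by (rule uD(6))
    show eq: "(radj u o\<^sub>L orbit_map A (inv_into U \<phi> y) o\<^sub>L u) = cayley_conj y A"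
      unfolding w conj[OF unitary_fredholm_compose[OF u c(1)]] s
      by (simp add: unitary_fredholm_inverse(2)[OF c(1)] c(2) cayley_conj_def)
    have "cayley_conj y A - A \<in> compact_sa_ops"
      using conj_A_diff[OF c(1)] by (simp add: cayley_conj_def c(2))
    moreover have "norm (cayley_conj y A - A) < r / 2"
      using wU unfolding U_def N_def f_def
      by (simp add: s unitary_fredholm_inverse(2)[OF c(1)] c(2) cayley_conj_def)
    ultimately show "cayley_conj y A - A \<in> W" by simp
  qed
  have "smooth_on compact_ah_ops ?X (\<lambda>y. g (cayley_conj y A - A))"
  proof (rule smooth_on_g_comp[OF orb(2)])
    fix y assume y: "y \<in> ?X"
    have "((\<lambda>y. cayley_conj y A) has_derivative
        (\<lambda>h. cayley_conj_deriv y A h + (cayley y o\<^sub>L 0 o\<^sub>L cayley (- y)))) (at y)"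
      by (rule cayley_conj_has_derivative[OF has_derivative_ident has_derivative_const dom[OF y]])
    from has_derivative_diff[OF has_derivative_at_withinI[OF this] has_derivative_const]
    have "((\<lambda>y. cayley_conj y A - A) has_derivative
        (\<lambda>h. cayley_conj_deriv y A h + (cayley y o\<^sub>L 0 o\<^sub>L cayley (- y)) - 0)) (at y within ?X)" .
    then show "((\<lambda>y. cayley_conj y A - A) has_derivative cayley_conj_deriv y A) (at y within ?X)" by simp
  next
    have "lrat ?X {lmul} (\<lambda>z. z)" unfolding lrat_def by (rule rat_base) simp
    then show "rat ?X {lmul} {} (\<lambda>z vs. cayley_conj_deriv z A)"
      by (rule rat_cayley_conj_deriv[OF _ lrat_const dom])
  qed
  then have "smooth_on compact_ah_ops ?X (\<psi> \<circ> orbit_map A \<circ> inv_into U \<phi>)"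
    by (rule smooth_on_cong) (simp add: \<psi>_def orb(1))
  then show "\<exists>U \<phi> F W \<psi> G. submanifold_chart unitary_fredholm_space unitary_fredholm u U \<phi> F \<and>
      submanifold_chart (orbit_space A) (unitary_orbit A) (orbit_map A u) W \<psi> G \<and>
      orbit_map A ` (U \<inter> unitary_fredholm) \<subseteq> W \<and>
      smooth_on F (\<phi> ` (U \<inter> unitary_fredholm)) (\<psi> \<circ> orbit_map A \<circ> inv_into U \<phi>)"
    using chart chart' into by blast
qed

theorem complemented_submanifold_orbit: "complemented_submanifold (orbit_space A) (unitary_orbit A)"
  unfolding complemented_submanifold_def direction_orbit_space
  using submanifold_orbit complemented_tangent_space_orbit by (auto simp: unitary_orbit_eq)

theorem submersion_orbit_map:
  "submersion unitary_fredholm_space unitary_fredholm (orbit_space A) (unitary_orbit A) (orbit_map A)"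
  unfolding submersion_def using smooth_orbit_map differential_image complemented_kernel by blast

end

theorem theorem4p4:
  fixes A :: "'a::complex_hilbert_space \<Rightarrow>\<^sub>L 'a"
  assumes "selfadjoint A"
  shows "complemented_submanifold (orbit_space A) (unitary_orbit A) \<and>
      submersion unitary_fredholm_space unitary_fredholm (orbit_space A) (unitary_orbit A)
        (orbit_map A)
    \<longleftrightarrow> finite (spectrum A)"
proof
  assume fin: "finite (spectrum A)"
  obtain L p where "finite L"
    "\<forall>a\<in>L. p a \<in> bounded_ops \<and> radj (p a) = p a \<and> A o\<^sub>L p a = a *\<^sub>R p a \<and> p a o\<^sub>L A = a *\<^sub>R p a"
    "\<forall>a\<in>L. \<forall>b\<in>L. p a o\<^sub>L p b = (if a = b then p a else 0)" "(\<Sum>a\<in>L. p a) = id_blinfun"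
    using spectral_decomposition[OF assms fin] by blast
  then interpret finite_resolution A L p
    using assms by unfold_locales (auto simp: selfadjoint_iff)
  obtain r g where "orbit_chart A L p r g" using orbit_chart_exists by blast
  then interpret orbit_chart A L p r g .
  show "complemented_submanifold (orbit_space A) (unitary_orbit A) \<and>
      submersion unitary_fredholm_space unitary_fredholm (orbit_space A) (unitary_orbit A) (orbit_map A)"
    using complemented_submanifold_orbit submersion_orbit_map by blast
qed (use submersion_imp_finite_spectrum[OF assms] in blast)

end
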